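(* Let $\mathbf{X}=L^{1}(\mathbb{R}^{d},dv)$, $\gamma\in(-d,0)$ and $b\in L^{1}(\mathbb{S}^{d-1})$. Then $$\mathbf{X}=\mathrm{Ker}(\mathcal{L})\oplus\overline{\mathrm{Im}(\mathcal{L})},$$ and the $C_0$-semigroup $(V(t))_{t\ge 0}$ generated by the linear Boltzmann operator $\mathcal{L}$ in $\mathbf{X}$ satisfies $$\lim_{t\to\infty}\|V(t)f-\varrho_f\,\mathcal{M}\|_{\mathbf{X}}=0$$ for any nonnegative $f\in\mathbf{X}$, where $\varrho_f=\int_{\mathbb{R}^d}f(v)\,dv$.
   Context: Let $d\ge 2$ and $\mathcal{M}(v)=(2\pi)^{-d/2}\exp(-|v|^2/2)$, $v\in\mathbb{R}^d$. For $v,v_*\in\mathbb{R}^d$ and $\sigma\in\mathbb{S}^{d-1}$ set $v'=\frac{v+v_*}{2}+\frac{|v-v_*|}{2}\sigma$, $v_*'=\frac{v+v_*}{2}-\frac{|v-v_*|}{2}\sigma$ and $\cos\theta=\left\langle \frac{v-v_*}{|v-v_*|},\sigma\right\rangle$. The angular kernel $b:[-1,1]\to[0,\infty)$ is measurable; $b\in L^1(\mathbb{S}^{d-1})$ means $\ell_b=\int_{\mathbb{S}^{d-1}}b(\cos\theta)\,d\sigma<\infty$ (this integral does not depend on $v,v_*$), and it is assumed that $\ell_b>0$. The collision kernel is $B(v-v_*,\sigma)=|v-v_*|^{\gamma}b(\cos\theta)$. Define the gain operator $Kf(v)=\int_{\mathbb{R}^d\times\mathbb{S}^{d-1}}B(v-v_*,\sigma)f(v')\mathcal{M}(v_*')\,dv_*\,d\sigma$,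 the collision frequency $\Sigma(v)=\int_{\mathbb{R}^d\times\mathbb{S}^{d-1}}B(v-v_*,\sigma)\mathcal{M}(v_* )\,dv_*\,d\sigma=\ell_b\int_{\mathbb{R}^d}|v-v_*|^{\gamma}\mathcal{M}(v_* )\,dv_*$, and the linear Boltzmann operator $\mathcal{L}f=Kf-\Sigma f$. For $\gamma\in(-d,0)$, $\mathcal{L}$ is a bounded operator on $L^1(\mathbb{R}^d,dv)$, with domain the whole space. *)

theory Defs
  imports "HOL-Analysis.Analysis"
begin

definition l1_rel :: "('a::euclidean_space \<Rightarrow> real) \<Rightarrow> ('a \<Rightarrow> real) \<Rightarrow> bool" where
  "l1_rel f g \<longleftrightarrow>
     integrable lborel f \<and> integrable lborel g \<and> (AE x in lborel. f x = g x)"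

lemma part_equivp_l1_rel: "part_equivp l1_rel"
proof (rule part_equivpI)
  show "\<exists>f::'a \<Rightarrow> real. l1_rel f f"
    by (rule exI[of _ "\<lambda>_. 0"]) (simp add: l1_rel_def)
  show "symp (l1_rel :: ('a \<Rightarrow> real) \<Rightarrow> _)"
    by (auto simp: symp_def l1_rel_def eq_commute)
  show "transp (l1_rel :: ('a \<Rightarrow> real) \<Rightarrow> _)"
    by (auto simp: transp_def l1_rel_def)
qed

quotient_type (overloaded) 'a l1 = "'a::euclidean_space \<Rightarrow> real" / partial: l1_rel
  morphisms rep_l1 abs_l1
  by (rule part_equivp_l1_rel)

instantiation l1 :: (euclidean_space) real_normed_vector
begin

lift_definition zero_l1 :: "'a l1" is "\<lambda>_. 0"
  by (simp add: l1_rel_def)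

lift_definition plus_l1 :: "'a l1 \<Rightarrow> 'a l1 \<Rightarrow> 'a l1" is "\<lambda>f g x. f x + g x"
  by (auto simp: l1_rel_def)

lift_definition minus_l1 :: "'a l1 \<Rightarrow> 'a l1 \<Rightarrow> 'a l1" is "\<lambda>f g x. f x - g x"
  by (auto simp: l1_rel_def)

lift_definition uminus_l1 :: "'a l1 \<Rightarrow> 'a l1" is "\<lambda>f x. - f x"
  by (auto simp: l1_rel_def)

lift_definition scaleR_l1 :: "real \<Rightarrow> 'a l1 \<Rightarrow> 'a l1" is "\<lambda>c f x. c * f x"
  by (auto simp: l1_rel_def)

lift_definition norm_l1 :: "'a l1 \<Rightarrow> real" is "\<lambda>f. \<integral>x. \<bar>f x\<bar> \<partial>lborel"
  by (auto simp: l1_rel_def intro!: integral_cong_AE)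

definition dist_l1 :: "'a l1 \<Rightarrow> 'a l1 \<Rightarrow> real" where
  "dist_l1 f g = norm (f - g)"

definition sgn_l1 :: "'a l1 \<Rightarrow> 'a l1" where
  "sgn_l1 f = inverse (norm f) *\<^sub>R f"

definition uniformity_l1 :: "('a l1 \<times> 'a l1) filter" where
  "uniformity_l1 = (INF e\<in>{0 <..}. principal {(x, y). dist x y < e})"

definition open_l1 :: "'a l1 set \<Rightarrow> bool" where
  "open_l1 U \<longleftrightarrow> (\<forall>x\<in>U. eventually (\<lambda>(x', y). x' = x \<longrightarrow> y \<in> U) uniformity)"

instance
proof
  fix f g h :: "'a l1" and a c :: real
  show "f + g + h = f + (g + h)"
    by transfer (auto simp: l1_rel_def add.assoc)
  show "f + g = g + f"
    by transfer (auto simp: l1_rel_def add.commute)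
  show "0 + f = f"
    by transfer (auto simp: l1_rel_def)
  show "- f + f = 0"
    by transfer (auto simp: l1_rel_def)
  show "f - g = f + - g"
    by transfer (auto simp: l1_rel_def)
  show "a *\<^sub>R (f + g) = a *\<^sub>R f + a *\<^sub>R g"
    by transfer (auto simp: l1_rel_def algebra_simps)
  show "(a + c) *\<^sub>R f = a *\<^sub>R f + c *\<^sub>R f"
    by transfer (auto simp: l1_rel_def algebra_simps)
  show "a *\<^sub>R c *\<^sub>R f = (a * c) *\<^sub>R f"
    by transfer (auto simp: l1_rel_def algebra_simps)
  show "1 *\<^sub>R f = f"
    by transfer (auto simp: l1_rel_def)
  show "dist f g = norm (f - g)"
    by (rule dist_l1_def)
  show "sgn f = inverse (norm f) *\<^sub>R f"
    by (rule sgn_l1_def)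
  show "uniformity = (INF e\<in>{0 <..}. principal {(x, y :: 'a l1). dist x y < e})"
    by (rule uniformity_l1_def)
  show "open U = (\<forall>x\<in>U. \<forall>\<^sub>F (x', y) in uniformity. x' = x \<longrightarrow> y \<in> U)" for U :: "'a l1 set"
    by (rule open_l1_def)
  show "norm f = 0 \<longleftrightarrow> f = 0"
    by transfer (auto simp: l1_rel_def integral_nonneg_eq_0_iff_AE)
  show "norm (f + g) \<le> norm f + norm g"
  proof transfer
    fix f g :: "'a \<Rightarrow> real"
    assume "l1_rel f f" "l1_rel g g"
    then have i: "integrable lborel f" "integrable lborel g"
      by (auto simp: l1_rel_def)
    have "(\<integral>x. \<bar>f x + g x\<bar> \<partial>lborel) \<le> (\<integral>x. \<bar>f x\<bar> + \<bar>g x\<bar> \<partial>lborel)"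
      using i by (intro integral_mono) auto
    also have "\<dots> = (\<integral>x. \<bar>f x\<bar> \<partial>lborel) + (\<integral>x. \<bar>g x\<bar> \<partial>lborel)"
      using i by (intro Bochner_Integration.integral_add) auto
    finally show "(\<integral>x. \<bar>f x + g x\<bar> \<partial>lborel) \<le> (\<integral>x. \<bar>f x\<bar> \<partial>lborel) + (\<integral>x. \<bar>g x\<bar> \<partial>lborel)" .
  qed
  show "norm (a *\<^sub>R f) = \<bar>a\<bar> * norm f"
    by transfer (simp add: abs_mult)
qed

end

lift_definition l1_integral :: "'a::euclidean_space l1 \<Rightarrow> real" is "\<lambda>f. \<integral>x. f x \<partial>lborel"
  by (auto simp: l1_rel_def intro!: integral_cong_AE)

lift_definition l1_nonneg :: "'a::euclidean_space l1 \<Rightarrow> bool" is "\<lambda>f. AE x in lborel. 0 \<le> f x"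
  by (auto simp: l1_rel_def elim!: AE_mp)

text \<open>Surface measure of the unit sphere, as cone measure: a Borel set \<open>A\<close> of the sphere has
  measure \<open>d\<close> times the volume of \<open>{r *\<^sub>R x | r x. 0 < r \<and> r < 1 \<and> x \<in> A}\<close>.\<close>

definition sphere_measure :: "'a::euclidean_space measure" where
  "sphere_measure =
     scale_measure (of_nat DIM('a))
       (distr (restrict_space lborel (ball 0 1 - {0})) (restrict_space borel (sphere 0 1)) sgn)"

definition maxwellian :: "'a::euclidean_space \<Rightarrow> real" where
  "maxwellian v = (2 * pi) powr (- real DIM('a) / 2) * exp (- (norm v)\<^sup>2 / 2)"

definition post :: "'a::euclidean_space \<Rightarrow> 'a \<Rightarrow> 'a \<Rightarrow> 'a" where
  "post v w \<sigma> = (v + w) /\<^sub>R 2 + (norm (v - w) / 2) *\<^sub>R \<sigma>"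

definition post_star :: "'a::euclidean_space \<Rightarrow> 'a \<Rightarrow> 'a \<Rightarrow> 'a" where
  "post_star v w \<sigma> = (v + w) /\<^sub>R 2 - (norm (v - w) / 2) *\<^sub>R \<sigma>"

definition cos_angle :: "'a::euclidean_space \<Rightarrow> 'a \<Rightarrow> 'a \<Rightarrow> real" where
  "cos_angle v w \<sigma> = ((v - w) /\<^sub>R norm (v - w)) \<bullet> \<sigma>"

text \<open>The value does not depend on the choice of \<open>v \<noteq> w\<close>.\<close>

definition angular_mass :: "(real \<Rightarrow> real) \<Rightarrow> 'a::euclidean_space \<Rightarrow> 'a \<Rightarrow> ennreal" where
  "angular_mass b v w = (\<integral>\<^sup>+\<sigma>. ennreal (b (cos_angle v w \<sigma>)) \<partial>sphere_measure)"

definition coll_kernel ::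
  "real \<Rightarrow> (real \<Rightarrow> real) \<Rightarrow> 'a::euclidean_space \<Rightarrow> 'a \<Rightarrow> 'a \<Rightarrow> real" where
  "coll_kernel \<gamma> b v w \<sigma> = norm (v - w) powr \<gamma> * b (cos_angle v w \<sigma>)"

definition gain ::
  "real \<Rightarrow> (real \<Rightarrow> real) \<Rightarrow> ('a::euclidean_space \<Rightarrow> real) \<Rightarrow> 'a \<Rightarrow> real" where
  "gain \<gamma> b f v =
     (\<integral>(w, \<sigma>). coll_kernel \<gamma> b v w \<sigma> * f (post v w \<sigma>) * maxwellian (post_star v w \<sigma>)
        \<partial>(lborel \<Otimes>\<^sub>M sphere_measure))"

definition coll_freq :: "real \<Rightarrow> (real \<Rightarrow> real) \<Rightarrow> 'a::euclidean_space \<Rightarrow> real" where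
  "coll_freq \<gamma> b v =
     (\<integral>(w, \<sigma>). coll_kernel \<gamma> b v w \<sigma> * maxwellian w \<partial>(lborel \<Otimes>\<^sub>M sphere_measure))"

text \<open>For \<open>- d < \<gamma> < 0\<close> and \<open>f\<close> integrable, the integral defining \<open>gain \<gamma> b f v\<close> converges for
  almost every \<open>v\<close>, and the class of \<open>gain \<gamma> b f - coll_freq \<gamma> b * f\<close> depends only on the class
  of \<open>f\<close>; so the representative picked by \<open>rep_l1\<close> is immaterial.\<close>

definition boltzmann :: "real \<Rightarrow> (real \<Rightarrow> real) \<Rightarrow> 'a::euclidean_space l1 \<Rightarrow> 'a l1" where
  "boltzmann \<gamma> b F = abs_l1 (\<lambda>v. gain \<gamma> b (rep_l1 F) v - coll_freq \<gamma> b v * rep_l1 F v)"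

definition c0_semigroup :: "(real \<Rightarrow> 'x::real_normed_vector \<Rightarrow> 'x) \<Rightarrow> bool" where
  "c0_semigroup V \<longleftrightarrow>
     (\<forall>t\<ge>0. bounded_linear (V t)) \<and>
     V 0 = id \<and>
     (\<forall>s\<ge>0. \<forall>t\<ge>0. V (s + t) = V s \<circ> V t) \<and>
     (\<forall>f. ((\<lambda>t. V t f) \<longlongrightarrow> f) (at_right 0))"

definition generator_graph :: "(real \<Rightarrow> 'x::real_normed_vector \<Rightarrow> 'x) \<Rightarrow> ('x \<times> 'x) set" where
  "generator_graph V = {(f, g). ((\<lambda>t. (V t f - f) /\<^sub>R t) \<longlongrightarrow> g) (at_right 0)}"

text \<open>Equality of graphs: the generator has the whole space as its domain.\<close>

definition generates ::
  "('x::real_normed_vector \<Rightarrow> 'x) \<Rightarrow> (real \<Rightarrow> 'x \<Rightarrow> 'x) \<Rightarrow> bool" where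
  "generates A V \<longleftrightarrow> c0_semigroup V \<and> generator_graph V = {(f, A f) |f. True}"

definition is_direct_sum :: "'x::real_vector set \<Rightarrow> 'x set \<Rightarrow> bool" where
  "is_direct_sum A B \<longleftrightarrow>
     subspace A \<and> subspace B \<and> (\<forall>x. \<exists>a\<in>A. \<exists>c\<in>B. x = a + c) \<and> A \<inter> B = {0}"

end

theory Submission
  imports Defs "HOL-Probability.Distributions"
begin

text \<open>
  The collision map \<open>(v, w, \<sigma>) \<mapsto> (v', w', (v - w) / |v - w|)\<close> preserves \<open>dv dw d\<sigma>\<close> and
  \<open>M(v) M(w)\<close>. Hence, writing \<open>f = M h\<close>, the operator becomes symmetric in \<open>L\<^sup>2(M)\<close> with Dirichlet form
  \<open>1/2 \<integral> B M(v) M(w) (h(v') - h(v))\<^sup>2\<close>. For \<open>\<gamma> > - d\<close> the collision frequency is bounded, say by \<open>S\<close>,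
  so \<open>P = 1 + L / (2 S)\<close> is a contraction of \<open>L\<^sup>1\<close>, and on \<open>L\<^sup>2(M)\<close> it is symmetric with spectrum
  in \<open>[0, 1]\<close>. The moments \<open>\<langle>h, P\<^sup>n h\<rangle>\<close> then decrease, which makes \<open>P\<^sup>n h\<close> a Cauchy sequence whose limit
  has vanishing Dirichlet form. Since almost every jump \<open>v' - v\<close> is charged as soon as \<open>b\<close> does not
  vanish identically, such a limit is constant. By density \<open>P\<^sup>n f\<close> tends to \<open>(\<integral> f) M\<close> for every \<open>f\<close> in
  \<open>L\<^sup>1\<close>; this yields the direct sum, and, because \<open>exp (t L)\<close> averages the powers of \<open>P\<close> against a
  Poisson law of mean \<open>2 S t\<close>, also the convergence of the semigroup.
\<close>

text \<open>For gamma < 0 the collision frequency tends to 0 at infinity, so mass placed far out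
  hardly moves for a long time. There is no spectral gap and no rate uniform in the datum; only
  strong convergence can be aimed at, and monotone moments take the place of compactness or a gap.
  The factor 2 in \<open>1 + L / (2 S)\<close> pays for this: with \<open>1 + L / S\<close> the
  spectrum is only known to lie in [-1, 1], and the powers might oscillate. The symmetric calculus
  is carried out on functions bounded at every point, where each pairing is an integral against a
  finite measure, so neither a spectral theorem nor a space L^2 has to be set up; only the limit is
  taken in L^1. On the semigroup side the claim concerns every V generated by the operator. Such a V
  must first be identified with the exponential series, and as strong continuity at 0 is all that is
  known of it, this step rests on uniform boundedness.\<close>

section \<open>Semigroups with bounded generator\<close>

text \<open>Endomorphisms get a type of their own because blinfun, having two type arguments,
  cannot be made an instance of the algebra classes that \<^const>\<open>exp\<close> needs.\<close>

typedef (overloaded) 'a bop = "UNIV :: ('a::real_normed_vector \<Rightarrow>\<^sub>L 'a) set"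
  morphisms blinfun_of_bop bop_of_blinfun by simp

setup_lifting type_definition_bop

instantiation bop :: (real_normed_vector) real_normed_vector
begin

lift_definition zero_bop :: "'a bop" is 0 .
lift_definition plus_bop :: "'a bop \<Rightarrow> 'a bop \<Rightarrow> 'a bop" is "(+)" .
lift_definition minus_bop :: "'a bop \<Rightarrow> 'a bop \<Rightarrow> 'a bop" is "(-)" .
lift_definition uminus_bop :: "'a bop \<Rightarrow> 'a bop" is uminus .
lift_definition scaleR_bop :: "real \<Rightarrow> 'a bop \<Rightarrow> 'a bop" is scaleR .
lift_definition norm_bop :: "'a bop \<Rightarrow> real" is norm .

definition dist_bop :: "'a bop \<Rightarrow> 'a bop \<Rightarrow> real" where
  "dist_bop f g = norm (f - g)"
definition sgn_bop :: "'a bop \<Rightarrow> 'a bop" where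
  "sgn_bop f = inverse (norm f) *\<^sub>R f"
definition uniformity_bop :: "('a bop \<times> 'a bop) filter" where
  "uniformity_bop = (INF e\<in>{0 <..}. principal {(x, y). dist x y < e})"
definition open_bop :: "'a bop set \<Rightarrow> bool" where
  "open_bop U \<longleftrightarrow> (\<forall>x\<in>U. eventually (\<lambda>(x', y). x' = x \<longrightarrow> y \<in> U) uniformity)"

instance
proof
  fix f g h :: "'a bop" and a c :: real
  show "f + g + h = f + (g + h)" by transfer (rule add.assoc)
  show "f + g = g + f" by transfer (rule add.commute)
  show "0 + f = f" by transfer simp
  show "- f + f = 0" by transfer simp
  show "f - g = f + - g" by transfer simp
  show "a *\<^sub>R (f + g) = a *\<^sub>R f + a *\<^sub>R g" by transfer (rule scaleR_add_right)
  show "(a + c) *\<^sub>R f = a *\<^sub>R f + c *\<^sub>R f" by transfer (rule scaleR_add_left)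
  show "a *\<^sub>R c *\<^sub>R f = (a * c) *\<^sub>R f" by transfer simp
  show "1 *\<^sub>R f = f" by transfer simp
  show "dist f g = norm (f - g)" by (rule dist_bop_def)
  show "sgn f = inverse (norm f) *\<^sub>R f" by (rule sgn_bop_def)
  show "uniformity = (INF e\<in>{0 <..}. principal {(x, y :: 'a bop). dist x y < e})"
    by (rule uniformity_bop_def)
  show "open U = (\<forall>x\<in>U. \<forall>\<^sub>F (x', y) in uniformity. x' = x \<longrightarrow> y \<in> U)" for U :: "'a bop set"
    by (rule open_bop_def)
  show "norm f = 0 \<longleftrightarrow> f = 0" by transfer simp
  show "norm (f + g) \<le> norm f + norm g" by transfer (rule norm_triangle_ineq)
  show "norm (a *\<^sub>R f) = \<bar>a\<bar> * norm f" by transfer simp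
qed

end

instantiation bop :: (real_normed_vector) real_normed_algebra
begin

lift_definition times_bop :: "'a bop \<Rightarrow> 'a bop \<Rightarrow> 'a bop" is blinfun_compose .

instance
proof
  fix f g h :: "'a bop" and a c :: real
  show "f * g * h = f * (g * h)" by transfer (auto intro: blinfun_eqI)
  show "(f + g) * h = f * h + g * h"
    by transfer (auto intro!: blinfun_eqI simp: blinfun.bilinear_simps)
  show "f * (g + h) = f * g + f * h"
    by transfer (auto intro!: blinfun_eqI simp: blinfun.bilinear_simps)
  show "a *\<^sub>R f * g = a *\<^sub>R (f * g)"
    by transfer (auto intro!: blinfun_eqI simp: blinfun.bilinear_simps)
  show "f * a *\<^sub>R g = a *\<^sub>R (f * g)"
    by transfer (auto intro!: blinfun_eqI simp: blinfun.bilinear_simps)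
  show "norm (f * g) \<le> norm f * norm g"
    by transfer (rule norm_blinfun_compose)
qed

end

text \<open>\<open>perfect_space\<close> rules out the zero space, on which the identity has norm 0
  and coincides with the zero operator.\<close>

instantiation bop :: ("{real_normed_vector, perfect_space}") real_normed_algebra_1
begin

lift_definition one_bop :: "'a bop" is id_blinfun .

instance
proof
  fix f :: "'a bop"
  show "1 * f = f" by transfer (auto intro: blinfun_eqI)
  show "f * 1 = f" by transfer (auto intro: blinfun_eqI)
  show n1: "norm (1 :: 'a bop) = 1" by transfer simp
  have "norm (0 :: 'a bop) \<noteq> norm (1 :: 'a bop)" using n1 by simp
  then show "(0 :: 'a bop) \<noteq> 1" by metis
qed

end

instance bop :: (banach) banach
proof
  fix X :: "nat \<Rightarrow> 'a bop"
  have dist: "dist (blinfun_of_bop x) (blinfun_of_bop y) = dist x y" for x y :: "'a bop"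
    by (simp add: dist_norm minus_bop.rep_eq norm_bop.rep_eq)
  assume "Cauchy X"
  then have "Cauchy (\<lambda>n. blinfun_of_bop (X n))"
    by (simp add: Cauchy_def dist)
  then obtain L where "(\<lambda>n. blinfun_of_bop (X n)) \<longlonglongrightarrow> L"
    by (auto simp: Cauchy_convergent_iff convergent_def)
  then have "X \<longlonglongrightarrow> bop_of_blinfun L"
    by (simp add: tendsto_iff flip: dist) (simp add: bop_of_blinfun_inverse)
  then show "convergent X" by (rule convergentI)
qed

lift_definition bop_apply :: "'a bop \<Rightarrow> 'a::real_normed_vector \<Rightarrow> 'a" is blinfun_apply .

lift_definition bop_of :: "('a \<Rightarrow> 'a) \<Rightarrow> 'a::real_normed_vector bop" is Blinfun .

lemma bop_apply_of: "bounded_linear A \<Longrightarrow> bop_apply (bop_of A) = A"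
  by transfer (rule bounded_linear_Blinfun_apply)

lemma norm_bop_apply: "norm (bop_apply F x) \<le> norm F * norm x"
  by transfer (rule norm_blinfun)

lemma bounded_bilinear_bop_apply: "bounded_bilinear bop_apply"
proof
  fix F G :: "'a bop" and x y :: 'a and r :: real
  show "bop_apply (F + G) x = bop_apply F x + bop_apply G x"
    by transfer (simp add: blinfun.bilinear_simps)
  show "bop_apply F (x + y) = bop_apply F x + bop_apply F y"
    by transfer (simp add: blinfun.bilinear_simps)
  show "bop_apply (r *\<^sub>R F) x = r *\<^sub>R bop_apply F x"
    by transfer (simp add: blinfun.bilinear_simps)
  show "bop_apply F (r *\<^sub>R x) = r *\<^sub>R bop_apply F x"
    by transfer (simp add: blinfun.bilinear_simps)
  show "\<exists>K. \<forall>(F::'a bop) x. norm (bop_apply F x) \<le> norm F * norm x * K"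
    by (rule exI[of _ 1]) (simp add: norm_bop_apply)
qed

interpretation bop: bounded_bilinear bop_apply
  by (rule bounded_bilinear_bop_apply)

lemma bop_apply_mult [simp]: "bop_apply (F * G) x = bop_apply F (bop_apply G x)"
  by transfer simp

lemma bop_apply_one [simp]: "bop_apply 1 x = x"
  by transfer simp

lemma bop_apply_power: "bop_apply (F ^ n) x = ((bop_apply F) ^^ n) x"
  by (induction n) auto

section \<open>Uniqueness of the semigroup with a given bounded generator\<close>

lemma uniform_boundedness_principle:
  fixes T :: "nat \<Rightarrow> 'a::banach \<Rightarrow> 'b::real_normed_vector"
  assumes lin: "\<And>n. bounded_linear (T n)" and bdd: "\<And>x. \<exists>C. \<forall>n. norm (T n x) \<le> C"
  shows "\<exists>C. \<forall>n x. norm (T n x) \<le> C * norm x"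
proof -
  define F where "F k = {x. \<forall>n. norm (T n x) \<le> real k}" for k :: nat
  have clF: "closed (F k)" for k
    unfolding F_def
    by (intro closed_Collect_all closed_Collect_le continuous_intros
        bounded_linear.continuous_on[OF lin])
  have UF: "\<Union>(range F) = UNIV"
  proof (intro equalityI subsetI UNIV_I)
    fix x
    obtain C where "\<forall>n. norm (T n x) \<le> C" using bdd by blast
    moreover obtain k where "C \<le> real k" using real_arch_simple[of C] by auto
    ultimately have "x \<in> F k" unfolding F_def by (blast intro: order_trans)
    then show "x \<in> \<Union>(range F)" by blast
  qed
  have "\<exists>k. interior (F k) \<noteq> {}"
  proof (rule ccontr)
    assume no: "\<not> ?thesis"
    have "Met_TC.mcomplete TYPE('a)"
      unfolding Met_TC.mcomplete_def
      by (simp add: Cauchy_convergent_iff convergent_def)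
    then have "(euclidean :: 'a topology) interior_of \<Union>(range F) = {}"
      using Met_TC.metric_Baire_category_alt[of "range F"] no clF
      by (simp add: image_iff) blast
    then show False by (simp add: UF)
  qed
  then obtain k x0 where "x0 \<in> interior (F k)" by blast
  then obtain e where e: "e > 0" "ball x0 e \<subseteq> F k"
    by (meson mem_interior)
  \<comment> \<open>The multiple \<open>y\<close> of \<open>x\<close> with norm e / 2 keeps
    \<open>x0 + y\<close> in the ball. \<open>T n y\<close> is a difference of two values bounded by
    k, and rescaling 2 k by 2 norm x / e gives the constant.\<close>
  have "norm (T n x) \<le> 4 * real k / e * norm x" for n x
  proof (cases "x = 0")
    case True
    then show ?thesis using linear_0[OF bounded_linear.linear[OF lin]] by simp
  next
    case False
    define y where "y = (e / (2 * norm x)) *\<^sub>R x"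
    have "norm y < e" using e False by (simp add: y_def)
    then have "x0 + y \<in> F k" "x0 \<in> F k"
      using e by (auto simp: dist_norm intro!: subsetD[OF e(2)])
    then have "norm (T n (x0 + y)) \<le> k" "norm (T n x0) \<le> k"
      by (auto simp: F_def)
    moreover have "T n y = T n (x0 + y) - T n x0"
      by (simp add: linear_add[OF bounded_linear.linear[OF lin]])
    ultimately have "norm (T n y) \<le> 2 * k"
      using norm_triangle_ineq4[of "T n (x0 + y)" "T n x0"] by simp
    moreover have "T n y = (e / (2 * norm x)) *\<^sub>R T n x"
      unfolding y_def by (rule linear_scale[OF bounded_linear.linear[OF lin]])
    ultimately show ?thesis using e False by (simp add: field_simps)
  qed
  then show ?thesis by blast
qed

text \<open>A failure would supply times \<open>t n\<close> tending to 0 and vectors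
  \<open>x n\<close> that \<open>V (t n)\<close> stretches by more than n. Yet each orbit
  \<open>V (t n) f\<close> converges to f and is therefore bounded, so the uniform boundedness
  principle gives one constant for all n.\<close>

lemma c0_semigroup_locally_bounded:
  fixes V :: "real \<Rightarrow> 'x::banach \<Rightarrow> 'x"
  assumes "c0_semigroup V"
  shows "\<exists>d>0. \<exists>C. \<forall>t\<in>{0..d}. \<forall>x. norm (V t x) \<le> C * norm x"
proof (rule ccontr)
  assume neg: "\<not> ?thesis"
  have "\<exists>t x. t \<in> {0..1 / real (Suc n)} \<and> norm (V t x) > real n * norm x" for n
  proof -
    have "\<not> (\<forall>t\<in>{0..1 / real (Suc n)}. \<forall>x. norm (V t x) \<le> real n * norm x)"
      using neg by (meson zero_less_divide_1_iff of_nat_0_less_iff zero_less_Suc)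
    then show ?thesis by (auto simp: not_le)
  qed
  then obtain t x where tx: "\<And>n. t n \<in> {0..1 / real (Suc n)}"
    "\<And>n. norm (V (t n) (x n)) > real n * norm (x n)"
    by metis
  have t0: "t \<longlonglongrightarrow> 0"
  proof (rule tendsto_sandwich)
    show "\<forall>\<^sub>F n in sequentially. 0 \<le> t n" "\<forall>\<^sub>F n in sequentially. t n \<le> 1 / real (Suc n)"
      using tx(1) by auto
    show "(\<lambda>n. 1 / real (Suc n)) \<longlonglongrightarrow> 0" by (rule LIMSEQ_Suc[OF lim_1_over_n])
  qed simp
  have lin: "bounded_linear (V (t n))" for n
    using assms tx(1)[of n] by (auto simp: c0_semigroup_def)
  have "\<exists>C. \<forall>n. norm (V (t n) f) \<le> C" for f
  proof -
    have "(\<lambda>n. V (t n) f) \<longlonglongrightarrow> f"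
    proof (rule tendstoI)
      fix e :: real assume "e > 0"
      have "((\<lambda>t. V t f) \<longlongrightarrow> f) (at_right 0)" using assms by (auto simp: c0_semigroup_def)
      then have "\<forall>\<^sub>F t in at_right 0. dist (V t f) f < e"
        using \<open>e > 0\<close> by (rule tendstoD)
      then obtain d where d: "d > 0" "\<And>s. 0 < s \<Longrightarrow> s < d \<Longrightarrow> dist (V s f) f < e"
        by (auto simp: eventually_at_right_field)
      \<comment> \<open>Some \<open>t n\<close> may vanish, and the limit from the right says
        nothing about time 0 itself.\<close>
      moreover have "V 0 f = f" using assms by (auto simp: c0_semigroup_def)
      ultimately have d': "0 \<le> s \<Longrightarrow> s < d \<Longrightarrow> dist (V s f) f < e" for s
        using \<open>e > 0\<close> by (cases "s = 0") auto
      have "\<forall>\<^sub>F n in sequentially. t n < d" using t0 d(1) by (rule order_tendstoD)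
      then show "\<forall>\<^sub>F n in sequentially. dist (V (t n) f) f < e"
        by eventually_elim (use d' tx(1) in auto)
    qed
    then have "Bseq (\<lambda>n. V (t n) f)" using convergentI convergent_imp_Bseq by blast
    then show ?thesis by (auto simp: Bseq_def)
  qed
  from uniform_boundedness_principle[OF lin this]
  obtain C where C: "\<And>n x. norm (V (t n) x) \<le> C * norm x" by blast
  obtain n where "C \<le> real n" using real_arch_simple[of C] by auto
  then have "C * norm (x n) \<le> real n * norm (x n)" by (simp add: mult_right_mono)
  with tx(2)[of n] C[of n "x n"] show False by linarith
qed

lemma exp_semigroup_generates:
  fixes A :: "'x::{banach, perfect_space} \<Rightarrow> 'x"
  assumes A: "bounded_linear A"
  shows "generates A (\<lambda>t. bop_apply (exp (t *\<^sub>R bop_of A)))"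
proof -
  define a where "a = bop_of A"
  have a: "bop_apply a = A" by (simp add: a_def bop_apply_of[OF A])
  have der: "((\<lambda>t. bop_apply (exp (t *\<^sub>R a)) f) has_vector_derivative A f) (at 0 within {0<..})" for f
  proof -
    have "((\<lambda>t. exp (t *\<^sub>R a)) has_vector_derivative a) (at 0 within {0<..})"
      using exp_scaleR_has_vector_derivative_right[of a 0 "{0<..}"] by simp
    from bounded_linear.has_vector_derivative[OF bop.bounded_linear_left this] show ?thesis
      by (simp add: a)
  qed
  have lim: "((\<lambda>t. (bop_apply (exp (t *\<^sub>R a)) f - f) /\<^sub>R t) \<longlongrightarrow> A f) (at_right 0)" for f
  proof -
    define u where "u t = bop_apply (exp (t *\<^sub>R a)) f" for t
    have u0: "u 0 = f" by (simp add: u_def)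
    have "((\<lambda>y. (1 / norm (y - 0)) *\<^sub>R (u y - (u 0 + (y - 0) *\<^sub>R A f))) \<longlongrightarrow> 0) (at_right 0)"
      using der[of f] unfolding u_def has_vector_derivative_def has_derivative_within by blast
    then have "((\<lambda>y. (u y - f) /\<^sub>R y - A f) \<longlongrightarrow> 0) (at_right 0)"
    proof (rule Lim_transform_eventually)
      show "\<forall>\<^sub>F y in at_right 0. (1 / norm (y - 0)) *\<^sub>R (u y - (u 0 + (y - 0) *\<^sub>R A f))
          = (u y - f) /\<^sub>R y - A f"
        unfolding eventually_at_filter
        by (rule always_eventually) (auto simp: u0 algebra_simps divide_inverse)
    qed
    then show ?thesis by (simp add: LIM_zero_iff u_def)
  qed
  have "c0_semigroup (\<lambda>t. bop_apply (exp (t *\<^sub>R a)))"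
    unfolding c0_semigroup_def
  proof (intro conjI allI impI)
    show "bounded_linear (bop_apply (exp (t *\<^sub>R a)))" for t
      by (rule bop.bounded_linear_right)
    show "bop_apply (exp (0 *\<^sub>R a)) = id" by auto
    show "bop_apply (exp ((s + t) *\<^sub>R a)) = bop_apply (exp (s *\<^sub>R a)) \<circ> bop_apply (exp (t *\<^sub>R a))" for s t
    proof -
      have "exp ((s + t) *\<^sub>R a) = exp (s *\<^sub>R a) * exp (t *\<^sub>R a)"
        unfolding scaleR_add_left by (rule exp_add_commuting) simp
      then show ?thesis by auto
    qed
    show "((\<lambda>t. bop_apply (exp (t *\<^sub>R a)) f) \<longlongrightarrow> f) (at_right 0)" for f
      using has_vector_derivative_continuous[OF der[of f]] by (simp add: continuous_within)
  qed
  \<comment> \<open>Uniqueness of limits upgrades differentiability at 0 to the equality of graphs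
    that \<open>generates\<close> asks for.\<close>
  moreover have "((\<lambda>t. (bop_apply (exp (t *\<^sub>R a)) f - f) /\<^sub>R t) \<longlongrightarrow> g) (at_right 0) \<longleftrightarrow> g = A f" for f g
    using lim[of f] tendsto_unique[OF trivial_limit_at_right_real _ lim[of f], of g] by auto
  then have "generator_graph (\<lambda>t. bop_apply (exp (t *\<^sub>R a))) = {(f, A f) |f. True}"
    by (auto simp: generator_graph_def)
  ultimately show ?thesis unfolding generates_def a_def by simp
qed

text \<open>Differentiate exp (- s A) (V s f): because A commutes with V s the derivative vanishes,
  and the value at s = t equals f. The work lies in the two-sided derivative of V s f, since the
  generator gives only a right derivative at 0. The quotient to the left of s is an earlier V y
  applied to the quotient at 0, and is controlled by a bound on V that is uniform over
  [0, t].\<close>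

lemma generates_unique:
  fixes A :: "'x::{banach, perfect_space} \<Rightarrow> 'x"
  assumes A: "bounded_linear A" and V: "generates A V" and t: "0 \<le> t"
  shows "V t = bop_apply (exp (t *\<^sub>R bop_of A))"
proof
  fix f
  define a where "a = bop_of A"
  have a: "bop_apply a = A" by (simp add: a_def bop_apply_of[OF A])
  have c0: "c0_semigroup V" using V by (simp add: generates_def)
  have V0: "V 0 x = x" for x using c0 by (simp add: c0_semigroup_def)
  have sg: "V (s + r) x = V s (V r x)" if "0 \<le> s" "0 \<le> r" for s r x
    using c0 that by (simp add: c0_semigroup_def)
  have lin: "bounded_linear (V s)" if "0 \<le> s" for s
    using c0 that by (simp add: c0_semigroup_def)
  have gen: "((\<lambda>h. (V h x - x) /\<^sub>R h) \<longlongrightarrow> A x) (at_right 0)" for x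
    using V by (auto simp: generates_def generator_graph_def set_eq_iff)
  have cont: "((\<lambda>h. V h x) \<longlongrightarrow> x) (at_right 0)" for x
    using c0 by (simp add: c0_semigroup_def)
  have comm: "A (V s x) = V s (A x)" if s: "0 \<le> s" for s x
  proof (rule tendsto_unique[OF _ gen])
    interpret Vs: bounded_linear "V s" using lin[OF s] .
    have "((\<lambda>h. V s ((V h x - x) /\<^sub>R h)) \<longlongrightarrow> V s (A x)) (at_right 0)"
      by (rule Vs.tendsto[OF gen])
    moreover have "\<forall>\<^sub>F h in at_right 0. V s ((V h x - x) /\<^sub>R h) = (V h (V s x) - V s x) /\<^sub>R h"
      unfolding eventually_at_filter
      by (rule always_eventually) (use s in \<open>auto simp: Vs.scaleR Vs.diff sg[symmetric] add.commute\<close>)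
    ultimately show "((\<lambda>h. (V h (V s x) - V s x) /\<^sub>R h) \<longlongrightarrow> V s (A x)) (at_right 0)"
      by (rule Lim_transform_eventually)
  qed simp
  obtain d C where d: "d > 0" and C: "\<And>s x. 0 \<le> s \<Longrightarrow> s \<le> d \<Longrightarrow> norm (V s x) \<le> C * norm x"
    using c0_semigroup_locally_bounded[OF c0] by (metis atLeastAtMost_iff)
  \<comment> \<open>The local bound is iterated over n steps of length d. The maximum with 1 makes
    the powers increase, so times s <= d are covered as well.\<close>
  have Cn: "norm (V s x) \<le> max C 1 ^ n * norm x" if "0 \<le> s" "s \<le> real n * d" for s x n
    using that
  proof (induction n arbitrary: s)
    case 0
    then show ?case by (simp add: V0)
  next
    case (Suc n)
    show ?case
    proof (cases "s \<le> d")
      case True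
      have "norm (V s x) \<le> C * norm x" using C Suc True by auto
      also have "\<dots> \<le> max C 1 ^ Suc n * norm x"
      proof (rule mult_right_mono)
        have "max C 1 * 1 \<le> max C 1 * max C 1 ^ n" by (intro mult_left_mono one_le_power) auto
        then show "C \<le> max C 1 ^ Suc n" by simp
      qed simp
      finally show ?thesis .
    next
      case False
      have "V s x = V d (V (s - d) x)" using sg[of d "s - d" x] d False by simp
      then have "norm (V s x) \<le> C * norm (V (s - d) x)" using C[of d] d by simp
      also have "\<dots> \<le> max C 1 * (max C 1 ^ n * norm x)"
        using Suc.IH[of "s - d"] Suc.prems False by (intro mult_mono) (auto simp: algebra_simps)
      finally show ?thesis by (simp add: mult.assoc)
    qed
  qed
  obtain n where n: "t \<le> real n * d"
    using d by (metis real_arch_simple pos_divide_le_eq)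
  define K where "K = max C 1 ^ n"
  have K1: "1 \<le> K" unfolding K_def by (intro one_le_power) auto
  have K: "norm (V s x) \<le> K * norm x" if "s \<in> {0..t}" for s x
    using Cn[of s n x] n that by (auto simp: K_def)
  have der: "((\<lambda>s. V s f) has_vector_derivative V s (A f)) (at s within {0..t})" if s: "s \<in> {0..t}" for s
    unfolding has_vector_derivative_def has_derivative_within_alt
  proof (intro conjI allI impI)
    show "bounded_linear (\<lambda>x. x *\<^sub>R V s (A f))" by (rule bounded_linear_scaleR_left)
    fix e :: real assume e: "e > 0"
    \<comment> \<open>Two errors occur below, each at most K e': replacing the quotient at 0 by A f,
      and replacing V m (A f) by V s (A f).\<close>
    define e' where "e' = e / (2 * K)"
    have e': "e' > 0" using e K1 by (simp add: e'_def)
    obtain d1 where d1: "d1 > 0" "\<And>h. 0 < h \<Longrightarrow> h < d1 \<Longrightarrow> dist ((V h f - f) /\<^sub>R h) (A f) < e'"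
      using tendstoD[OF gen[of f] e'] by (auto simp: eventually_at_right_field)
    obtain d2 where d2: "d2 > 0" "\<And>h. 0 < h \<Longrightarrow> h < d2 \<Longrightarrow> dist (V h (A f)) (A f) < e'"
      using tendstoD[OF cont[of "A f"] e'] by (auto simp: eventually_at_right_field)
    have d2': "dist (V h (A f)) (A f) < e'" if "0 \<le> h" "h < d2" for h
      using that d2 e' V0 by (cases "h = 0") auto
    show "\<exists>d>0. \<forall>y\<in>{0..t}. norm (y - s) < d \<longrightarrow>
        norm (V y f - V s f - (y - s) *\<^sub>R V s (A f)) \<le> e * norm (y - s)"
    proof (intro exI[of _ "min d1 d2"] conjI ballI impI)
      show "min d1 d2 > 0" using d1 d2 by simp
      fix y assume y: "y \<in> {0..t}" "norm (y - s) < min d1 d2"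
      show "norm (V y f - V s f - (y - s) *\<^sub>R V s (A f)) \<le> e * norm (y - s)"
      proof (cases "y = s")
        case True
        then show ?thesis by simp
      next
        case False
        \<comment> \<open>With m the earlier of the two times, the increment is V m applied to V h f
          - f up to sign, on whichever side of s the time y lies; (y - s) / h is that sign.\<close>
        define m h where "m = min y s" and "h = \<bar>y - s\<bar>"
        have h: "0 < h" "h < d1" "h < d2" using False y by (auto simp: h_def)
        have m: "m \<in> {0..t}" using y s by (auto simp: m_def)
        then interpret Vm: bounded_linear "V m" using lin by auto
        have V_m: "V m ((V h f - f) /\<^sub>R h) = (V (m + h) f - V m f) /\<^sub>R h"
          using m h by (simp add: Vm.scaleR Vm.diff sg)
        have eq: "V y f - V s f = (y - s) *\<^sub>R V m ((V h f - f) /\<^sub>R h)"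
        proof (cases "y < s")
          case True
          then have "m = y" "m + h = s" "(y - s) * inverse h = - 1"
            by (auto simp: m_def h_def field_simps)
          then show ?thesis unfolding V_m by simp
        next
          case False
          then have "m = s" "m + h = y" "(y - s) * inverse h = 1"
            using \<open>y \<noteq> s\<close> by (auto simp: m_def h_def field_simps)
          then show ?thesis unfolding V_m by simp
        qed
        have q: "norm (V m ((V h f - f) /\<^sub>R h) - V m (A f)) \<le> K * e'"
        proof -
          have "norm (V m ((V h f - f) /\<^sub>R h) - V m (A f)) \<le> K * norm ((V h f - f) /\<^sub>R h - A f)"
            using K[OF m] by (simp flip: Vm.diff)
          also have "\<dots> \<le> K * e'"
            using d1(2)[of h] h K1 by (intro mult_left_mono) (auto simp: dist_norm)
          finally show ?thesis .
        qed
        have r: "norm (V m (A f) - V s (A f)) \<le> K * e'"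
        proof -
          have "V s (A f) = V m (V (s - m) (A f))"
            using sg[of m "s - m" "A f"] m by (simp add: m_def)
          then have "norm (V m (A f) - V s (A f)) \<le> K * norm (A f - V (s - m) (A f))"
            using K[OF m] by (simp flip: Vm.diff)
          also have "\<dots> \<le> K * e'"
          proof -
            have "0 \<le> s - m" "s - m < d2" using h by (auto simp: m_def h_def)
            from d2'[OF this] show ?thesis
              using K1 by (intro mult_left_mono) (auto simp: dist_norm norm_minus_commute)
          qed
          finally show ?thesis .
        qed
        have "norm (V y f - V s f - (y - s) *\<^sub>R V s (A f))
            = \<bar>y - s\<bar> * norm (V m ((V h f - f) /\<^sub>R h) - V s (A f))"
          unfolding eq by (simp flip: scaleR_diff_right)
        also have "\<dots> \<le> \<bar>y - s\<bar> * (K * e' + K * e')"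
          using norm_triangle_ineq[of "V m ((V h f - f) /\<^sub>R h) - V m (A f)" "V m (A f) - V s (A f)"] q r
          by (intro mult_left_mono) auto
        also have "\<dots> = e * norm (y - s)" using K1 by (simp add: e'_def field_simps)
        finally show ?thesis .
      qed
    qed
  qed
  define W where "W s = bop_apply (exp (s *\<^sub>R (- a))) (V s f)" for s
  have "(W has_vector_derivative 0) (at s within {0..t})" if s: "s \<in> {0..t}" for s
  proof -
    have "(W has_vector_derivative
        (bop_apply (exp (s *\<^sub>R (- a))) (V s (A f)) + bop_apply (exp (s *\<^sub>R (- a)) * (- a)) (V s f)))
        (at s within {0..t})"
      unfolding W_def
      by (intro bop.has_vector_derivative exp_scaleR_has_vector_derivative_right der s)
    moreover have "bop_apply (exp (s *\<^sub>R (- a)) * (- a)) (V s f)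
        = - bop_apply (exp (s *\<^sub>R (- a))) (V s (A f))"
      using comm[of s f] s by (simp add: bop.minus_left bop.minus_right a)
    ultimately show ?thesis by simp
  qed
  then obtain c where "\<And>s. s \<in> {0..t} \<Longrightarrow> W s = c"
    using has_vector_derivative_zero_constant[of "{0..t}" W] by auto
  then have "W t = W 0" using t by (metis atLeastAtMost_iff order_refl)
  then have "bop_apply (exp (t *\<^sub>R a)) (bop_apply (exp (- (t *\<^sub>R a))) (V t f)) = bop_apply (exp (t *\<^sub>R a)) f"
    by (simp add: W_def V0)
  then show "V t f = bop_apply (exp (t *\<^sub>R bop_of A)) f"
    by (simp add: exp_minus_inverse a_def flip: bop_apply_mult)
qed

section \<open>Poisson averages of a convergent sequence\<close>

lemma power_series_exp_null_sequence:
  fixes x :: "nat \<Rightarrow> real"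
  assumes x: "x \<longlonglongrightarrow> 0" and nn: "\<And>n. 0 \<le> x n"
  shows "((\<lambda>s. exp (- s) * (\<Sum>n. s ^ n / fact n * x n)) \<longlongrightarrow> 0) at_top"
proof -
  obtain C where C: "\<And>n. x n \<le> C" "C > 0"
    using convergent_imp_Bseq[OF convergentI[OF x]] by (auto simp: Bseq_def nn)
  have sm: "summable (\<lambda>n. s ^ n / fact n * x n)" if "s \<ge> 0" for s
  proof (rule summable_comparison_test')
    show "summable (\<lambda>n. s ^ n / fact n * C)"
      using summable_mult2[OF summable_exp[of s]] by (simp add: divide_inverse mult_ac)
    show "norm (s ^ n / fact n * x n) \<le> s ^ n / fact n * C" for n
      using that nn C by (auto simp: abs_mult intro!: divide_right_mono mult_left_mono)
  qed
  have es: "(\<lambda>n. s ^ n / fact n) sums exp s" for s :: real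
    using exp_converges[of s] by (simp add: divide_inverse mult.commute)
  show ?thesis
  proof (rule tendstoI)
    fix e :: real assume e: "e > 0"
    obtain N where N: "\<And>n. n \<ge> N \<Longrightarrow> x n < e / 2"
      using order_tendstoD(2)[OF x, of "e / 2"] e by (auto simp: eventually_sequentially)
    \<comment> \<open>Indices n >= N cost at most e / 2 times the total weight exp s. The first N
      terms form a polynomial in s, which the factor exp (- s) sends to 0.\<close>
    have bound: "(\<Sum>n. s ^ n / fact n * x n) \<le> e / 2 * exp s + C * (\<Sum>n<N. s ^ n / fact n)"
      if s: "s \<ge> 0" for s
    proof -
      have "(\<lambda>n. e / 2 * (s ^ n / fact n) + (if n < N then C * (s ^ n / fact n) else 0))
          sums (e / 2 * exp s + (\<Sum>n<N. C * (s ^ n / fact n)))"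
        using sums_add[OF sums_mult[OF es[of s], of "e / 2"]
          sums_If_finite_set[of "{..<N}" "\<lambda>n. C * (s ^ n / fact n)"]] by simp
      moreover have "s ^ n / fact n * x n
          \<le> e / 2 * (s ^ n / fact n) + (if n < N then C * (s ^ n / fact n) else 0)" for n
      proof (cases "n < N")
        case True
        have "s ^ n / fact n * x n \<le> s ^ n / fact n * C" using s C by (intro mult_left_mono) auto
        moreover have "0 \<le> e / 2 * (s ^ n / fact n)" using s e by simp
        ultimately show ?thesis using True by (simp add: mult.commute)
      next
        case False
        then have "s ^ n / fact n * x n \<le> s ^ n / fact n * (e / 2)"
          using s N[of n] by (intro mult_left_mono) auto
        then show ?thesis using False by (simp add: mult.commute)
      qed
      ultimately have "(\<Sum>n. s ^ n / fact n * x n) \<le> e / 2 * exp s + (\<Sum>n<N. C * (s ^ n / fact n))"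
        using s
        by (intro sums_le[OF _ summable_sums[OF sm[OF s]]]) auto
      then show ?thesis by (simp add: sum_distrib_left)
    qed
    have "((\<lambda>s. C * (\<Sum>n<N. s ^ n / exp s / fact n)) \<longlongrightarrow> C * (\<Sum>n<N. 0 / fact n)) at_top"
      by (intro tendsto_intros tendsto_power_div_exp_0) auto
    then have "((\<lambda>s. C * (\<Sum>n<N. s ^ n / exp s / fact n)) \<longlongrightarrow> 0) at_top" by simp
    then have "\<forall>\<^sub>F s in at_top. C * (\<Sum>n<N. s ^ n / exp s / fact n) < e / 2"
      using e by (intro order_tendstoD) auto
    then show "\<forall>\<^sub>F s in at_top. dist (exp (- s) * (\<Sum>n. s ^ n / fact n * x n)) 0 < e"
      using eventually_ge_at_top[of 0]
    proof eventually_elim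
      case (elim s)
      have "0 \<le> (\<Sum>n. s ^ n / fact n * x n)" using elim nn by (intro suminf_nonneg sm) auto
      then have "dist (exp (- s) * (\<Sum>n. s ^ n / fact n * x n)) 0 = exp (- s) * (\<Sum>n. s ^ n / fact n * x n)"
        by (simp only: dist_real_def) simp
      also have "\<dots> \<le> exp (- s) * (e / 2 * exp s + C * (\<Sum>n<N. s ^ n / fact n))"
        using bound elim by (intro mult_left_mono) auto
      also have "\<dots> = e / 2 + C * (\<Sum>n<N. s ^ n / exp s / fact n)"
        by (simp add: exp_minus sum_distrib_left field_simps)
      also have "\<dots> < e" using elim by linarith
      finally show ?case .
    qed
  qed
qed

text \<open>The semigroup generated by \<open>c (P - 1)\<close> averages the powers of \<open>P\<close> against a Poisson
  distribution of parameter \<open>c t\<close>, which escapes to infinity with \<open>t\<close>.\<close>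

lemma poisson_average_tendsto:
  fixes P :: "'x::{banach, perfect_space} \<Rightarrow> 'x"
  assumes P: "bounded_linear P" and c: "c > 0"
    and lim: "(\<lambda>n. (P ^^ n) f) \<longlonglongrightarrow> g"
  shows "((\<lambda>t. bop_apply (exp (t *\<^sub>R bop_of (\<lambda>x. c *\<^sub>R (P x - x)))) f) \<longlongrightarrow> g) at_top"
proof -
  define p where "p = bop_of P"
  have p: "bop_apply p = P" by (simp add: p_def bop_apply_of[OF P])
  have "bounded_linear (\<lambda>x. c *\<^sub>R (P x - x))"
    by (intro bounded_linear_const_scaleR bounded_linear_sub P bounded_linear_ident)
  then have "bop_apply (bop_of (\<lambda>x. c *\<^sub>R (P x - x))) = bop_apply (c *\<^sub>R (p - 1))"
    by (auto simp: bop_apply_of bop.scaleR_left bop.diff_left p)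
  then have A: "bop_of (\<lambda>x. c *\<^sub>R (P x - x)) = c *\<^sub>R (p - 1)"
    by (simp add: bop_apply_def blinfun_apply_inject blinfun_of_bop_inject)
  have eq: "norm (bop_apply (exp (t *\<^sub>R c *\<^sub>R (p - 1))) f - g)
      \<le> exp (- (c * t)) * (\<Sum>n. (c * t) ^ n / fact n * norm ((P ^^ n) f - g))" if t: "t \<ge> 0" for t
  proof -
    define s where "s = c * t"
    have s: "s \<ge> 0" using t c by (simp add: s_def)
    have "exp (t *\<^sub>R c *\<^sub>R (p - 1)) = exp (s *\<^sub>R p + (- s) *\<^sub>R 1)"
      by (simp add: s_def scaleR_diff_right mult.commute)
    also have "\<dots> = exp (s *\<^sub>R p) * exp ((- s) *\<^sub>R 1)" by (rule exp_add_commuting) simp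
    also have "exp ((- s) *\<^sub>R (1 :: 'x bop)) = exp (- s) *\<^sub>R 1"
      using exp_of_real[of "- s", where 'a="'x bop"] by (simp add: of_real_def)
    finally have e: "bop_apply (exp (t *\<^sub>R c *\<^sub>R (p - 1))) f = exp (- s) *\<^sub>R bop_apply (exp (s *\<^sub>R p)) f"
      by (simp only: bop_apply_mult bop.scaleR_left bop.scaleR_right bop_apply_one)
    have "(\<lambda>n. bop_apply ((s *\<^sub>R p) ^ n /\<^sub>R fact n) f) sums bop_apply (exp (s *\<^sub>R p)) f"
      by (rule bounded_linear.sums[OF bop.bounded_linear_left exp_converges])
    then have 1: "(\<lambda>n. (s ^ n / fact n) *\<^sub>R (P ^^ n) f) sums bop_apply (exp (s *\<^sub>R p)) f"
      by (simp add: bop.scaleR_left scaleR_power bop_apply_power p divide_inverse mult.commute)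
    have es: "(\<lambda>n. s ^ n / fact n) sums exp s"
      using exp_converges[of s] by (simp add: divide_inverse mult.commute)
    from sums_diff[OF 1 sums_scaleR_left[OF es, of g]]
    have 2: "(\<lambda>n. (s ^ n / fact n) *\<^sub>R ((P ^^ n) f - g)) sums (bop_apply (exp (s *\<^sub>R p)) f - exp s *\<^sub>R g)"
      by (simp add: scaleR_diff_right)
    obtain C where C: "\<And>n. norm ((P ^^ n) f - g) \<le> C" "C > 0"
      using convergent_imp_Bseq[OF convergentI[OF tendsto_diff[OF lim tendsto_const[of g]]]]
      by (auto simp: Bseq_def)
    have sm: "summable (\<lambda>n. norm ((s ^ n / fact n) *\<^sub>R ((P ^^ n) f - g)))"
    proof (rule summable_comparison_test')
      show "summable (\<lambda>n. s ^ n / fact n * C)"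
        by (rule summable_mult2[OF sums_summable[OF es]])
      show "norm (norm ((s ^ n / fact n) *\<^sub>R ((P ^^ n) f - g))) \<le> s ^ n / fact n * C" for n
        using s C by (auto intro!: mult_left_mono divide_right_mono)
    qed
    have "bop_apply (exp (t *\<^sub>R c *\<^sub>R (p - 1))) f - g
        = exp (- s) *\<^sub>R (bop_apply (exp (s *\<^sub>R p)) f - exp s *\<^sub>R g)"
      unfolding e by (simp add: scaleR_diff_right flip: exp_add)
    then have "norm (bop_apply (exp (t *\<^sub>R c *\<^sub>R (p - 1))) f - g)
        = exp (- s) * norm (\<Sum>n. (s ^ n / fact n) *\<^sub>R ((P ^^ n) f - g))"
      unfolding sums_unique[OF 2, symmetric] by simp
    also have "\<dots> \<le> exp (- s) * (\<Sum>n. norm ((s ^ n / fact n) *\<^sub>R ((P ^^ n) f - g)))"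
      using summable_norm[OF sm] by (intro mult_left_mono) auto
    finally show ?thesis using s by (simp add: s_def)
  qed
  have "(\<lambda>n. norm ((P ^^ n) f - g)) \<longlonglongrightarrow> 0"
    using lim by (simp add: LIM_zero_iff tendsto_norm_zero_iff)
  from power_series_exp_null_sequence[OF this]
  have "((\<lambda>s. exp (- s) * (\<Sum>n. s ^ n / fact n * norm ((P ^^ n) f - g))) \<longlongrightarrow> 0) at_top" by simp
  moreover have "filterlim (\<lambda>t. c * t) at_top at_top"
    using c by (intro filterlim_tendsto_pos_mult_at_top[OF tendsto_const] filterlim_ident)
  ultimately have "((\<lambda>t. exp (- (c * t)) * (\<Sum>n. (c * t) ^ n / fact n * norm ((P ^^ n) f - g))) \<longlongrightarrow> 0) at_top"
    by (rule filterlim_compose)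
  then have "((\<lambda>t. bop_apply (exp (t *\<^sub>R c *\<^sub>R (p - 1))) f - g) \<longlongrightarrow> 0) at_top"
  proof (rule Lim_null_comparison[rotated])
    show "\<forall>\<^sub>F t in at_top. norm (bop_apply (exp (t *\<^sub>R c *\<^sub>R (p - 1))) f - g)
        \<le> exp (- (c * t)) * (\<Sum>n. (c * t) ^ n / fact n * norm ((P ^^ n) f - g))"
      using eventually_ge_at_top[of 0] by eventually_elim (rule eq)
  qed
  then show ?thesis unfolding A by (simp add: LIM_zero_iff)
qed

section \<open>The ergodic splitting into fixed vectors and closed range\<close>

lemma subspace_closure_of_subspace:
  fixes S :: "'x::real_normed_vector set"
  assumes S: "subspace S"
  shows "subspace (closure S)"
proof (rule subspaceI)
  show "0 \<in> closure S" using subspace_0[OF S] closure_subset by blast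
  fix x y :: 'x and c :: real
  assume x: "x \<in> closure S"
  then obtain u where u: "(\<forall>n. u n \<in> S) \<and> u \<longlonglongrightarrow> x" unfolding closure_sequential ..
  then have "(\<lambda>n. c *\<^sub>R u n) \<longlonglongrightarrow> c *\<^sub>R x" by (intro tendsto_intros) auto
  then show "c *\<^sub>R x \<in> closure S"
    unfolding closure_sequential using u subspace_mul[OF S] by (intro exI[of _ "\<lambda>n. c *\<^sub>R u n"]) auto
  assume "y \<in> closure S"
  then obtain w where w: "(\<forall>n. w n \<in> S) \<and> w \<longlonglongrightarrow> y" unfolding closure_sequential ..
  have "(\<lambda>n. u n + w n) \<longlonglongrightarrow> x + y" using u w by (intro tendsto_intros) auto
  then show "x + y \<in> closure S"
    unfolding closure_sequential using u w subspace_add[OF S] by (intro exI[of _ "\<lambda>n. u n + w n"]) auto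
qed

text \<open>Mean ergodic decomposition x = L x + (x - L x): the limit L x is fixed by P, and x - (P
  ^^ n) x telescopes into elements of the range. The sum is direct because L is the identity on
  fixed vectors and vanishes on the range, hence, being a contraction, also on its closure.\<close>

lemma direct_sum_of_convergent_powers:
  fixes P L :: "'x::real_normed_vector \<Rightarrow> 'x"
  assumes P: "bounded_linear P" and contr: "\<And>x. norm (P x) \<le> norm x" and c: "c \<noteq> 0"
    and lim: "\<And>f. (\<lambda>n. (P ^^ n) f) \<longlonglongrightarrow> L f"
  shows "is_direct_sum {f. c *\<^sub>R (P f - f) = 0} (closure (range (\<lambda>f. c *\<^sub>R (P f - f))))"
proof -
  interpret P: bounded_linear P by fact
  define A where "A f = c *\<^sub>R (P f - f)" for f
  have A: "linear A"
    unfolding A_def by (intro bounded_linear.linear bounded_linear_const_scaleR bounded_linear_sub P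
        bounded_linear_ident)
  have powdiff: "(P ^^ n) (x - y) = (P ^^ n) x - (P ^^ n) y" for n x y
    by (induction n) (auto simp: P.diff)
  have powscale: "(P ^^ n) (r *\<^sub>R x) = r *\<^sub>R (P ^^ n) x" for n x r
    by (induction n) (auto simp: P.scaleR)
  have pownorm: "norm ((P ^^ n) x) \<le> norm x" for n x
    by (induction n) (auto intro: order_trans[OF contr])
  have Pdiff: "L (x - y) = L x - L y" for x y
    by (rule LIMSEQ_unique[OF lim]) (use tendsto_diff[OF lim[of x] lim[of y]] in \<open>simp add: powdiff\<close>)
  have Pnorm: "norm (L x) \<le> norm x" for x
    using lim[THEN tendsto_norm] by (rule LIMSEQ_le_const2) (use pownorm in auto)
  have PA: "L (A g) = 0" for g
  proof (rule LIMSEQ_unique[OF lim])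
    have "(\<lambda>n. c *\<^sub>R ((P ^^ Suc n) g - (P ^^ n) g)) \<longlonglongrightarrow> c *\<^sub>R (L g - L g)"
      by (intro tendsto_intros LIMSEQ_Suc[OF lim] lim)
    then show "(\<lambda>n. (P ^^ n) (A g)) \<longlonglongrightarrow> 0"
      by (simp add: A_def powdiff powscale funpow_swap1)
  qed
  have fix_L: "P (L f) = L f" for f
    by (rule LIMSEQ_unique[OF P.tendsto[OF lim[of f]]]) (use LIMSEQ_Suc[OF lim[of f]] in simp)
  have cl: "L x = 0" if x: "x \<in> closure (range A)" for x
  proof -
    obtain y where "(\<forall>n. y n \<in> range A) \<and> y \<longlonglongrightarrow> x"
      using x unfolding closure_sequential ..
    then have y: "\<And>n. y n \<in> range A" "y \<longlonglongrightarrow> x" by auto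
    have "norm (L x) \<le> norm (x - y n)" for n
    proof -
      have "L (y n) = 0" using y(1)[of n] PA by auto
      then show ?thesis using Pnorm[of "x - y n"] by (simp add: Pdiff)
    qed
    moreover have "(\<lambda>n. norm (x - y n)) \<longlonglongrightarrow> norm (x - x)" by (intro tendsto_intros y)
    ultimately have "norm (L x) \<le> norm (x - x)" by (intro LIMSEQ_le_const) auto
    then show ?thesis by simp
  qed
  have "x - L x \<in> closure (range A)" for x
  proof (rule Lim_in_closed_set[of _ "\<lambda>n. x - (P ^^ n) x" sequentially])
    show "(\<lambda>n. x - (P ^^ n) x) \<longlonglongrightarrow> x - L x" by (intro tendsto_intros lim)
    have "x - (P ^^ n) x \<in> range A" for n
    proof (induction n)
      case 0
      have "A 0 = 0" using linear_0[OF A] .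
      then show ?case by (metis rangeI diff_self funpow_0)
    next
      case (Suc n)
      have "(P ^^ n) x - (P ^^ Suc n) x = A ((- 1 / c) *\<^sub>R (P ^^ n) x)"
        using c by (simp add: A_def P.scaleR P.neg scaleR_diff_right)
      then have "(P ^^ n) x - (P ^^ Suc n) x \<in> range A" by (metis rangeI)
      with Suc have "(x - (P ^^ n) x) + ((P ^^ n) x - (P ^^ Suc n) x) \<in> range A"
        using subspace_add[OF linear_subspace_image[OF A subspace_UNIV]] by blast
      then show ?case by simp
    qed
    then show "\<forall>\<^sub>F n in sequentially. x - (P ^^ n) x \<in> closure (range A)"
      using closure_subset by (intro always_eventually) blast
  qed auto
  then have "\<exists>a\<in>{f. A f = 0}. \<exists>y\<in>closure (range A). x = a + y" for x
    using fix_L[of x] by (intro bexI[of _ "L x"] bexI[of _ "x - L x"]) (auto simp: A_def)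
  moreover have "{f. A f = 0} \<inter> closure (range A) = {0}"
  proof (intro equalityI subsetI)
    fix x assume x: "x \<in> {f. A f = 0} \<inter> closure (range A)"
    then have Px: "P x = x" using c by (auto simp: A_def)
    have "(P ^^ n) x = x" for n by (induction n) (auto simp: Px)
    then have "L x = x" using lim[of x] by (simp add: LIMSEQ_const_iff)
    then show "x \<in> {0}" using cl x by auto
  next
    fix x :: 'x assume "x \<in> {0}"
    moreover have "0 \<in> range A" using linear_0[OF A] by (metis rangeI)
    ultimately show "x \<in> {f. A f = 0} \<inter> closure (range A)"
      using linear_0[OF A] subsetD[OF closure_subset[of "range A"]] by auto
  qed
  ultimately show ?thesis
    unfolding is_direct_sum_def A_def[symmetric]
    using linear_subspace_kernel[OF A] subspace_closure_of_subspace[OF linear_subspace_image[OF A subspace_UNIV]]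
    by auto
qed

section \<open>Surface measure and invariance of the collision map\<close>

text \<open>\<open>sphere_measure\<close> lives on the sphere with the trace sigma-algebra. Its
  image on the whole space has the ordinary Borel sets, so joint measurability with the velocities
  is automatic, at the price of carrying norm s = 1 as an almost everywhere fact.\<close>

definition sph :: "'a::euclidean_space measure" where
  "sph = distr sphere_measure borel (\<lambda>x. x)"

lemma sets_sphere_measure: "sets (sphere_measure :: 'a::euclidean_space measure) = sets (restrict_space borel (sphere 0 1))"
  by (simp add: sphere_measure_def)

lemma sets_sph [simp, measurable_cong]: "sets sph = sets borel"
  by (simp add: sph_def)

lemma space_sph [simp]: "space sph = UNIV"
  by (simp add: sph_def)

lemma measurable_id_sphere_measure: "(\<lambda>x. x) \<in> measurable (sphere_measure :: 'a::euclidean_space measure) borel"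
  by (simp add: measurable_restrict_space1 measurable_cong_sets[OF sets_sphere_measure refl])

lemma measurable_sgn_sphere:
  "sgn \<in> restrict_space lborel (ball (0::'a::euclidean_space) 1 - {0}) \<rightarrow>\<^sub>M restrict_space borel (sphere 0 1)"
proof (rule measurable_restrict_space2)
  show "sgn \<in> space (restrict_space lborel (ball (0::'a) 1 - {0})) \<rightarrow> sphere 0 1"
    by (auto simp: space_restrict_space norm_sgn)
  show "sgn \<in> restrict_space lborel (ball (0::'a) 1 - {0}) \<rightarrow>\<^sub>M borel"
    by (rule measurable_restrict_space1) simp
qed

lemma nn_integral_sph:
  fixes f :: "'a::euclidean_space \<Rightarrow> ennreal"
  assumes [measurable]: "f \<in> borel_measurable borel"
  shows "(\<integral>\<^sup>+x. f x \<partial>sph) = of_nat DIM('a) * (\<integral>\<^sup>+x. f (sgn x) * indicator (ball 0 1) x \<partial>lborel)"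
proof -
  note [measurable] = measurable_sgn_sphere
  have f: "f \<in> borel_measurable (restrict_space borel (sphere 0 1))"
    by (rule measurable_restrict_space1) simp
  have "(\<integral>\<^sup>+x. f x \<partial>sph) = (\<integral>\<^sup>+x. f x \<partial>sphere_measure)"
    unfolding sph_def by (subst nn_integral_distr[OF measurable_id_sphere_measure]) simp_all
  also have "\<dots> = of_nat DIM('a) *
      (\<integral>\<^sup>+x. f x \<partial>distr (restrict_space lborel (ball 0 1 - {0})) (restrict_space borel (sphere 0 1)) sgn)"
    unfolding sphere_measure_def by (rule nn_integral_scale_measure) (simp add: f)
  also have "\<dots> = of_nat DIM('a) * (\<integral>\<^sup>+x. f (sgn x) \<partial>restrict_space lborel (ball 0 1 - {0}))"
    by (subst nn_integral_distr[OF measurable_sgn_sphere]) (simp_all add: f)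
  also have "\<dots> = of_nat DIM('a) * (\<integral>\<^sup>+x. f (sgn x) * indicator (ball 0 1 - {0}) x \<partial>lborel)"
    by (subst nn_integral_restrict_space) auto
  \<comment> \<open>The cone measure leaves out the origin, a null set, so the integral may run over
    the full ball.\<close>
  also have "(\<integral>\<^sup>+x. f (sgn x) * indicator (ball 0 1 - {0}) x \<partial>lborel)
      = (\<integral>\<^sup>+x. f (sgn x) * indicator (ball 0 1) x \<partial>lborel)"
  proof (rule nn_integral_cong_AE)
    have "AE x in lborel. x \<noteq> (0::'a)" by (rule AE_lborel_singleton)
    then show "AE x in lborel. f (sgn x) * indicator (ball 0 1 - {0}) x = f (sgn x) * indicator (ball 0 1) (x::'a)"
      by eventually_elim (auto split: split_indicator)
  qed
  finally show ?thesis .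
qed

lemma nn_integral_sphere_measure:
  fixes f :: "'a::euclidean_space \<Rightarrow> ennreal"
  assumes "f \<in> borel_measurable borel"
  shows "(\<integral>\<^sup>+x. f x \<partial>sphere_measure) = (\<integral>\<^sup>+x. f x \<partial>sph)"
  unfolding sph_def using assms by (subst nn_integral_distr[OF measurable_id_sphere_measure]) simp_all

lemma emeasure_sph:
  assumes "A \<in> sets (borel :: 'a::euclidean_space measure)"
  shows "emeasure sph A = of_nat DIM('a) * emeasure lborel {x \<in> ball 0 1. sgn x \<in> A}"
proof -
  have [measurable]: "A \<in> sets borel" by fact
  have "emeasure sph A = (\<integral>\<^sup>+x. indicator A x \<partial>sph)" by simp
  also have "\<dots> = of_nat DIM('a) * (\<integral>\<^sup>+x. indicator A (sgn x) * indicator (ball 0 1) x \<partial>lborel)"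
    by (rule nn_integral_sph) simp
  also have "(\<integral>\<^sup>+x. indicator A (sgn x) * indicator (ball 0 1) x \<partial>lborel)
      = (\<integral>\<^sup>+x. indicator {x \<in> ball 0 1. sgn x \<in> A} x \<partial>lborel)"
    by (intro nn_integral_cong) (auto split: split_indicator)
  also have "\<dots> = emeasure lborel {x \<in> ball 0 1. sgn x \<in> A}"
    by (rule nn_integral_indicator) measurable
  finally show ?thesis .
qed

lemma emeasure_lborel_unit_ball:
  "emeasure lborel (ball (0::'a::euclidean_space) 1) \<noteq> 0" "emeasure lborel (ball (0::'a) 1) < \<infinity>"
proof -
  show "emeasure lborel (ball (0::'a) 1) < \<infinity>"
    by (rule emeasure_bounded_finite) simp
  show "emeasure lborel (ball (0::'a) 1) \<noteq> 0"
    using open_not_negligible[of "ball (0::'a) 1"]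
    by (auto simp: negligible_iff_null_sets null_sets_def emeasure_completion)
qed

lemma emeasure_sph_UNIV:
  "emeasure (sph :: 'a::euclidean_space measure) UNIV = of_nat DIM('a) * emeasure lborel (ball (0::'a) 1)"
proof -
  have "{x \<in> ball (0::'a) 1. sgn x \<in> UNIV} = ball 0 1" by auto
  then show ?thesis using emeasure_sph[of "UNIV :: 'a set"] by (metis space_borel sets.top)
qed

lemma sph_UNIV_pos: "emeasure (sph :: 'a::euclidean_space measure) UNIV \<noteq> 0"
  using emeasure_lborel_unit_ball(1)[where 'a='a] by (simp add: emeasure_sph_UNIV)

interpretation sph: finite_measure "sph :: 'a::euclidean_space measure"
proof
  show "emeasure (sph :: 'a measure) (space sph) \<noteq> \<infinity>"
    using emeasure_lborel_unit_ball(2)[where 'a='a]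
    by (auto simp: emeasure_sph_UNIV ennreal_mult_eq_top_iff)
qed

lemma AE_sph_norm: "AE x in sph. norm x = 1"
proof -
  have "{x \<in> ball (0::'a) 1. sgn x \<in> {x. norm x \<noteq> 1}} \<subseteq> {0}"
    by (auto simp: norm_sgn)
  then have "emeasure lborel {x \<in> ball (0::'a) 1. sgn x \<in> {x. norm x \<noteq> 1}} = 0"
    using emeasure_mono[of _ "{0::'a}" lborel] by (auto simp: emeasure_lborel_singleton)
  then show ?thesis
    by (intro AE_I'[of "{x. norm x \<noteq> 1}"]) (auto simp: null_sets_def emeasure_sph)
qed

text \<open>Null sets of the sphere are those with Lebesgue null cones. This moves null-set
  arguments into full dimension, where differentiable images of null sets are null.\<close>

lemma AE_sph_iff:
  fixes P :: "'a::euclidean_space \<Rightarrow> bool"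
  assumes [measurable]: "Measurable.pred borel P"
  shows "(AE s in sph. P s) \<longleftrightarrow> (AE x in lborel. x \<in> ball 0 1 \<longrightarrow> P (sgn x))"
proof -
  have "(AE s in sph. P s) \<longleftrightarrow> emeasure sph {s. \<not> P s} = 0"
    by (subst AE_iff_measurable[OF _ refl]) auto
  also have "\<dots> \<longleftrightarrow> emeasure lborel {x \<in> ball 0 1. sgn x \<in> {s. \<not> P s}} = 0"
    by (subst emeasure_sph) auto
  also have "\<dots> \<longleftrightarrow> (AE x in lborel. x \<in> ball 0 1 \<longrightarrow> P (sgn x))"
    by (subst AE_iff_measurable[of "{x \<in> ball 0 1. sgn x \<in> {s. \<not> P s}}"]) auto
  finally show ?thesis .
qed

section \<open>Isometry invariance of Lebesgue and surface measure\<close>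

lemma nn_integral_lborel_affine:
  fixes f :: "'a::euclidean_space \<Rightarrow> ennreal"
  assumes [measurable]: "f \<in> borel_measurable borel" and c: "c \<noteq> 0"
  shows "(\<integral>\<^sup>+x. f x \<partial>lborel) = ennreal (\<bar>c\<bar> ^ DIM('a)) * (\<integral>\<^sup>+x. f (t + c *\<^sub>R x) \<partial>lborel)"
proof -
  have "(\<integral>\<^sup>+x. f x \<partial>lborel) = (\<integral>\<^sup>+x. f x \<partial>density (distr lborel borel (\<lambda>x. t + c *\<^sub>R x)) (\<lambda>_. \<bar>c\<bar>^DIM('a)))"
    using lborel_affine[OF c, where t=t and 'a='a] by simp
  also have "\<dots> = (\<integral>\<^sup>+x. ennreal (\<bar>c\<bar>^DIM('a)) * f (t + c *\<^sub>R x) \<partial>lborel)"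
    by (simp add: nn_integral_density nn_integral_distr)
  also have "\<dots> = ennreal (\<bar>c\<bar>^DIM('a)) * (\<integral>\<^sup>+x. f (t + c *\<^sub>R x) \<partial>lborel)"
    by (rule nn_integral_cmult) simp
  finally show ?thesis .
qed

lemma nn_integral_lborel_shift:
  fixes f :: "'a::euclidean_space \<Rightarrow> ennreal"
  assumes "f \<in> borel_measurable borel"
  shows "(\<integral>\<^sup>+x. f (t + x) \<partial>lborel) = (\<integral>\<^sup>+x. f x \<partial>lborel)"
  using nn_integral_lborel_affine[OF assms, of 1 t] by simp

lemma nn_integral_lborel_reflect:
  fixes f :: "'a::euclidean_space \<Rightarrow> ennreal"
  assumes "f \<in> borel_measurable borel"
  shows "(\<integral>\<^sup>+x. f (t - x) \<partial>lborel) = (\<integral>\<^sup>+x. f x \<partial>lborel)"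
  using nn_integral_lborel_affine[OF assms, of "- 1" t] by simp

text \<open>Uniqueness of Haar measure: multiplied by the volume of the unit ball \<open>B\<close>, both sides equal the
  integral of \<open>indicator A (f x) * indicator B (f x - y)\<close> over all \<open>x\<close> and \<open>y\<close>.\<close>

lemma emeasure_lborel_isometry_vimage:
  fixes f :: "'a::euclidean_space \<Rightarrow> 'a"
  assumes lin: "linear f" and iso: "\<And>x. norm (f x) = norm x"
    and A[measurable]: "A \<in> sets borel"
  shows "emeasure lborel {x. f x \<in> A} = emeasure lborel A"
proof -
  define B where "B = ball (0::'a) 1"
  have [measurable]: "f \<in> borel_measurable borel" "B \<in> sets borel"
    using linear_continuous_on[OF linear_conv_bounded_linear[THEN iffD1, OF lin]]
    by (auto simp: B_def intro: borel_measurable_continuous_onI)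
  have "inj f"
    using iso linear_injective_0[OF lin] by (metis norm_eq_zero)
  then have "surj f" using linear_injective_imp_surjective[OF lin] by simp
  \<comment> \<open>Invariance of the ball under f determines the scalar, a priori unknown, by which
    f could rescale volume.\<close>
  have fB: "f x \<in> B \<longleftrightarrow> x \<in> B" for x by (simp add: B_def iso)
  have "emeasure lborel {x. f x \<in> A} * emeasure lborel B
      = (\<integral>\<^sup>+x. indicator A (f x) * emeasure lborel B \<partial>lborel)"
    by (subst nn_integral_multc) (auto simp: nn_integral_indicator[symmetric] indicator_def
        simp del: nn_integral_indicator intro!: arg_cong2[where f="(*)"] nn_integral_cong)
  also have "\<dots> = (\<integral>\<^sup>+x. indicator A (f x) * (\<integral>\<^sup>+y. indicator B (f x - y) \<partial>lborel) \<partial>lborel)"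
    by (subst nn_integral_lborel_reflect) auto
  also have "\<dots> = (\<integral>\<^sup>+x. (\<integral>\<^sup>+y. indicator A (f x) * indicator B (f x - y) \<partial>lborel) \<partial>lborel)"
    by (subst nn_integral_cmult) auto
  also have "\<dots> = (\<integral>\<^sup>+y. (\<integral>\<^sup>+x. indicator A (f x) * indicator B (f x - y) \<partial>lborel) \<partial>lborel)"
    by (rule lborel_pair.Fubini') simp
  also have "\<dots> = (\<integral>\<^sup>+y. (\<integral>\<^sup>+x. indicator A (f x + y) * indicator B (f x) \<partial>lborel) \<partial>lborel)"
  proof (rule nn_integral_cong)
    fix y
    \<comment> \<open>Surjectivity turns the shift by y after f into a shift by z before f, to which
      Lebesgue measure is blind.\<close>
    obtain z where z: "y = f z" using \<open>surj f\<close> by auto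
    have "(\<integral>\<^sup>+x. indicator A (f x) * indicator B (f x - y) \<partial>lborel)
        = (\<integral>\<^sup>+x. indicator A (f (z + x)) * indicator B (f (z + x) - y) \<partial>lborel)"
      by (rule nn_integral_lborel_shift[symmetric]) simp
    then show "(\<integral>\<^sup>+x. indicator A (f x) * indicator B (f x - y) \<partial>lborel)
        = (\<integral>\<^sup>+x. indicator A (f x + y) * (indicator B (f x) :: ennreal) \<partial>lborel)"
      by (simp add: z linear_add[OF lin] add.commute)
  qed
  also have "\<dots> = (\<integral>\<^sup>+x. (\<integral>\<^sup>+y. indicator A (f x + y) * indicator B (f x) \<partial>lborel) \<partial>lborel)"
    by (rule lborel_pair.Fubini'[symmetric]) simp
  also have "\<dots> = (\<integral>\<^sup>+x. emeasure lborel A * indicator B x \<partial>lborel)"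
    by (intro nn_integral_cong, subst nn_integral_multc)
      (auto simp: nn_integral_lborel_shift[of "indicator A"] indicator_def[of B] fB)
  also have "\<dots> = emeasure lborel A * emeasure lborel B"
    by (subst nn_integral_cmult) auto
  finally show ?thesis
    using emeasure_lborel_unit_ball[where 'a='a]
    by (auto simp: B_def mult.commute[of _ "emeasure lborel (ball 0 1)"] ennreal_mult_cancel_left)
qed

lemma distr_lborel_isometry:
  fixes f :: "'a::euclidean_space \<Rightarrow> 'a"
  assumes lin: "linear f" and iso: "\<And>x. norm (f x) = norm x"
  shows "distr lborel borel f = lborel"
proof (rule measure_eqI)
  have [measurable]: "f \<in> borel_measurable borel"
    using linear_continuous_on[OF linear_conv_bounded_linear[THEN iffD1, OF lin]]
    by (auto intro: borel_measurable_continuous_onI)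
  fix A assume "A \<in> sets (distr lborel borel f)"
  then show "emeasure (distr lborel borel f) A = emeasure lborel A"
    using emeasure_lborel_isometry_vimage[OF lin iso, of A] by (simp add: emeasure_distr vimage_def)
qed simp

lemma nn_integral_sph_isometry:
  fixes f :: "'a::euclidean_space \<Rightarrow> 'a" and g :: "'a \<Rightarrow> ennreal"
  assumes lin: "linear f" and iso: "\<And>x. norm (f x) = norm x"
    and [measurable]: "g \<in> borel_measurable borel"
  shows "(\<integral>\<^sup>+x. g (f x) \<partial>sph) = (\<integral>\<^sup>+x. g x \<partial>sph)"
proof -
  have [measurable]: "ball (0::'a) 1 \<in> sets borel" by simp
  have [measurable]: "f \<in> borel_measurable borel"
    using linear_continuous_on[OF linear_conv_bounded_linear[THEN iffD1, OF lin]]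
    by (auto intro: borel_measurable_continuous_onI)
  have "(\<integral>\<^sup>+x. g (sgn x) * indicator (ball 0 1) x \<partial>lborel)
      = (\<integral>\<^sup>+x. g (sgn x) * indicator (ball 0 1) x \<partial>distr lborel borel f)"
    by (simp add: distr_lborel_isometry[OF lin iso])
  also have "\<dots> = (\<integral>\<^sup>+x. g (sgn (f x)) * indicator (ball 0 1) (f x) \<partial>lborel)"
    by (rule nn_integral_distr) measurable
  also have "\<dots> = (\<integral>\<^sup>+x. g (f (sgn x)) * indicator (ball 0 1) x \<partial>lborel)"
    by (simp add: sgn_div_norm iso linear_scale[OF lin] indicator_def)
  finally show ?thesis by (simp add: nn_integral_sph)
qed

text \<open>For distinct e and e' the reflection in the hyperplane orthogonal to e - e' does
  it.\<close>

lemma exists_isometry: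
  fixes e e' :: "'a::euclidean_space"
  assumes "norm e = 1" "norm e' = 1"
  shows "\<exists>f :: 'a \<Rightarrow> 'a. linear f \<and> (\<forall>x y. f x \<bullet> f y = x \<bullet> y) \<and> f e = e'"
proof (cases "e = e'")
  case True
  then show ?thesis by (intro exI[of _ "\<lambda>x. x"]) (auto intro: linearI)
next
  case False
  define n where "n = e - e'"
  define f where "f x = x - (2 * (x \<bullet> n) / (n \<bullet> n)) *\<^sub>R n" for x
  have nn: "n \<bullet> n \<noteq> 0" using False by (simp add: n_def)
  have ee: "e \<bullet> e = 1" "e' \<bullet> e' = 1" using assms by (simp_all add: dot_square_norm)
  \<comment> \<open>Equal lengths make the coefficient of n in f e equal to 1, so that f e = e -
    n.\<close>
  have "n \<bullet> n = 2 * (e \<bullet> n)" by (simp add: n_def inner_diff ee inner_commute)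
  then have "f e = e'" using nn by (simp add: f_def n_def)
  moreover have "linear f"
    unfolding f_def
    by (intro linearI) (auto simp: inner_add algebra_simps add_divide_distrib scaleR_add_left)
  moreover have "f x \<bullet> f y = x \<bullet> y" for x y
    using nn by (simp add: f_def inner_diff inner_commute field_simps)
  ultimately show ?thesis by blast
qed

text \<open>An isometry taking e to e' leaves the surface measure unchanged. This is why the angular
  mass is the same for all relative velocities.\<close>

lemma nn_integral_sph_inner:
  fixes e e' :: "'a::euclidean_space" and g :: "real \<Rightarrow> ennreal"
  assumes "norm e = 1" "norm e' = 1" and [measurable]: "g \<in> borel_measurable borel"
  shows "(\<integral>\<^sup>+s. g (e \<bullet> s) \<partial>sph) = (\<integral>\<^sup>+s. g (e' \<bullet> s) \<partial>sph)"
proof -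
  obtain f :: "'a \<Rightarrow> 'a" where f: "linear f" "\<And>x y. f x \<bullet> f y = x \<bullet> y" "f e = e'"
    using exists_isometry[OF assms(1,2)] by blast
  have "(\<integral>\<^sup>+s. g (e' \<bullet> f s) \<partial>sph) = (\<integral>\<^sup>+s. g (e' \<bullet> s) \<partial>sph)"
    by (rule nn_integral_sph_isometry[OF f(1)]) (auto simp: norm_eq_sqrt_inner f(2))
  then show ?thesis by (simp add: f(2) flip: f(3))
qed

section \<open>Polar coordinates and the collision change of variables\<close>

lemma norm_sgn_scaleR: "norm u *\<^sub>R sgn u = (u :: 'a::real_normed_vector)"
  by (cases "u = 0") (simp_all add: sgn_div_norm)

lemma emeasure_cone_scale:
  fixes A :: "'a::euclidean_space set"
  assumes [measurable]: "A \<in> sets borel" and r: "r > 0"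
  shows "emeasure lborel {u. norm u < r \<and> sgn u \<in> A}
    = ennreal (r ^ DIM('a)) * emeasure lborel {u. norm u < 1 \<and> sgn u \<in> A}"
proof -
  have "emeasure lborel {u. norm u < r \<and> sgn u \<in> A} = (\<integral>\<^sup>+u. indicator {u. norm u < r \<and> sgn u \<in> A} u \<partial>lborel)"
    by simp
  also have "\<dots> = ennreal (\<bar>r\<bar> ^ DIM('a)) * (\<integral>\<^sup>+u. indicator {u. norm u < r \<and> sgn u \<in> A} (0 + r *\<^sub>R u) \<partial>lborel)"
    using r by (intro nn_integral_lborel_affine) auto
  also have "(\<integral>\<^sup>+u. indicator {u. norm u < r \<and> sgn u \<in> A} (0 + r *\<^sub>R u) \<partial>lborel)
      = (\<integral>\<^sup>+u. indicator {u. norm u < 1 \<and> sgn u \<in> A} u \<partial>lborel)"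
    using r by (intro nn_integral_cong) (auto simp: sgn_scaleR indicator_def)
  finally show ?thesis using r by simp
qed

text \<open>As functions of I both sides are measures on the line, and they agree on the generating
  rays \<open>{..<r}\<close> because cones scale with the power \<open>DIM('a)\<close> of the
  radius. Multiplying by the total surface mass instead of dividing keeps the identity free of
  quotients in \<open>ennreal\<close>.\<close>

lemma emeasure_polar_rectangle:
  fixes A :: "'a::euclidean_space set" and I :: "real set"
  assumes A[measurable]: "A \<in> sets borel" and I: "I \<in> sets borel"
  shows "emeasure sph (UNIV :: 'a set) * emeasure lborel {u. norm u \<in> I \<and> sgn u \<in> A}
    = emeasure sph A * emeasure lborel {u::'a. norm u \<in> I}"
proof -
  define D where "D = density lborel (indicator {u. sgn u \<in> A} :: 'a \<Rightarrow> ennreal)"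
  define M1 where "M1 = scale_measure (emeasure sph (UNIV :: 'a set)) (distr D borel norm)"
  define M2 where "M2 = scale_measure (emeasure sph A) (distr lborel borel (norm :: 'a \<Rightarrow> real))"
  have eD: "emeasure (distr D borel norm) J = emeasure lborel {u. norm u \<in> J \<and> sgn u \<in> A}"
    if [measurable]: "J \<in> sets borel" for J
  proof -
    have "emeasure (distr D borel norm) J = (\<integral>\<^sup>+u. indicator {u. sgn u \<in> A} u * indicator {u. norm u \<in> J} u \<partial>lborel)"
      by (simp add: emeasure_distr D_def emeasure_density vimage_def)
    also have "\<dots> = (\<integral>\<^sup>+u. indicator {u. norm u \<in> J \<and> sgn u \<in> A} u \<partial>lborel)"
      by (intro nn_integral_cong) (auto split: split_indicator)
    finally show ?thesis by simp
  qed
  have e2: "emeasure (distr lborel borel (norm :: 'a \<Rightarrow> real)) J = emeasure lborel {u::'a. norm u \<in> J}"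
    if "J \<in> sets borel" for J
    using that by (simp add: emeasure_distr vimage_def)
  have sph: "emeasure sph B = of_nat DIM('a) * emeasure lborel {x. norm x < 1 \<and> sgn x \<in> B}"
    if "B \<in> sets borel" for B :: "'a set"
    using emeasure_sph[OF that] by (simp add: Collect_conj_eq)
  have U: "(UNIV :: 'a set) \<in> sets borel" by simp
  have "M1 = M2"
  proof (rule measure_eqI_generator_eq[of "range lessThan" UNIV _ _ "\<lambda>i. {..<real i}"])
    show "Int_stable (range (lessThan :: real \<Rightarrow> real set))"
    proof (rule Int_stableI)
      fix a b :: "real set" assume "a \<in> range lessThan" "b \<in> range lessThan"
      then obtain x y where "a = {..<x}" "b = {..<y}" by auto
      then have "a \<inter> b = {..<min x y}" by auto
      then show "a \<inter> b \<in> range lessThan" by blast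
    qed
    show "sets M1 = sigma_sets UNIV (range lessThan)" "sets M2 = sigma_sets UNIV (range lessThan)"
      by (simp_all add: M1_def M2_def borel_Iio)
    show "(\<Union>i. {..<real i}) = UNIV"
      using reals_Archimedean2 by (auto simp: set_eq_iff)
    fix X :: "real set" assume "X \<in> range lessThan"
    then obtain r where X: "X = {..<r}" by auto
    have M1X: "emeasure M1 X = emeasure sph (UNIV :: 'a set) * emeasure lborel {u. norm u < r \<and> sgn u \<in> A}"
      using eD[of X] by (simp add: M1_def X)
    have M2X: "emeasure M2 X = emeasure sph A * emeasure lborel {u::'a. norm u < r \<and> sgn u \<in> UNIV}"
      using e2[of X] by (simp add: M2_def X)
    show "emeasure M1 X = emeasure M2 X"
    proof (cases "r > 0")
      case True
      then show ?thesis
        unfolding M1X M2X emeasure_cone_scale[OF A True] emeasure_cone_scale[OF U True]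
          sph[OF A] sph[OF U]
        by (simp only: mult_ac)
    next
      case False
      then have "\<not> norm u < r" for u :: 'a using norm_ge_zero[of u] by linarith
      then show ?thesis unfolding M1X M2X by simp
    qed
  next
    fix i :: nat
    have "emeasure lborel {u. norm u < real i \<and> sgn u \<in> A} \<le> emeasure lborel (ball (0::'a) (real i))"
      by (intro emeasure_mono) auto
    also have "\<dots> < \<infinity>" by (rule emeasure_bounded_finite) simp
    finally have "emeasure lborel {u. norm u < real i \<and> sgn u \<in> A} \<noteq> \<infinity>" by simp
    then show "emeasure M1 {..<real i} \<noteq> \<infinity>"
      using eD[of "{..<real i}"] sph.emeasure_finite[of "UNIV :: 'a set"]
      by (auto simp: M1_def ennreal_mult_eq_top_iff)
  qed auto
  then have "emeasure M1 I = emeasure M2 I" by simp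
  then show ?thesis using eD[OF I] e2[OF I] by (simp add: M1_def M2_def)
qed

text \<open>The radial measure is the image of Lebesgue measure under the norm, divided by the total
  mass of the sphere. Its density is never computed: to exchange directions it is enough that norm
  and direction split into a product measure.\<close>

lemma polar_decomposition:
  "\<exists>rad :: real measure. sigma_finite_measure rad \<and> sets rad = sets borel \<and>
    (\<forall>g :: real \<times> 'a::euclidean_space \<Rightarrow> ennreal. g \<in> borel_measurable (borel \<Otimes>\<^sub>M borel) \<longrightarrow>
      (\<integral>\<^sup>+u. g (norm u, sgn u) \<partial>lborel) = (\<integral>\<^sup>+r. (\<integral>\<^sup>+s. g (r, s) \<partial>sph) \<partial>rad))"
proof -
  define S where "S = emeasure sph (UNIV :: 'a set)"
  have S: "S \<noteq> 0" "S \<noteq> \<infinity>" using sph_UNIV_pos sph.emeasure_finite by (auto simp: S_def)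
  have S1: "inverse S * S = 1" using S by (simp add: ennreal_divide_self mult.commute less_top flip: divide_ennreal_def)
  define rad where "rad = scale_measure (inverse S) (distr lborel borel (norm :: 'a \<Rightarrow> real))"
  have sets[simp, measurable_cong]: "sets rad = sets borel" by (simp add: rad_def)
  have space[simp]: "space rad = UNIV" by (simp add: rad_def space_scale_measure)
  have erad: "emeasure rad I = inverse S * emeasure lborel {u::'a. norm u \<in> I}" if "I \<in> sets borel" for I
    using that by (simp add: rad_def emeasure_distr vimage_def)
  have sf: "sigma_finite_measure rad"
  proof
    show "\<exists>A. countable A \<and> A \<subseteq> sets rad \<and> \<Union> A = space rad \<and> (\<forall>a\<in>A. emeasure rad a \<noteq> \<infinity>)"
    proof (intro exI[of _ "range (\<lambda>i::nat. {..<real i})"] conjI ballI)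
      show "\<Union> (range (\<lambda>i::nat. {..<real i})) = space rad"
        using reals_Archimedean2 by (auto simp: set_eq_iff)
      fix a :: "real set" assume "a \<in> range (\<lambda>i::nat. {..<real i})"
      then obtain i :: nat where a: "a = {..<real i}" by auto
      have "emeasure lborel {u::'a. norm u \<in> a} \<le> emeasure lborel (ball (0::'a) (real i))"
        by (intro emeasure_mono) (auto simp: a)
      also have "\<dots> < \<infinity>" by (rule emeasure_bounded_finite) simp
      finally show "emeasure rad a \<noteq> \<infinity>"
        using S by (subst erad) (auto simp: a ennreal_mult_eq_top_iff)
    qed auto
  qed
  have eq: "rad \<Otimes>\<^sub>M sph = distr lborel (borel \<Otimes>\<^sub>M borel) (\<lambda>u::'a. (norm u, sgn u))"
  proof (rule pair_measure_eqI[OF sf])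
    show "sigma_finite_measure (sph :: 'a measure)" ..
    show "sets (rad \<Otimes>\<^sub>M sph) = sets (distr lborel (borel \<Otimes>\<^sub>M borel) (\<lambda>u::'a. (norm u, sgn u)))"
      by (simp add: sets_pair_measure_cong[OF sets sets_sph])
    fix I :: "real set" and A :: "'a set" assume "I \<in> sets rad" "A \<in> sets sph"
    then have [measurable]: "I \<in> sets borel" "A \<in> sets borel" by auto
    have "emeasure rad I * emeasure sph A = inverse S * (emeasure sph A * emeasure lborel {u::'a. norm u \<in> I})"
      by (simp add: erad mult_ac)
    also have "\<dots> = inverse S * S * emeasure lborel {u::'a. norm u \<in> I \<and> sgn u \<in> A}"
      by (subst emeasure_polar_rectangle[symmetric]) (auto simp: S_def mult_ac)
    also have "\<dots> = emeasure lborel {u::'a. norm u \<in> I \<and> sgn u \<in> A}" by (simp add: S1)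
    also have "\<dots> = emeasure (distr lborel (borel \<Otimes>\<^sub>M borel) (\<lambda>u::'a. (norm u, sgn u))) (I \<times> A)"
      by (subst emeasure_distr) (auto intro!: arg_cong[where f="emeasure lborel"])
    finally show "emeasure rad I * emeasure sph A
        = emeasure (distr lborel (borel \<Otimes>\<^sub>M borel) (\<lambda>u::'a. (norm u, sgn u))) (I \<times> A)" .
  qed
  have "(\<integral>\<^sup>+u. g (norm u, sgn u) \<partial>lborel) = (\<integral>\<^sup>+r. (\<integral>\<^sup>+s. g (r, s) \<partial>sph) \<partial>rad)"
    if [measurable]: "g \<in> borel_measurable (borel \<Otimes>\<^sub>M borel)" for g :: "real \<times> 'a \<Rightarrow> ennreal"
  proof -
    have "(\<integral>\<^sup>+u. g (norm u, sgn u) \<partial>lborel) = (\<integral>\<^sup>+x. g x \<partial>(rad \<Otimes>\<^sub>M sph))"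
      unfolding eq by (subst nn_integral_distr) simp_all
    also have "\<dots> = (\<integral>\<^sup>+r. (\<integral>\<^sup>+s. g (r, s) \<partial>sph) \<partial>rad)"
      by (rule sph.nn_integral_fst[symmetric]) simp
    finally show ?thesis .
  qed
  then show ?thesis using sf sets by (intro exI[of _ rad]) auto
qed

text \<open>Once u = r w is written in polar coordinates, exchanging its direction w with s is
  Fubini on the product of the sphere with itself.\<close>

lemma nn_integral_swap_direction:
  fixes G :: "'a::euclidean_space \<Rightarrow> 'a \<Rightarrow> ennreal"
  assumes [measurable]: "case_prod G \<in> borel_measurable (borel \<Otimes>\<^sub>M borel)"
  shows "(\<integral>\<^sup>+u. (\<integral>\<^sup>+s. G u s \<partial>sph) \<partial>lborel) = (\<integral>\<^sup>+u. (\<integral>\<^sup>+s. G (norm u *\<^sub>R s) (sgn u) \<partial>sph) \<partial>lborel)"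
proof -
  obtain rad :: "real measure" where rad: "sigma_finite_measure rad" "sets rad = sets borel"
    "\<And>g :: real \<times> 'a \<Rightarrow> ennreal. g \<in> borel_measurable (borel \<Otimes>\<^sub>M borel) \<Longrightarrow>
      (\<integral>\<^sup>+u. g (norm u, sgn u) \<partial>lborel) = (\<integral>\<^sup>+r. (\<integral>\<^sup>+s. g (r, s) \<partial>sph) \<partial>rad)"
    using polar_decomposition[where 'a='a] by blast
  interpret pair: pair_sigma_finite "sph :: 'a measure" "sph :: 'a measure" ..
  have "(\<integral>\<^sup>+u. (\<integral>\<^sup>+s. G u s \<partial>sph) \<partial>lborel)
      = (\<integral>\<^sup>+u. (\<lambda>p. \<integral>\<^sup>+s. G (fst p *\<^sub>R snd p) s \<partial>sph) (norm u, sgn u) \<partial>lborel)"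
    by (simp add: norm_sgn_scaleR)
  also have "\<dots> = (\<integral>\<^sup>+r. (\<integral>\<^sup>+w. (\<integral>\<^sup>+s. G (r *\<^sub>R w) s \<partial>sph) \<partial>sph) \<partial>rad)"
    by (subst rad(3)) auto
  also have "\<dots> = (\<integral>\<^sup>+r. (\<integral>\<^sup>+w. (\<integral>\<^sup>+s. G (r *\<^sub>R s) w \<partial>sph) \<partial>sph) \<partial>rad)"
    by (intro nn_integral_cong pair.Fubini') measurable
  also have "\<dots> = (\<integral>\<^sup>+u. (\<lambda>p. \<integral>\<^sup>+s. G (fst p *\<^sub>R s) (snd p) \<partial>sph) (norm u, sgn u) \<partial>lborel)"
    by (subst rad(3)) auto
  finally show ?thesis by simp
qed

text \<open>The substitution v = x + u / 2, w = x - u / 2 preserves volume. It is factored into a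
  reflection in w alone and a translation in v alone, so no determinant is computed.\<close>

lemma nn_integral_center_of_mass:
  fixes F :: "'a::euclidean_space \<Rightarrow> 'a \<Rightarrow> ennreal"
  assumes [measurable]: "case_prod F \<in> borel_measurable (borel \<Otimes>\<^sub>M borel)"
  shows "(\<integral>\<^sup>+v. (\<integral>\<^sup>+w. F v w \<partial>lborel) \<partial>lborel)
    = (\<integral>\<^sup>+u. (\<integral>\<^sup>+x. F (x + u /\<^sub>R 2) (x - u /\<^sub>R 2) \<partial>lborel) \<partial>lborel)"
proof -
  have "(\<integral>\<^sup>+v. (\<integral>\<^sup>+w. F v w \<partial>lborel) \<partial>lborel) = (\<integral>\<^sup>+v. (\<integral>\<^sup>+u. F v (v - u) \<partial>lborel) \<partial>lborel)"
    by (intro nn_integral_cong nn_integral_lborel_reflect[symmetric]) simp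
  also have "\<dots> = (\<integral>\<^sup>+u. (\<integral>\<^sup>+v. F v (v - u) \<partial>lborel) \<partial>lborel)"
    by (rule lborel_pair.Fubini'[symmetric]) simp
  also have "\<dots> = (\<integral>\<^sup>+u. (\<integral>\<^sup>+x. F (u /\<^sub>R 2 + x) (u /\<^sub>R 2 + x - u) \<partial>lborel) \<partial>lborel)"
    by (intro nn_integral_cong nn_integral_lborel_shift[symmetric]) simp
  also have "\<dots> = (\<integral>\<^sup>+u. (\<integral>\<^sup>+x. F (x + u /\<^sub>R 2) (x - u /\<^sub>R 2) \<partial>lborel) \<partial>lborel)"
  proof -
    have "u /\<^sub>R 2 + x - u = x - u /\<^sub>R 2" for u x :: 'a
    proof -
      have "u = u /\<^sub>R 2 + u /\<^sub>R 2" by (simp flip: scaleR_add_left)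
      then show ?thesis by (metis add_diff_cancel_left diff_diff_add add.commute)
    qed
    then show ?thesis by (simp only: add.commute)
  qed
  finally show ?thesis .
qed

lemma measurable_post [measurable (raw)]:
  assumes [measurable]: "f \<in> borel_measurable M" "g \<in> borel_measurable M" "h \<in> borel_measurable M"
  shows "(\<lambda>x. post (f x) (g x) (h x)) \<in> borel_measurable M"
    "(\<lambda>x. post_star (f x) (g x) (h x)) \<in> borel_measurable M"
    "(\<lambda>x. cos_angle (f x) (g x) (h x)) \<in> borel_measurable M"
  unfolding post_def post_star_def cos_angle_def by measurable

lemma measurable_compose3:
  assumes "(\<lambda>(v, w, s). F v w s) \<in> borel_measurable (borel \<Otimes>\<^sub>M borel \<Otimes>\<^sub>M borel)"
    and "f \<in> borel_measurable M" "g \<in> borel_measurable M" "h \<in> borel_measurable M"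
  shows "(\<lambda>x. F (f x) (g x) (h x)) \<in> borel_measurable M"
  using measurable_compose[OF _ assms(1), of "\<lambda>x. (f x, g x, h x)" M] assms(2-) by simp

text \<open>In the variables \<open>x = (v + w) / 2\<close> and \<open>u = v - w\<close> a collision fixes \<open>x\<close> and \<open>norm u\<close> and
  exchanges the direction of \<open>u\<close> with \<open>\<sigma>\<close>.\<close>

lemma nn_integral_collision:
  fixes F :: "'a::euclidean_space \<Rightarrow> 'a \<Rightarrow> 'a \<Rightarrow> ennreal"
  assumes [measurable]: "(\<lambda>(v, w, s). F v w s) \<in> borel_measurable (borel \<Otimes>\<^sub>M borel \<Otimes>\<^sub>M borel)"
  shows "(\<integral>\<^sup>+v. (\<integral>\<^sup>+w. (\<integral>\<^sup>+s. F (post v w s) (post_star v w s) (sgn (v - w)) \<partial>sph) \<partial>lborel) \<partial>lborel)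
    = (\<integral>\<^sup>+v. (\<integral>\<^sup>+w. (\<integral>\<^sup>+s. F v w s \<partial>sph) \<partial>lborel) \<partial>lborel)"
proof -
  interpret pair: pair_sigma_finite lborel "sph :: 'a measure" ..
  note [measurable (raw)] = measurable_compose3[OF assms]
  have half: "x + u /\<^sub>R 2 + (x - u /\<^sub>R 2) = 2 *\<^sub>R x" "x + u /\<^sub>R 2 - (x - u /\<^sub>R 2) = u" for x u :: 'a
    by (simp_all add: scaleR_2 flip: scaleR_add_left)
  define G where "G u s = (\<integral>\<^sup>+x. F (x + u /\<^sub>R 2) (x - u /\<^sub>R 2) s \<partial>lborel)" for u s
  have [measurable]: "case_prod G \<in> borel_measurable (borel \<Otimes>\<^sub>M borel)"
    unfolding G_def by measurable
  have "(\<integral>\<^sup>+v. (\<integral>\<^sup>+w. (\<integral>\<^sup>+s. F v w s \<partial>sph) \<partial>lborel) \<partial>lborel)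
      = (\<integral>\<^sup>+u. (\<integral>\<^sup>+x. (\<integral>\<^sup>+s. F (x + u /\<^sub>R 2) (x - u /\<^sub>R 2) s \<partial>sph) \<partial>lborel) \<partial>lborel)"
    by (rule nn_integral_center_of_mass) measurable
  also have "\<dots> = (\<integral>\<^sup>+u. (\<integral>\<^sup>+s. G u s \<partial>sph) \<partial>lborel)"
    unfolding G_def by (intro nn_integral_cong pair.Fubini'[symmetric]) measurable
  also have "\<dots> = (\<integral>\<^sup>+u. (\<integral>\<^sup>+s. G (norm u *\<^sub>R s) (sgn u) \<partial>sph) \<partial>lborel)"
    by (rule nn_integral_swap_direction) measurable
  also have "\<dots> = (\<integral>\<^sup>+u. (\<integral>\<^sup>+x. (\<integral>\<^sup>+s.
      F (x + (norm u *\<^sub>R s) /\<^sub>R 2) (x - (norm u *\<^sub>R s) /\<^sub>R 2) (sgn u) \<partial>sph) \<partial>lborel) \<partial>lborel)"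
    unfolding G_def by (intro nn_integral_cong pair.Fubini') measurable
  also have "\<dots> = (\<integral>\<^sup>+u. (\<integral>\<^sup>+x. (\<integral>\<^sup>+s. F (post (x + u /\<^sub>R 2) (x - u /\<^sub>R 2) s)
      (post_star (x + u /\<^sub>R 2) (x - u /\<^sub>R 2) s) (sgn (x + u /\<^sub>R 2 - (x - u /\<^sub>R 2))) \<partial>sph) \<partial>lborel) \<partial>lborel)"
    unfolding post_def post_star_def half by simp
  also have "\<dots> = (\<integral>\<^sup>+v. (\<integral>\<^sup>+w. (\<integral>\<^sup>+s. F (post v w s) (post_star v w s) (sgn (v - w)) \<partial>sph) \<partial>lborel) \<partial>lborel)"
    by (rule nn_integral_center_of_mass[symmetric]) measurable
  finally show ?thesis ..
qed

section \<open>Irreducibility\<close>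

text \<open>A differentiable map of the space into itself sends null sets to null sets, injective or
  not. In the form of \<open>cover\<close> it takes one bad preimage of each bad point, and neither
  an inverse nor a Jacobian.\<close>

lemma AE_lborel_differentiable_image:
  fixes f :: "'a::euclidean_space \<Rightarrow> 'a"
  assumes P: "AE u in lborel. P u" and f: "f differentiable_on D"
    and cover: "\<And>z. \<not> Q z \<Longrightarrow> \<exists>u\<in>D. \<not> P u \<and> z = f u"
  shows "AE z in lborel. Q z"
proof -
  obtain N where N: "N \<in> null_sets lborel" "{u. \<not> P u} \<subseteq> N"
    using P by (auto simp: eventually_ae_filter)
  have "negligible N"
    using N(1) by (auto simp: negligible_iff_null_sets null_sets_completion_iff2)
  then have "negligible (N \<inter> D)" by (rule negligible_subset) auto
  then have "negligible (f ` (N \<inter> D))"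
    by (rule negligible_differentiable_image_negligible[OF order_refl])
      (rule differentiable_on_subset[OF f], auto)
  then obtain N' where N': "N' \<in> null_sets lborel" "f ` (N \<inter> D) \<subseteq> N'"
    by (auto simp: negligible_iff_null_sets null_sets_completion_iff2)
  have "{z. \<not> Q z} \<subseteq> N'"
  proof safe
    fix z assume "\<not> Q z"
    then obtain u where "u \<in> D" "\<not> P u" "z = f u" using cover by blast
    then show "z \<in> N'" using N(2) N'(2) by blast
  qed
  then show ?thesis using N'(1) by (intro AE_I'[of N']) auto
qed

lemma negligible_AE_lborel:
  assumes "negligible {x :: 'a::euclidean_space. \<not> P x}"
  shows "AE x in lborel. P x"
  using assms by (auto simp: negligible_iff_null_sets null_sets_completion_iff2 intro: AE_I')

text \<open>\<open>(|u|\<sigma> - u) / 2\<close> is the jump \<open>v' - v\<close> for the relative velocity \<open>u = v - w\<close>.\<close>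

lemma AE_jump_fixed_direction:
  fixes s :: "'a::euclidean_space" and b :: "real \<Rightarrow> real"
  assumes s: "norm s = 1"
    and ae: "AE u in lborel. b (sgn u \<bullet> s) = 0 \<or> (norm u *\<^sub>R s - u) /\<^sub>R 2 \<notin> N"
  shows "AE z in lborel. s \<bullet> z \<le> 0 \<or> b (1 - 2 * (s \<bullet> sgn z)\<^sup>2) = 0 \<or> z \<notin> N"
proof (rule AE_lborel_differentiable_image[OF ae, of _ "- {0}"])
  show "(\<lambda>u. (norm u *\<^sub>R s - u) /\<^sub>R 2) differentiable_on - {0}"
    by (rule differentiable_at_imp_differentiable_on) (auto intro!: derivative_intros)
  fix z assume "\<not> (s \<bullet> z \<le> 0 \<or> b (1 - 2 * (s \<bullet> sgn z)\<^sup>2) = 0 \<or> z \<notin> N)"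
  then have z: "s \<bullet> z > 0" "b (1 - 2 * (s \<bullet> sgn z)\<^sup>2) \<noteq> 0" "z \<in> N" by auto
  have z0: "norm z \<noteq> 0" using z(1) by auto
  have ss: "s \<bullet> s = 1" using s by (simp add: dot_square_norm)
  \<comment> \<open>Solving norm u s - u = 2 z for u gives u = rho s - 2 z with norm u = rho, and
    squaring this norm forces rho (s . z) = norm z ^ 2. The condition s . z > 0 makes rho
    positive.\<close>
  define \<rho> where "\<rho> = (norm z)\<^sup>2 / (s \<bullet> z)"
  have \<rho>: "\<rho> > 0" using z z0 by (simp add: \<rho>_def)
  define u where "u = \<rho> *\<^sub>R s - 2 *\<^sub>R z"
  have "u \<bullet> u = \<rho>\<^sup>2 - 4 * (\<rho> * (s \<bullet> z)) + 4 * (norm z)\<^sup>2"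
    by (simp add: u_def inner_diff inner_commute ss power2_eq_square[of \<rho>] power2_norm_eq_inner algebra_simps)
  also have "\<rho> * (s \<bullet> z) = (norm z)\<^sup>2" using z by (simp add: \<rho>_def)
  finally have nu: "norm u = \<rho>" using \<rho> by (simp add: norm_eq_sqrt_inner)
  have "sgn u \<bullet> s = (\<rho> - 2 * (s \<bullet> z)) / \<rho>"
    unfolding sgn_div_norm nu
    by (simp add: u_def inner_diff ss inner_commute divide_inverse mult.commute)
  also have "\<dots> = 1 - 2 * (s \<bullet> z)\<^sup>2 / (norm z)\<^sup>2"
    using z z0 by (simp add: \<rho>_def field_simps power2_eq_square)
  also have "\<dots> = 1 - 2 * (s \<bullet> sgn z)\<^sup>2"
    by (simp add: sgn_div_norm power_mult_distrib divide_inverse power_inverse mult_ac)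
  finally have "b (sgn u \<bullet> s) \<noteq> 0" using z(2) by simp
  moreover have "(norm u *\<^sub>R s - u) /\<^sub>R 2 = z" unfolding nu by (simp add: u_def)
  moreover have "u \<noteq> 0" using nu \<rho> by auto
  ultimately show "\<exists>u\<in>- {0}. \<not> (b (sgn u \<bullet> s) = 0 \<or> (norm u *\<^sub>R s - u) /\<^sub>R 2 \<notin> N) \<and>
      z = (norm u *\<^sub>R s - u) /\<^sub>R 2"
    using z(3) by (intro bexI[of _ u]) auto
qed

text \<open>1 - 2 (e . s)^2 is the inner product of e with its mirror image e - 2 (e . s) s, and
  every unit vector other than e is such an image, for s proportional to its difference from e.
  \<open>G\<close> extends this map to the whole space, homogeneous of degree one, so that null sets
  can be pushed forward by it. The ray through e is null because the dimension is at least
  2.\<close>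

lemma AE_sph_double_angle:
  fixes e :: "'a::euclidean_space" and b :: "real \<Rightarrow> real"
  assumes dim: "DIM('a) \<ge> 2" and e: "norm e = 1" and [measurable]: "b \<in> borel_measurable borel"
    and ae: "AE s in sph. b (1 - 2 * (e \<bullet> s)\<^sup>2) = 0"
  shows "AE s in sph. b (e \<bullet> s) = 0"
proof -
  have ee: "e \<bullet> e = 1" using e by (simp add: dot_square_norm)
  define G where "G x = norm x *\<^sub>R e - (2 * (e \<bullet> x) / norm x) *\<^sub>R x" for x
  have "AE x in lborel. x \<in> ball 0 1 \<longrightarrow> b (1 - 2 * (e \<bullet> sgn x)\<^sup>2) = 0"
    using ae by (subst (asm) AE_sph_iff) auto
  then have "AE y in lborel. y = 0 \<or> sgn y = e \<or> (y \<in> ball 0 1 \<longrightarrow> b (e \<bullet> sgn y) = 0)"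
  proof (rule AE_lborel_differentiable_image[of _ G "- {0}"])
    show "G differentiable_on - {0}"
      unfolding G_def
      by (rule differentiable_at_imp_differentiable_on) (auto intro!: derivative_intros)
    fix y assume "\<not> (y = 0 \<or> sgn y = e \<or> (y \<in> ball 0 1 \<longrightarrow> b (e \<bullet> sgn y) = 0))"
    then have y: "y \<noteq> 0" "sgn y \<noteq> e" "norm y < 1" "b (e \<bullet> sgn y) \<noteq> 0" by auto
    \<comment> \<open>n is the unit normal of the mirror that takes e to sgn y; giving n the length
      of y yields the preimage of y under \<open>G\<close>.\<close>
    define k n where "k = norm (e - sgn y)" and "n = (e - sgn y) /\<^sub>R k"
    have k: "k > 0" using y(2) by (simp add: k_def)
    have yy: "sgn y \<bullet> sgn y = 1" using y(1) by (simp add: dot_square_norm norm_sgn)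
    have k2: "k\<^sup>2 = 2 - 2 * (e \<bullet> sgn y)"
      by (simp add: k_def power2_norm_eq_inner inner_diff ee yy inner_commute)
    have n1: "norm n = 1" using k by (simp add: n_def k_def)
    have en: "e \<bullet> n = k / 2"
    proof -
      have "e \<bullet> n = (1 - e \<bullet> sgn y) / k" by (simp add: n_def inner_diff ee divide_inverse mult.commute)
      also have "\<dots> = (k\<^sup>2 / 2) / k" using k2 by (simp add: diff_divide_distrib)
      finally show ?thesis using k by (simp add: power2_eq_square)
    qed
    define x where "x = norm y *\<^sub>R n"
    have x: "norm x = norm y" "sgn x = n"
      using y n1 by (auto simp: x_def sgn_scaleR) (simp_all add: sgn_div_norm)
    have "G x = norm y *\<^sub>R e - (k * norm y) *\<^sub>R n"
      using y by (simp add: G_def x(1)) (simp add: x_def en)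
    also have "\<dots> = norm y *\<^sub>R (e - k *\<^sub>R n)" by (simp add: scaleR_diff_right mult.commute)
    also have "e - k *\<^sub>R n = sgn y" using k by (simp add: n_def)
    finally have "G x = y" by (simp add: norm_sgn_scaleR)
    moreover have "1 - 2 * (e \<bullet> sgn x)\<^sup>2 = e \<bullet> sgn y"
      using k2 by (simp add: x en power_divide field_simps)
    moreover have "x \<noteq> 0" using x y by auto
    ultimately show "\<exists>x\<in>- {0}. \<not> (x \<in> ball 0 1 \<longrightarrow> b (1 - 2 * (e \<bullet> sgn x)\<^sup>2) = 0) \<and> y = G x"
      using y x(1) by (intro bexI[of _ x]) auto
  qed
  moreover have "AE y in lborel. sgn y \<noteq> e"
  proof (rule negligible_AE_lborel, rule negligible_lowdim)
    have "y \<in> span {e}" if "sgn y = e" for y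
      using that norm_sgn_scaleR[of y] by (metis span_base span_mul singletonI)
    then have "{y. \<not> sgn y \<noteq> e} \<subseteq> span {e}" by auto
    then have "dim {y. \<not> sgn y \<noteq> e} \<le> card {e}" by (intro dim_le_card) auto
    then show "dim {y. \<not> sgn y \<noteq> e} < DIM('a)" using dim by simp
  qed
  moreover have "AE y in lborel. y \<noteq> (0::'a)" by (rule AE_lborel_singleton)
  ultimately have "AE y in lborel. y \<in> ball 0 1 \<longrightarrow> b (e \<bullet> sgn y) = 0"
    by eventually_elim auto
  then show ?thesis by (subst AE_sph_iff) auto
qed

lemma AE_sph_uminus:
  assumes [measurable]: "Measurable.pred borel P" and "AE s in sph. P s"
  shows "AE s in sph. P (- s :: 'a::euclidean_space)"
proof -
  have [measurable]: "Measurable.pred borel (\<lambda>s::'a. P (- s))"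
    by (rule measurable_compose[OF _ assms(1)]) simp
  have "emeasure sph {s. \<not> P s} = 0"
    using assms(2) AE_iff_measurable[of "{s. \<not> P s}" sph P] by simp
  moreover have "emeasure sph {s. \<not> P (- s)} = (\<integral>\<^sup>+s. indicator {s. \<not> P (- s)} s \<partial>sph)"
    by simp
  moreover have "\<dots> = (\<integral>\<^sup>+s. indicator {s. \<not> P s} (- s) \<partial>sph)"
    by (intro nn_integral_cong) (simp add: indicator_def)
  moreover have "\<dots> = (\<integral>\<^sup>+s. indicator {s. \<not> P s} s \<partial>sph)"
    by (rule nn_integral_sph_isometry) (auto intro: linearI)
  ultimately have "emeasure sph {s. \<not> P (- s)} = 0" by simp
  then show ?thesis
    using AE_iff_measurable[of "{s. \<not> P (- s)}" sph "\<lambda>s. P (- s)"] by simp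
qed

text \<open>Fubini reduces the claim to one displacement z in N, of direction e. For almost every s
  with s . z > 0, b vanishes at 1 - 2 (e . s)^2; this expression is even in s, so the antipodal half
  follows, and the equator is null. \<open>AE_sph_double_angle\<close> then contradicts
  \<open>pos\<close>.\<close>

lemma AE_jump_null:
  fixes N :: "'a::euclidean_space set" and b :: "real \<Rightarrow> real"
  assumes dim: "DIM('a) \<ge> 2" and [measurable]: "b \<in> borel_measurable borel" "N \<in> sets borel"
    and pos: "\<And>e :: 'a. norm e = 1 \<Longrightarrow> \<not> (AE s in sph. b (e \<bullet> s) = 0)"
    and ae: "AE s in sph. AE u in lborel. b (sgn u \<bullet> s) = 0 \<or> (norm u *\<^sub>R s - u) /\<^sub>R 2 \<notin> N"
  shows "AE z in lborel. z \<notin> N"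
proof -
  interpret pair: pair_sigma_finite lborel "sph :: 'a measure" ..
  define R where "R z s \<longleftrightarrow> s \<bullet> z \<le> 0 \<or> b (1 - 2 * (s \<bullet> sgn z)\<^sup>2) = 0 \<or> z \<notin> N" for z s
  have R: "{x \<in> space (lborel \<Otimes>\<^sub>M sph). R (fst x) (snd x)} \<in> sets (lborel \<Otimes>\<^sub>M sph)"
    unfolding R_def by measurable
  have "AE s in sph. AE z in lborel. R z s"
    using ae AE_sph_norm unfolding R_def by eventually_elim (rule AE_jump_fixed_direction)
  then have "AE z in lborel. AE s in sph. R z s"
    using pair.AE_commute[OF R] by simp
  moreover have "AE z in lborel. z \<noteq> (0::'a)" by (rule AE_lborel_singleton)
  ultimately show ?thesis
  proof eventually_elim
    case (elim z)
    show ?case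
    proof
      assume "z \<in> N"
      define e where "e = sgn z"
      have e: "norm e = 1" using elim by (simp add: e_def norm_sgn)
      have 1: "AE s in sph. s \<bullet> z \<le> 0 \<or> b (1 - 2 * (e \<bullet> s)\<^sup>2) = 0"
        using elim(1) \<open>z \<in> N\<close> unfolding R_def by (simp add: e_def inner_commute)
      have 2: "AE s in sph. - s \<bullet> z \<le> 0 \<or> b (1 - 2 * (e \<bullet> (- s))\<^sup>2) = 0"
        by (rule AE_sph_uminus[OF _ 1]) measurable
      have 3: "AE s in sph. s \<bullet> z \<noteq> 0"
      proof (subst AE_sph_iff)
        have "AE x in lborel. z \<bullet> x \<noteq> 0"
          using elim by (intro negligible_AE_lborel) (simp add: negligible_hyperplane)
        then show "AE x in lborel. x \<in> ball 0 1 \<longrightarrow> sgn x \<bullet> z \<noteq> 0"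
          by eventually_elim (auto simp: sgn_div_norm inner_commute)
      qed measurable
      have "AE s in sph. b (1 - 2 * (e \<bullet> s)\<^sup>2) = 0"
        using 1 2 3 by eventually_elim auto
      then have "AE s in sph. b (e \<bullet> s) = 0"
        using AE_sph_double_angle[OF dim e] by simp
      then show False using pos[OF e] by simp
    qed
  qed
qed

section \<open>Convergence of reversible chains\<close>

text \<open>An almost everywhere convergent subsequence supplies the limit, and Fatou's lemma along
  it bounds the distance of every late term to that limit.\<close>

lemma L1_complete:
  fixes s :: "nat \<Rightarrow> 'b \<Rightarrow> real"
  assumes int[measurable]: "\<And>n. integrable M (s n)"
    and cauchy: "\<And>e. e > 0 \<Longrightarrow> \<exists>N. \<forall>i\<ge>N. \<forall>j\<ge>N. (\<integral>x. \<bar>s i x - s j x\<bar> \<partial>M) < e"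
  shows "\<exists>f. integrable M f \<and> (\<lambda>n. \<integral>x. \<bar>s n x - f x\<bar> \<partial>M) \<longlonglongrightarrow> 0"
proof -
  obtain r where r: "strict_mono r" "AE x in M. Cauchy (\<lambda>i. s (r i) x)"
    using cauchy_L1_AE_cauchy_subseq[of M s] int cauchy by auto
  have [measurable]: "s n \<in> borel_measurable M" for n using int by auto
  define f where "f x = lim (\<lambda>i. s (r i) x)" for x
  have [measurable]: "f \<in> borel_measurable M" unfolding f_def by measurable
  have lim: "AE x in M. (\<lambda>i. s (r i) x) \<longlonglongrightarrow> f x"
    using r(2) by eventually_elim (simp add: f_def Cauchy_convergent_iff convergent_LIMSEQ_iff)
  have bound: "(\<integral>\<^sup>+x. ennreal \<bar>s i x - f x\<bar> \<partial>M) \<le> ennreal e"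
    if N: "\<forall>i\<ge>N. \<forall>j\<ge>N. (\<integral>x. \<bar>s i x - s j x\<bar> \<partial>M) < e" and i: "i \<ge> N" for i N e
  proof -
    have "(\<integral>\<^sup>+x. ennreal \<bar>s i x - f x\<bar> \<partial>M) = (\<integral>\<^sup>+x. liminf (\<lambda>j. ennreal \<bar>s i x - s (r j) x\<bar>) \<partial>M)"
    proof (rule nn_integral_cong_AE)
      show "AE x in M. ennreal \<bar>s i x - f x\<bar> = liminf (\<lambda>j. ennreal \<bar>s i x - s (r j) x\<bar>)"
        using lim
      proof eventually_elim
        case (elim x)
        have "(\<lambda>j. ennreal \<bar>s i x - s (r j) x\<bar>) \<longlonglongrightarrow> ennreal \<bar>s i x - f x\<bar>"
          by (intro tendsto_intros elim)
        then show ?case using lim_imp_Liminf[OF sequentially_bot] by metis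
      qed
    qed
    also have "\<dots> \<le> liminf (\<lambda>j. \<integral>\<^sup>+x. ennreal \<bar>s i x - s (r j) x\<bar> \<partial>M)"
      by (rule nn_integral_liminf) simp
    also have "\<dots> \<le> ennreal e"
    proof (rule Liminf_le)
      show "\<forall>\<^sub>F j in sequentially. (\<integral>\<^sup>+x. ennreal \<bar>s i x - s (r j) x\<bar> \<partial>M) \<le> ennreal e"
        using eventually_ge_at_top[of N]
      proof eventually_elim
        case (elim j)
        then have "r j \<ge> N" using seq_suble[OF r(1), of j] by simp
        then have "(\<integral>x. \<bar>s i x - s (r j) x\<bar> \<partial>M) < e" using N i by simp
        then show ?case using int by (subst nn_integral_eq_integral) (auto intro!: ennreal_leI)
      qed
    qed simp
    finally show ?thesis .
  qed
  obtain N1 where "\<forall>i\<ge>N1. \<forall>j\<ge>N1. (\<integral>x. \<bar>s i x - s j x\<bar> \<partial>M) < 1"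
    using cauchy[of 1] by auto
  from bound[OF this order_refl] have "(\<integral>\<^sup>+x. ennreal \<bar>s N1 x - f x\<bar> \<partial>M) < \<infinity>"
    by (simp add: le_less_trans)
  then have "integrable M (\<lambda>x. s N1 x - f x)"
    by (intro integrableI_bounded) auto
  from Bochner_Integration.integrable_diff[OF int[of N1] this] have f: "integrable M f" by simp
  have "(\<lambda>n. \<integral>x. \<bar>s n x - f x\<bar> \<partial>M) \<longlonglongrightarrow> 0"
  proof (rule LIMSEQ_I)
    fix e :: real assume "e > 0"
    then obtain N where N: "\<forall>i\<ge>N. \<forall>j\<ge>N. (\<integral>x. \<bar>s i x - s j x\<bar> \<partial>M) < e / 2"
      using cauchy[of "e / 2"] by auto
    have le: "(\<integral>x. \<bar>s n x - f x\<bar> \<partial>M) \<le> e / 2" if "n \<ge> N" for n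
      using bound[OF N that] int f \<open>e > 0\<close>
      by (subst (asm) nn_integral_eq_integral) (auto simp: ennreal_le_iff)
    have "norm ((\<integral>x. \<bar>s n x - f x\<bar> \<partial>M) - 0) < e" if "n \<ge> N" for n
      using le[OF that] \<open>e > 0\<close> by simp
    then show "\<exists>N. \<forall>n\<ge>N. norm ((\<integral>x. \<bar>s n x - f x\<bar> \<partial>M) - 0) < e" by blast
  qed
  with f show ?thesis by blast
qed

text \<open>Boundedness is asked at every point, not merely almost everywhere, so the class survives
  composition with any measurable map, in particular with both endpoints of a jump.\<close>

definition bdd_meas :: "'a measure \<Rightarrow> ('a \<Rightarrow> real) set" where
  "bdd_meas M = {h. h \<in> borel_measurable M \<and> (\<exists>C. \<forall>x. \<bar>h x\<bar> \<le> C)}"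

lemma bdd_meas_measurable: "h \<in> bdd_meas M \<Longrightarrow> h \<in> borel_measurable M"
  by (simp add: bdd_meas_def)

lemma bdd_meas_const: "(\<lambda>_. c) \<in> bdd_meas M"
  by (auto simp: bdd_meas_def)

lemma bdd_meas_add: "f \<in> bdd_meas M \<Longrightarrow> g \<in> bdd_meas M \<Longrightarrow> (\<lambda>x. f x + g x) \<in> bdd_meas M"
proof -
  assume "f \<in> bdd_meas M" "g \<in> bdd_meas M"
  then obtain C D where "f \<in> borel_measurable M" "g \<in> borel_measurable M" "\<And>x. \<bar>f x\<bar> \<le> C" "\<And>x. \<bar>g x\<bar> \<le> D"
    by (auto simp: bdd_meas_def)
  then show ?thesis
    by (auto simp: bdd_meas_def intro!: exI[of _ "C + D"] order_trans[OF abs_triangle_ineq] add_mono)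
qed

lemma bdd_meas_mult: "f \<in> bdd_meas M \<Longrightarrow> g \<in> bdd_meas M \<Longrightarrow> (\<lambda>x. f x * g x) \<in> bdd_meas M"
proof -
  assume "f \<in> bdd_meas M" "g \<in> bdd_meas M"
  then obtain C D where "f \<in> borel_measurable M" "g \<in> borel_measurable M" "\<And>x. \<bar>f x\<bar> \<le> C" "\<And>x. \<bar>g x\<bar> \<le> D"
    by (auto simp: bdd_meas_def)
  then show ?thesis
    by (auto simp: bdd_meas_def abs_mult intro!: exI[of _ "\<bar>C\<bar> * \<bar>D\<bar>"] mult_mono intro: order_trans[OF _ abs_ge_self])
qed

lemma bdd_meas_diff: "f \<in> bdd_meas M \<Longrightarrow> g \<in> bdd_meas M \<Longrightarrow> (\<lambda>x. f x - g x) \<in> bdd_meas M"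
  using bdd_meas_add[of f M "\<lambda>x. - 1 * g x"] bdd_meas_mult[OF bdd_meas_const[of "- 1" M], of g] by simp

lemma bdd_meas_compose: "h \<in> bdd_meas M \<Longrightarrow> p \<in> measurable N M \<Longrightarrow> (\<lambda>x. h (p x)) \<in> bdd_meas N"
  by (auto simp: bdd_meas_def)

lemma (in finite_measure) integrable_bdd_meas:
  assumes "h \<in> bdd_meas M"
  shows "integrable M h"
proof -
  obtain C where "h \<in> borel_measurable M" "\<And>x. \<bar>h x\<bar> \<le> C" using assms by (auto simp: bdd_meas_def)
  then show ?thesis by (intro integrable_const_bound[of _ C]) auto
qed

text \<open>\<open>N\<close> is the law of a jump from \<open>\<phi>\<close> to \<open>\<psi>\<close>, and \<open>Q\<close> is the Markov operator moving by \<open>N\<close>,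
  slowed down enough (factor \<open>2 s\<close>) that \<open>Q\<close> is nonnegative as a quadratic form.\<close>

locale reversible_chain = mu: finite_measure \<mu> + N: finite_measure N
  for \<mu> :: "'a measure" and N :: "'b measure" +
  fixes \<phi> \<psi> :: "'b \<Rightarrow> 'a" and s :: real and Q :: "('a \<Rightarrow> real) \<Rightarrow> 'a \<Rightarrow> real"
  assumes prob: "measure \<mu> (space \<mu>) = 1"
    and \<phi>[measurable]: "\<phi> \<in> measurable N \<mu>" and \<psi>[measurable]: "\<psi> \<in> measurable N \<mu>"
    and s: "s > 0"
    and marginal_\<phi>: "\<And>f. f \<in> borel_measurable \<mu> \<Longrightarrow> (\<integral>\<^sup>+x. f (\<phi> x) \<partial>N) \<le> ennreal s * (\<integral>\<^sup>+x. f x \<partial>\<mu>)"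
    and marginal_\<psi>: "\<And>f. f \<in> borel_measurable \<mu> \<Longrightarrow> (\<integral>\<^sup>+x. f (\<psi> x) \<partial>N) \<le> ennreal s * (\<integral>\<^sup>+x. f x \<partial>\<mu>)"
    and sym: "\<And>f g. f \<in> bdd_meas \<mu> \<Longrightarrow> g \<in> bdd_meas \<mu> \<Longrightarrow>
      (\<integral>x. f (\<phi> x) * g (\<psi> x) \<partial>N) = (\<integral>x. g (\<phi> x) * f (\<psi> x) \<partial>N)"
    and Q_bdd: "\<And>h. h \<in> bdd_meas \<mu> \<Longrightarrow> Q h \<in> bdd_meas \<mu>"
    and Q_weak: "\<And>g h. g \<in> bdd_meas \<mu> \<Longrightarrow> h \<in> bdd_meas \<mu> \<Longrightarrow>
      (\<integral>x. g x * Q h x \<partial>\<mu>) = (\<integral>x. g x * h x \<partial>\<mu>) - (\<integral>x. g (\<phi> x) * (h (\<phi> x) - h (\<psi> x)) \<partial>N) / (2 * s)"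
    and irreducible: "\<And>g :: 'a \<Rightarrow> real. g \<in> borel_measurable \<mu> \<Longrightarrow> AE x in N. g (\<phi> x) = g (\<psi> x) \<Longrightarrow> \<exists>c. AE x in \<mu>. g x = c"
begin

lemma integrable_jump:
  assumes "f \<in> bdd_meas \<mu>" "g \<in> bdd_meas \<mu>"
  shows "integrable N (\<lambda>x. f (\<phi> x) * g (\<psi> x))" "integrable N (\<lambda>x. f (\<phi> x) * g (\<phi> x))"
    "integrable N (\<lambda>x. f (\<psi> x) * g (\<psi> x))"
  using assms by (auto intro!: N.integrable_bdd_meas bdd_meas_mult bdd_meas_compose[OF _ \<phi>] bdd_meas_compose[OF _ \<psi>])

text \<open>Reversibility with the constant 1 as second function shows that f^2 has the same
  integral at both endpoints of a jump; expanding the square does the rest.\<close>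

lemma dirichlet_form:
  assumes f: "f \<in> bdd_meas \<mu>"
  shows "(\<integral>x. f (\<phi> x) * (f (\<phi> x) - f (\<psi> x)) \<partial>N) = (\<integral>x. (f (\<phi> x) - f (\<psi> x))\<^sup>2 \<partial>N) / 2"
proof -
  have "(\<integral>x. (f (\<phi> x) * f (\<phi> x)) * 1 \<partial>N) = (\<integral>x. 1 * (f (\<psi> x) * f (\<psi> x)) \<partial>N)"
    using sym[OF bdd_meas_mult[OF f f] bdd_meas_const[of 1]] by simp
  moreover have "(\<integral>x. (f (\<phi> x) - f (\<psi> x))\<^sup>2 \<partial>N)
      = (\<integral>x. f (\<phi> x) * f (\<phi> x) \<partial>N) + (\<integral>x. f (\<psi> x) * f (\<psi> x) \<partial>N) - 2 * (\<integral>x. f (\<phi> x) * f (\<psi> x) \<partial>N)"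
  proof -
    have "(\<integral>x. (f (\<phi> x) - f (\<psi> x))\<^sup>2 \<partial>N)
        = (\<integral>x. f (\<phi> x) * f (\<phi> x) + f (\<psi> x) * f (\<psi> x) - 2 * (f (\<phi> x) * f (\<psi> x)) \<partial>N)"
      by (simp add: power2_eq_square algebra_simps)
    then show ?thesis using integrable_jump[OF f f] by simp
  qed
  moreover have "(\<integral>x. f (\<phi> x) * (f (\<phi> x) - f (\<psi> x)) \<partial>N)
      = (\<integral>x. f (\<phi> x) * f (\<phi> x) \<partial>N) - (\<integral>x. f (\<phi> x) * f (\<psi> x) \<partial>N)"
    using integrable_jump[OF f f] by (simp add: right_diff_distrib)
  ultimately show ?thesis by simp
qed

lemma Q_symmetric:
  assumes f: "f \<in> bdd_meas \<mu>" and g: "g \<in> bdd_meas \<mu>"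
  shows "(\<integral>x. f x * Q g x \<partial>\<mu>) = (\<integral>x. Q f x * g x \<partial>\<mu>)"
proof -
  have "(\<integral>x. f (\<phi> x) * (g (\<phi> x) - g (\<psi> x)) \<partial>N) = (\<integral>x. g (\<phi> x) * (f (\<phi> x) - f (\<psi> x)) \<partial>N)"
    using integrable_jump[OF f g] integrable_jump[OF g f] sym[OF f g]
    by (simp add: right_diff_distrib mult.commute)
  then show ?thesis
    using Q_weak[OF f g] Q_weak[OF g f] by (simp add: mult.commute)
qed

lemma integral_marginal_square:
  assumes f: "f \<in> bdd_meas \<mu>"
  shows "(\<integral>x. (f (\<phi> x))\<^sup>2 \<partial>N) \<le> s * (\<integral>x. (f x)\<^sup>2 \<partial>\<mu>)"
proof -
  have i: "integrable N (\<lambda>x. (f (\<phi> x))\<^sup>2)" "integrable \<mu> (\<lambda>x. (f x)\<^sup>2)"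
    using integrable_jump[OF f f] mu.integrable_bdd_meas[OF bdd_meas_mult[OF f f]]
    by (auto simp: power2_eq_square)
  have "(\<lambda>x. ennreal ((f x)\<^sup>2)) \<in> borel_measurable \<mu>" using bdd_meas_measurable[OF f] by simp
  from marginal_\<phi>[OF this] show ?thesis
    using i s by (subst (asm) (1 2) nn_integral_eq_integral) (auto simp: ennreal_mult'[symmetric] ennreal_le_iff)
qed

text \<open>With T = 1 - Q the first claim reads T^2 <= T as quadratic forms, which places the
  spectrum of Q in [0, 1]. Test the weak form of T f with T f itself and split the product: the
  marginal bound absorbs half of 2 s norm (T f)^2, and what remains is a quarter of the jump
  integral E, which equals s <f, T f>. The factor 2 in 2 s is what makes this absorption
  possible.\<close>

lemma dirichlet_dominates:
  assumes f: "f \<in> bdd_meas \<mu>"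
  shows "(\<integral>x. (f x - Q f x)\<^sup>2 \<partial>\<mu>) \<le> (\<integral>x. f x * (f x - Q f x) \<partial>\<mu>)"
    and "(\<integral>x. f x * (f x - Q f x) \<partial>\<mu>) = (\<integral>x. (f (\<phi> x) - f (\<psi> x))\<^sup>2 \<partial>N) / (4 * s)"
proof -
  define D where "D x = f x - Q f x" for x
  have D: "D \<in> bdd_meas \<mu>" unfolding D_def by (intro bdd_meas_diff Q_bdd f)
  define E where "E = (\<integral>x. (f (\<phi> x) - f (\<psi> x))\<^sup>2 \<partial>N)"
  have weak: "(\<integral>x. g x * D x \<partial>\<mu>) = (\<integral>x. g (\<phi> x) * (f (\<phi> x) - f (\<psi> x)) \<partial>N) / (2 * s)"
    if g: "g \<in> bdd_meas \<mu>" for g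
    using Q_weak[OF g f] mu.integrable_bdd_meas[OF bdd_meas_mult[OF g f]]
      mu.integrable_bdd_meas[OF bdd_meas_mult[OF g Q_bdd[OF f]]]
    by (simp add: D_def right_diff_distrib)
  have fD: "(\<integral>x. f x * D x \<partial>\<mu>) = E / (4 * s)"
    using weak[OF f] dirichlet_form[OF f] by (simp add: E_def)
  have diff: "(\<lambda>x. f (\<phi> x) - f (\<psi> x)) \<in> bdd_meas N"
    by (intro bdd_meas_diff bdd_meas_compose[OF f] \<phi> \<psi>)
  have D\<phi>: "(\<lambda>x. D (\<phi> x)) \<in> bdd_meas N" by (intro bdd_meas_compose[OF D] \<phi>)
  have i: "integrable N (\<lambda>x. D (\<phi> x) * (f (\<phi> x) - f (\<psi> x)))" "integrable N (\<lambda>x. (D (\<phi> x))\<^sup>2)"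
    "integrable N (\<lambda>x. (f (\<phi> x) - f (\<psi> x))\<^sup>2)"
    using bdd_meas_mult[OF D\<phi> diff] bdd_meas_mult[OF D\<phi> D\<phi>] bdd_meas_mult[OF diff diff]
    by (auto simp: power2_eq_square intro: N.integrable_bdd_meas)
  have "(\<integral>x. D (\<phi> x) * (f (\<phi> x) - f (\<psi> x)) \<partial>N)
      \<le> (\<integral>x. (D (\<phi> x))\<^sup>2 + (f (\<phi> x) - f (\<psi> x))\<^sup>2 / 4 \<partial>N)"
  proof (rule integral_mono)
    fix x
    have "0 \<le> (D (\<phi> x) - (f (\<phi> x) - f (\<psi> x)) / 2)\<^sup>2" by simp
    then show "D (\<phi> x) * (f (\<phi> x) - f (\<psi> x)) \<le> (D (\<phi> x))\<^sup>2 + (f (\<phi> x) - f (\<psi> x))\<^sup>2 / 4"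
      by (simp add: power2_diff power_divide)
  qed (use i in auto)
  also have "\<dots> = (\<integral>x. (D (\<phi> x))\<^sup>2 \<partial>N) + E / 4"
    using i by (simp add: E_def)
  also have "\<dots> \<le> s * (\<integral>x. (D x)\<^sup>2 \<partial>\<mu>) + E / 4"
    using integral_marginal_square[OF D] by simp
  finally have "(\<integral>x. (D x)\<^sup>2 \<partial>\<mu>) * (2 * s) \<le> s * (\<integral>x. (D x)\<^sup>2 \<partial>\<mu>) + E / 4"
    using weak[OF D] s by (simp add: power2_eq_square)
  then have "(\<integral>x. (D x)\<^sup>2 \<partial>\<mu>) \<le> E / (4 * s)"
    using s by (simp add: field_simps)
  then show "(\<integral>x. (f x - Q f x)\<^sup>2 \<partial>\<mu>) \<le> (\<integral>x. f x * (f x - Q f x) \<partial>\<mu>)"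
    using fD by (simp add: D_def)
  show "(\<integral>x. f x * (f x - Q f x) \<partial>\<mu>) = (\<integral>x. (f (\<phi> x) - f (\<psi> x))\<^sup>2 \<partial>N) / (4 * s)"
    using fD by (simp add: D_def E_def)
qed

lemma Q_pow_bdd: "h \<in> bdd_meas \<mu> \<Longrightarrow> (Q ^^ n) h \<in> bdd_meas \<mu>"
  by (induction n) (auto intro: Q_bdd)

lemma inner_Q_pow:
  assumes h: "h \<in> bdd_meas \<mu>"
  shows "(\<integral>x. (Q ^^ n) h x * (Q ^^ m) h x \<partial>\<mu>) = (\<integral>x. h x * (Q ^^ (n + m)) h x \<partial>\<mu>)"
proof (induction n arbitrary: m)
  case (Suc n)
  have "(\<integral>x. (Q ^^ Suc n) h x * (Q ^^ m) h x \<partial>\<mu>) = (\<integral>x. (Q ^^ n) h x * (Q ^^ Suc m) h x \<partial>\<mu>)"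
    using Q_symmetric[OF Q_pow_bdd[OF h] Q_pow_bdd[OF h], of n m] by simp
  then show ?case using Suc[of "Suc m"] by simp
qed simp

lemma integral_Q:
  assumes h: "h \<in> bdd_meas \<mu>"
  shows "(\<integral>x. Q h x \<partial>\<mu>) = (\<integral>x. h x \<partial>\<mu>)"
proof -
  have "(\<integral>x. h (\<phi> x) - h (\<psi> x) \<partial>N) = 0"
    using sym[OF h bdd_meas_const[of 1]] integrable_jump[OF h bdd_meas_const[of 1]]
      integrable_jump[OF bdd_meas_const[of 1] h] by simp
  then show ?thesis using Q_weak[OF bdd_meas_const[of 1] h] by simp
qed

lemma integral_Q_pow: "h \<in> bdd_meas \<mu> \<Longrightarrow> (\<integral>x. (Q ^^ n) h x \<partial>\<mu>) = (\<integral>x. h x \<partial>\<mu>)"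
  by (induction n) (auto simp: integral_Q Q_pow_bdd)

text \<open>The moments \<open>p n = \<langle>h, Q^n h\<rangle>\<close> decrease to a limit, and
  \<open>\<parallel>Q^n h - Q^m h\<parallel>^2 = p (2 n) + p (2 m) - 2 p (n + m)\<close>.\<close>

lemma moments_convergent:
  assumes h: "h \<in> bdd_meas \<mu>"
  shows "convergent (\<lambda>n. \<integral>x. h x * (Q ^^ n) h x \<partial>\<mu>)"
proof -
  define p where "p n = (\<integral>x. h x * (Q ^^ n) h x \<partial>\<mu>)" for n
  have step: "p (2 * n + 1) \<le> p (2 * n)" "p (2 * n + 2) \<le> p (2 * n + 1)" "0 \<le> p (2 * n)" for n
  proof -
    \<comment> \<open>With T = 1 - Q the two decrements are p(2 n) - p(2 n + 1) = <f, T f> and p(2 n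
      + 1) - p(2 n + 2) = <f, T f> - norm (T f)^2; \<open>dirichlet_dominates\<close> makes both
      nonnegative.\<close>
    define f where "f = (Q ^^ n) h"
    have f: "f \<in> bdd_meas \<mu>" unfolding f_def by (rule Q_pow_bdd[OF h])
    note Qf = Q_bdd[OF f]
    have p0: "p (2 * n) = (\<integral>x. f x * f x \<partial>\<mu>)"
      using inner_Q_pow[OF h, of n n] by (simp add: p_def f_def mult_2)
    have p1: "p (2 * n + 1) = (\<integral>x. f x * Q f x \<partial>\<mu>)"
      using inner_Q_pow[OF h, of n "Suc n"] by (simp add: p_def f_def mult_2)
    have p2: "p (2 * n + 2) = (\<integral>x. Q f x * Q f x \<partial>\<mu>)"
      using inner_Q_pow[OF h, of "Suc n" "Suc n"] by (simp add: p_def f_def mult_2)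
    have i: "integrable \<mu> (\<lambda>x. f x * f x)" "integrable \<mu> (\<lambda>x. f x * Q f x)" "integrable \<mu> (\<lambda>x. Q f x * Q f x)"
      by (intro mu.integrable_bdd_meas bdd_meas_mult f Qf)+
    have d1: "(\<integral>x. f x * (f x - Q f x) \<partial>\<mu>) = p (2 * n) - p (2 * n + 1)"
      unfolding p0 p1 using i by (simp add: right_diff_distrib)
    have "(\<integral>x. (f x - Q f x)\<^sup>2 \<partial>\<mu>) = (\<integral>x. f x * f x - 2 * (f x * Q f x) + Q f x * Q f x \<partial>\<mu>)"
      by (simp add: power2_eq_square algebra_simps)
    then have d2: "(\<integral>x. (f x - Q f x)\<^sup>2 \<partial>\<mu>) = p (2 * n) - 2 * p (2 * n + 1) + p (2 * n + 2)"
      unfolding p0 p1 p2 using i by simp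
    have "0 \<le> (\<integral>x. (f x - Q f x)\<^sup>2 \<partial>\<mu>)" by simp
    then show "p (2 * n + 1) \<le> p (2 * n)" using dirichlet_dominates(1)[OF f] d1 by linarith
    show "p (2 * n + 2) \<le> p (2 * n + 1)" using dirichlet_dominates(1)[OF f] d1 d2 by linarith
    show "0 \<le> p (2 * n)" unfolding p0 by simp
  qed
  have dec: "p (Suc n) \<le> p n" for n
  proof (cases "even n")
    case True
    then obtain k where "n = 2 * k" by blast
    then show ?thesis using step(1)[of k] by simp
  next
    case False
    then obtain k where "n = 2 * k + 1" using oddE by blast
    then show ?thesis using step(2)[of k] by simp
  qed
  \<comment> \<open>Even moments are squared norms, and every p n dominates p (2 n).\<close>
  have nonneg: "0 \<le> p n" for n
    using step(3)[of n] decseqD[of p n "2 * n"] dec by (simp add: decseq_Suc_iff)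
  have "convergent p"
    by (rule decseq_convergent[of p 0]) (auto simp: decseq_Suc_iff dec nonneg intro: convergentI)
  then show ?thesis unfolding p_def .
qed

text \<open>Cauchy-Schwarz in additive form, from 2 d |f| <= d^2 + f^2; the free parameter d stands
  in for a square root.\<close>

lemma integral_abs_le:
  assumes M: "finite_measure M" and f: "f \<in> bdd_meas M" and d: "d > 0"
  shows "(\<integral>x. \<bar>f x\<bar> \<partial>M) \<le> (d * measure M (space M) + (\<integral>x. (f x)\<^sup>2 \<partial>M) / d) / 2"
proof -
  interpret finite_measure M by fact
  have i: "integrable M f" "integrable M (\<lambda>x. (f x)\<^sup>2)"
    using integrable_bdd_meas[OF f] integrable_bdd_meas[OF bdd_meas_mult[OF f f]]
    by (auto simp: power2_eq_square)
  have "(\<integral>x. \<bar>f x\<bar> \<partial>M) \<le> (\<integral>x. (d + (f x)\<^sup>2 / d) / 2 \<partial>M)"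
  proof (rule integral_mono)
    fix x
    have "0 \<le> (d - \<bar>f x\<bar>)\<^sup>2" by simp
    then show "\<bar>f x\<bar> \<le> (d + (f x)\<^sup>2 / d) / 2"
      using d by (simp add: power2_diff field_simps power2_eq_square)
  qed (use i in auto)
  also have "\<dots> = (d * measure M (space M) + (\<integral>x. (f x)\<^sup>2 \<partial>M) / d) / 2"
    using i by (simp add: mult.commute)
  finally show ?thesis .
qed

theorem Q_pow_tendsto_mean:
  assumes h: "h \<in> bdd_meas \<mu>"
  shows "(\<lambda>n. \<integral>x. \<bar>(Q ^^ n) h x - (\<integral>x. h x \<partial>\<mu>)\<bar> \<partial>\<mu>) \<longlonglongrightarrow> 0"
proof -
  define p where "p n = (\<integral>x. h x * (Q ^^ n) h x \<partial>\<mu>)" for n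
  define q where "q n = (Q ^^ n) h" for n
  have q: "q n \<in> bdd_meas \<mu>" for n unfolding q_def by (rule Q_pow_bdd[OF h])
  have [measurable]: "q n \<in> borel_measurable \<mu>" for n using q by (rule bdd_meas_measurable)
  have qi: "integrable \<mu> (q n)" for n by (rule mu.integrable_bdd_meas[OF q])
  have qq: "integrable \<mu> (\<lambda>x. q n x * q m x)" for n m
    by (rule mu.integrable_bdd_meas[OF bdd_meas_mult[OF q q]])
  have inner: "(\<integral>x. q n x * q m x \<partial>\<mu>) = p (n + m)" for n m
    unfolding q_def p_def by (rule inner_Q_pow[OF h])
  obtain L where L: "p \<longlonglongrightarrow> L"
    using moments_convergent[OF h] unfolding convergent_def p_def by blast
  have dist2: "(\<integral>x. (q n x - q m x)\<^sup>2 \<partial>\<mu>) = p (n + n) + p (m + m) - 2 * p (n + m)" for n m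
  proof -
    have "(\<integral>x. (q n x - q m x)\<^sup>2 \<partial>\<mu>) = (\<integral>x. q n x * q n x + q m x * q m x - 2 * (q n x * q m x) \<partial>\<mu>)"
      by (simp add: power2_eq_square algebra_simps)
    then show ?thesis using qq by (simp add: inner)
  qed
  have cauchy: "\<exists>K. \<forall>i\<ge>K. \<forall>j\<ge>K. (\<integral>x. \<bar>q i x - q j x\<bar> \<partial>\<mu>) < e" if e: "e > 0" for e
  proof -
    \<comment> \<open>In p(2 i) + p(2 j) - 2 p(i + j) the limits cancel and four errors remain, so
      each has to stay below e^2 / 4. \<open>integral_abs_le\<close> with d = e then gives a bound
      below e.\<close>
    obtain K where K: "\<And>n. n \<ge> K \<Longrightarrow> \<bar>p n - L\<bar> < e\<^sup>2 / 4"
      using LIMSEQ_D[OF L, of "e\<^sup>2 / 4"] e by auto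
    have "(\<integral>x. \<bar>q i x - q j x\<bar> \<partial>\<mu>) < e" if "i \<ge> K" "j \<ge> K" for i j
    proof -
      have "(\<integral>x. (q i x - q j x)\<^sup>2 \<partial>\<mu>) < e\<^sup>2"
      proof -
        have "\<bar>p (i + i) - L\<bar> < e\<^sup>2 / 4" "\<bar>p (j + j) - L\<bar> < e\<^sup>2 / 4" "\<bar>p (i + j) - L\<bar> < e\<^sup>2 / 4"
          using that by (intro K; linarith)+
        then show ?thesis unfolding dist2 by linarith
      qed
      then have "(\<integral>x. (q i x - q j x)\<^sup>2 \<partial>\<mu>) / e < e"
        using e by (simp add: field_simps power2_eq_square)
      then show ?thesis
        using integral_abs_le[OF mu.finite_measure_axioms bdd_meas_diff[OF q q] e, of i j] by (simp add: prob)
    qed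
    then show ?thesis by blast
  qed
  obtain g where g: "integrable \<mu> g" "(\<lambda>n. \<integral>x. \<bar>q n x - g x\<bar> \<partial>\<mu>) \<longlonglongrightarrow> 0"
    using L1_complete[OF qi cauchy] by blast
  have [measurable]: "g \<in> borel_measurable \<mu>" using g by auto
  have "AE x in N. g (\<phi> x) = g (\<psi> x)"
  proof -
    define m where "m = measure N (space N)"
    define a where "a n = (\<integral>x. \<bar>q n x - g x\<bar> \<partial>\<mu>)" for n
    define E where "E n = (\<integral>x. (q n (\<phi> x) - q n (\<psi> x))\<^sup>2 \<partial>N)" for n
    \<comment> \<open>The jump integral of Q^n h is a multiple of one decrement of the convergent
      moments, hence tends to 0.\<close>
    have E: "E n = 4 * s * (p (n + n) - p (n + Suc n))" for n
    proof -
      have "(\<integral>x. q n x * (q n x - Q (q n) x) \<partial>\<mu>) = p (n + n) - p (n + Suc n)"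
        using qq[of n n] qq[of n "Suc n"] inner[of n n] inner[of n "Suc n"]
        by (simp add: right_diff_distrib q_def)
      then have "p (n + n) - p (n + Suc n) = E n / (4 * s)"
        using dirichlet_dominates(2)[OF q, of n] unfolding E_def by simp
      then show ?thesis using s by simp
    qed
    have E0: "E \<longlonglongrightarrow> 0"
    proof -
      have "filterlim (\<lambda>n::nat. n + n) at_top sequentially" "filterlim (\<lambda>n::nat. n + Suc n) at_top sequentially"
        by (auto intro!: filterlim_at_top_mono[OF filterlim_ident] always_eventually)
      from this[THEN filterlim_compose[OF L]]
      have "(\<lambda>n. 4 * s * (p (n + n) - p (n + Suc n))) \<longlonglongrightarrow> 4 * s * (L - L)"
        by (intro tendsto_intros)
      then show ?thesis by (simp add: E[abs_def])
    qed
    have bound: "(\<integral>\<^sup>+x. ennreal \<bar>g (\<phi> x) - g (\<psi> x)\<bar> \<partial>N)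
        \<le> ennreal (2 * (s * a n) + (d * m + E n / d) / 2)" if d: "d > 0" for n d
    proof -
      have qd: "(\<lambda>x. q n (\<phi> x) - q n (\<psi> x)) \<in> bdd_meas N"
        by (intro bdd_meas_diff bdd_meas_compose[OF q] \<phi> \<psi>)
      have an: "0 \<le> a n" unfolding a_def by simp
      have m0: "0 \<le> (d * m + E n / d) / 2" using d by (simp add: m_def E_def)
      have ea: "(\<integral>\<^sup>+x. ennreal \<bar>q n x - g x\<bar> \<partial>\<mu>) = ennreal (a n)"
        unfolding a_def using qi g(1) by (intro nn_integral_eq_integral) auto
      have "(\<integral>\<^sup>+x. ennreal \<bar>g (\<phi> x) - g (\<psi> x)\<bar> \<partial>N)
          \<le> (\<integral>\<^sup>+x. ennreal \<bar>q n (\<phi> x) - g (\<phi> x)\<bar> + ennreal \<bar>q n (\<psi> x) - g (\<psi> x)\<bar>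
            + ennreal \<bar>q n (\<phi> x) - q n (\<psi> x)\<bar> \<partial>N)"
        by (intro nn_integral_mono) (auto simp flip: ennreal_plus intro!: ennreal_leI)
      also have "\<dots> = (\<integral>\<^sup>+x. ennreal \<bar>q n (\<phi> x) - g (\<phi> x)\<bar> \<partial>N) + (\<integral>\<^sup>+x. ennreal \<bar>q n (\<psi> x) - g (\<psi> x)\<bar> \<partial>N)
          + (\<integral>\<^sup>+x. ennreal \<bar>q n (\<phi> x) - q n (\<psi> x)\<bar> \<partial>N)"
        by (simp add: nn_integral_add)
      also have "\<dots> \<le> ennreal s * ennreal (a n) + ennreal s * ennreal (a n) + ennreal ((d * m + E n / d) / 2)"
      proof (intro add_mono)
        show "(\<integral>\<^sup>+x. ennreal \<bar>q n (\<phi> x) - g (\<phi> x)\<bar> \<partial>N) \<le> ennreal s * ennreal (a n)"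
          using marginal_\<phi>[of "\<lambda>x. ennreal \<bar>q n x - g x\<bar>"] by (simp add: ea)
        show "(\<integral>\<^sup>+x. ennreal \<bar>q n (\<psi> x) - g (\<psi> x)\<bar> \<partial>N) \<le> ennreal s * ennreal (a n)"
          using marginal_\<psi>[of "\<lambda>x. ennreal \<bar>q n x - g x\<bar>"] by (simp add: ea)
        show "(\<integral>\<^sup>+x. ennreal \<bar>q n (\<phi> x) - q n (\<psi> x)\<bar> \<partial>N) \<le> ennreal ((d * m + E n / d) / 2)"
          using integral_abs_le[OF N.finite_measure_axioms qd d] N.integrable_bdd_meas[OF qd]
          by (subst nn_integral_eq_integral) (auto simp: m_def E_def intro!: ennreal_leI)
      qed
      also have "\<dots> = ennreal (2 * (s * a n) + (d * m + E n / d) / 2)"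
        using s an m0 by (simp add: ennreal_mult'[symmetric] ennreal_plus[symmetric] del: ennreal_plus)
      finally show ?thesis .
    qed
    \<comment> \<open>The order of limits matters: n tends to infinity with d fixed, because E n is
      divided by d, and only then d tends to 0.\<close>
    have "(\<integral>\<^sup>+x. ennreal \<bar>g (\<phi> x) - g (\<psi> x)\<bar> \<partial>N) \<le> ennreal (d * m / 2)" if d: "d > 0" for d
    proof (rule LIMSEQ_le_const)
      have "(\<lambda>n. 2 * (s * a n) + (d * m + E n / d) / 2) \<longlonglongrightarrow> 2 * (s * 0) + (d * m + 0 / d) / 2"
        using g(2) E0 d by (intro tendsto_intros) (auto simp: a_def)
      then show "(\<lambda>n. ennreal (2 * (s * a n) + (d * m + E n / d) / 2)) \<longlonglongrightarrow> ennreal (d * m / 2)"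
        by (intro tendsto_ennrealI) simp
    qed (use bound[OF d] in auto)
    moreover have "((\<lambda>d. ennreal (d * m / 2)) \<longlongrightarrow> ennreal (0 * m / 2)) (at_right 0)"
      by (intro tendsto_intros) auto
    ultimately have "(\<integral>\<^sup>+x. ennreal \<bar>g (\<phi> x) - g (\<psi> x)\<bar> \<partial>N) \<le> ennreal (0 * m / 2)"
      by (intro tendsto_le[OF trivial_limit_at_right_real _ tendsto_const])
        (auto simp: eventually_at_right_field intro: gt_ex)
    then have "(\<integral>\<^sup>+x. ennreal \<bar>g (\<phi> x) - g (\<psi> x)\<bar> \<partial>N) = 0" by simp
    then show ?thesis by (subst (asm) nn_integral_0_iff_AE) auto
  qed
  then obtain c where c: "AE x in \<mu>. g x = c" using irreducible[of g] by auto
  have lim: "(\<lambda>n. \<integral>x. \<bar>q n x - c\<bar> \<partial>\<mu>) \<longlonglongrightarrow> 0"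
  proof -
    have "(\<integral>x. \<bar>q n x - g x\<bar> \<partial>\<mu>) = (\<integral>x. \<bar>q n x - c\<bar> \<partial>\<mu>)" for n
      using c by (intro integral_cong_AE) auto
    then show ?thesis using g(2) by simp
  qed
  \<comment> \<open>Q preserves the mean, so the constant c can only be the mean of h.\<close>
  have "\<bar>(\<integral>x. h x \<partial>\<mu>) - c\<bar> \<le> (\<integral>x. \<bar>q n x - c\<bar> \<partial>\<mu>)" for n
  proof -
    have "(\<integral>x. h x \<partial>\<mu>) - c = (\<integral>x. q n x - c \<partial>\<mu>)"
      using qi[of n] integral_Q_pow[OF h, of n] by (simp add: prob q_def)
    then show ?thesis using integral_abs_bound[of \<mu> "\<lambda>x. q n x - c"] by simp
  qed
  then have "\<bar>(\<integral>x. h x \<partial>\<mu>) - c\<bar> \<le> 0" using LIMSEQ_le_const[OF lim] by blast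
  then show ?thesis using lim by (simp add: q_def)
qed

end

section \<open>The space of integrable functions and the Maxwellian\<close>

lemma integrable_rep_l1 [simp]: "integrable lborel (rep_l1 F)"
  using Quotient_rep_reflp[OF Quotient_l1, of F] by (simp add: l1_rel_def)

lemma abs_rep_l1 [simp]: "abs_l1 (rep_l1 F) = F"
  by (rule Quotient_abs_rep[OF Quotient_l1])

lemma abs_l1_eqI:
  assumes "integrable lborel f" "integrable lborel g" "AE x in lborel. f x = g x"
  shows "abs_l1 f = abs_l1 g"
  using assms Quotient_rel_abs[OF Quotient_l1, of f g] by (simp add: l1_rel_def)

lemma rep_abs_l1: "integrable lborel f \<Longrightarrow> AE x in lborel. rep_l1 (abs_l1 f) x = f x"
  using Quotient_rep_abs[OF Quotient_l1, of f] by (simp add: l1_rel_def)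

lemma abs_l1_ops:
  assumes "integrable lborel f" "integrable lborel g"
  shows "abs_l1 f + abs_l1 g = abs_l1 (\<lambda>x. f x + g x)" "abs_l1 f - abs_l1 g = abs_l1 (\<lambda>x. f x - g x)"
  using assms by (simp_all add: plus_l1.abs_eq minus_l1.abs_eq l1_rel_def)

lemma
  assumes "integrable lborel f"
  shows scaleR_abs_l1: "c *\<^sub>R abs_l1 f = abs_l1 (\<lambda>x. c * f x)"
    and norm_abs_l1: "norm (abs_l1 f) = (\<integral>x. \<bar>f x\<bar> \<partial>lborel)"
    and l1_integral_abs_l1: "l1_integral (abs_l1 f) = (\<integral>x. f x \<partial>lborel)"
  using assms by (simp_all add: scaleR_l1.abs_eq norm_l1.abs_eq l1_integral.abs_eq l1_rel_def)

instance l1 :: (euclidean_space) banach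
proof
  fix X :: "nat \<Rightarrow> 'a l1"
  assume X: "Cauchy X"
  have norm: "norm (X i - abs_l1 f) = (\<integral>x. \<bar>rep_l1 (X i) x - f x\<bar> \<partial>lborel)" if "integrable lborel f" for i f
  proof -
    have "X i - abs_l1 f = abs_l1 (\<lambda>x. rep_l1 (X i) x - f x)"
      using abs_l1_ops(2)[OF integrable_rep_l1[of "X i"] that] by simp
    then show ?thesis
      using norm_abs_l1[OF Bochner_Integration.integrable_diff[OF integrable_rep_l1[of "X i"] that]] by simp
  qed
  have "\<exists>N. \<forall>i\<ge>N. \<forall>j\<ge>N. (\<integral>x. \<bar>rep_l1 (X i) x - rep_l1 (X j) x\<bar> \<partial>lborel) < e" if "e > 0" for e
    using CauchyD[OF X that] by (simp flip: norm)
  from L1_complete[OF integrable_rep_l1 this] obtain f where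
    f: "integrable lborel f" "(\<lambda>n. \<integral>x. \<bar>rep_l1 (X n) x - f x\<bar> \<partial>lborel) \<longlonglongrightarrow> 0"
    by auto
  then have "(\<lambda>n. norm (X n - abs_l1 f)) \<longlonglongrightarrow> 0" by (simp add: norm)
  then have "X \<longlonglongrightarrow> abs_l1 f" by (simp add: tendsto_norm_zero_iff LIM_zero_iff)
  then show "convergent X" by (rule convergentI)
qed

text \<open>Operators form a unital normed algebra only over a nontrivial space. The class of the
  indicator of the unit ball is a nonzero vector along which any point can be moved by a small
  amount.\<close>

instance l1 :: (euclidean_space) perfect_space
proof
  fix x :: "'a l1"
  have i: "integrable lborel (indicator (ball (0::'a) 1) :: 'a \<Rightarrow> real)"
    using emeasure_lborel_unit_ball(2)[where 'a='a] by (simp add: integrable_indicator_iff)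
  define e where "e = abs_l1 (indicator (ball (0::'a) 1) :: 'a \<Rightarrow> real)"
  have "norm e = measure lborel (ball (0::'a) 1)"
    using norm_abs_l1[OF i] by (simp add: e_def)
  then have e: "norm e \<noteq> 0"
    using emeasure_lborel_unit_ball[where 'a='a] by (auto simp: measure_def enn2real_eq_0_iff)
  show "\<not> open {x}"
  proof
    assume "open {x}"
    then obtain d where d: "d > 0" "ball x d \<subseteq> {x}" by (meson open_contains_ball singletonI)
    define y where "y = x + (d / (2 * norm e)) *\<^sub>R e"
    have "dist x y = d / 2" using d e by (simp add: y_def dist_norm)
    then have "y \<in> ball x d" using d by simp
    then have "y = x" using d by blast
    then show False using \<open>dist x y = d / 2\<close> d by simp
  qed
qed

section \<open>The Maxwellian\<close>

lemma maxwellian_pos: "maxwellian v > 0"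
  by (simp add: maxwellian_def)

lemma maxwellian_le: "maxwellian (v::'a::euclidean_space) \<le> (2 * pi) powr (- real DIM('a) / 2)"
  by (simp add: maxwellian_def mult_left_le)

lemma measurable_maxwellian [measurable]: "maxwellian \<in> borel_measurable borel"
  unfolding maxwellian_def[abs_def] by measurable

text \<open>Reduces the normalization of the Maxwellian to the one-dimensional standard normal
  density.\<close>

lemma maxwellian_prod: "maxwellian (v::'a::euclidean_space) = (\<Prod>i\<in>Basis. std_normal_density (v \<bullet> i))"
proof -
  have "(\<Prod>i\<in>(Basis::'a set). std_normal_density (v \<bullet> i))
      = (1 / sqrt (2 * pi)) ^ DIM('a) * exp (\<Sum>i\<in>Basis. - (v \<bullet> i)\<^sup>2 / 2)"
    unfolding std_normal_density_def prod.distrib by (simp add: exp_sum)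
  also have "(\<Sum>i\<in>Basis. - (v \<bullet> i)\<^sup>2 / 2) = - (norm v)\<^sup>2 / 2"
  proof -
    have "(norm v)\<^sup>2 = (\<Sum>i\<in>Basis. (v \<bullet> i)\<^sup>2)"
      unfolding power2_norm_eq_inner by (subst euclidean_inner) (simp add: power2_eq_square)
    then show ?thesis by (simp add: sum_negf sum_divide_distrib)
  qed
  also have "(1 / sqrt (2 * pi)) ^ DIM('a) = (2 * pi) powr (- real DIM('a) / 2)"
  proof -
    have "(2 * pi) powr (1 / 2) = sqrt (2 * pi)" by (rule powr_half_sqrt) simp
    then have "1 / sqrt (2 * pi) = (2 * pi) powr (- (1 / 2))" by (simp only: powr_minus_divide)
    then have "(1 / sqrt (2 * pi)) ^ DIM('a) = ((2 * pi) powr (- (1 / 2))) powr real DIM('a)"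
      using powr_realpow[of "(2 * pi) powr (- (1 / 2))" "DIM('a)"] by (simp only: powr_gt_zero) simp
    also have "\<dots> = (2 * pi) powr (- real DIM('a) / 2)"
      unfolding powr_powr by (rule arg_cong[where f="(powr) (2 * pi)"]) simp
    finally show ?thesis .
  qed
  finally show ?thesis by (simp add: maxwellian_def)
qed

lemma nn_integral_maxwellian: "(\<integral>\<^sup>+v. ennreal (maxwellian (v::'a::euclidean_space)) \<partial>lborel) = 1"
proof -
  have one: "(\<integral>\<^sup>+x. ennreal (std_normal_density x) \<partial>lborel) = 1"
    by (subst nn_integral_eq_integral) auto
  have "(\<integral>\<^sup>+v. ennreal (maxwellian (v::'a)) \<partial>lborel) = (\<integral>\<^sup>+v. (\<Prod>i\<in>Basis. ennreal (std_normal_density ((v::'a) \<bullet> i))) \<partial>lborel)"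
    by (simp add: maxwellian_prod prod_ennreal)
  also have "\<dots> = (\<Prod>i\<in>(Basis :: 'a set). \<integral>\<^sup>+x. ennreal (std_normal_density x) \<partial>lborel)"
    by (rule nn_integral_lborel_prod) auto
  finally show ?thesis by (simp add: one)
qed

lemma integrable_maxwellian: "integrable lborel (maxwellian :: 'a::euclidean_space \<Rightarrow> real)"
  using nn_integral_maxwellian[where 'a='a]
  by (intro integrableI_nonneg) (auto simp: maxwellian_pos less_imp_le)

lemma integral_maxwellian: "(\<integral>v. maxwellian (v::'a::euclidean_space) \<partial>lborel) = 1"
  using nn_integral_maxwellian[where 'a='a]
  by (simp add: integral_eq_nn_integral maxwellian_pos less_imp_le)

text \<open>Conservation of kinetic energy. The parallelogram identity is used twice: for the centre
  (v + w) / 2 with half the new relative velocity, and then backwards for v and w. The unit length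
  of s keeps the relative speed.\<close>

lemma maxwellian_collision:
  assumes s: "norm (s::'a::euclidean_space) = 1"
  shows "maxwellian (post v w s) * maxwellian (post_star v w s) = maxwellian v * maxwellian w"
proof -
  have ss: "s \<bullet> s = 1" using s by (simp add: dot_square_norm)
  have par: "(norm (x + y))\<^sup>2 + (norm (x - y))\<^sup>2 = 2 * (norm x)\<^sup>2 + 2 * (norm y)\<^sup>2" for x y :: 'a
    by (simp add: power2_norm_eq_inner inner_add inner_diff inner_commute)
  have "(norm (post v w s))\<^sup>2 + (norm (post_star v w s))\<^sup>2
      = 2 * (norm ((v + w) /\<^sub>R 2))\<^sup>2 + 2 * (norm ((norm (v - w) / 2) *\<^sub>R s))\<^sup>2"
    unfolding post_def post_star_def by (rule par)
  also have "norm ((v + w) /\<^sub>R 2) = norm (v + w) / 2" by (simp only: norm_scaleR) simp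
  also have "norm ((norm (v - w) / 2) *\<^sub>R s) = norm (v - w) / 2" using s by simp
  also have "2 * (norm (v + w) / 2)\<^sup>2 + 2 * (norm (v - w) / 2)\<^sup>2 = ((norm (v + w))\<^sup>2 + (norm (v - w))\<^sup>2) / 2"
    by (simp add: power_divide field_simps)
  also have "\<dots> = (norm v)\<^sup>2 + (norm w)\<^sup>2" by (simp add: par)
  finally have "- (norm (post v w s))\<^sup>2 / 2 + - (norm (post_star v w s))\<^sup>2 / 2 = - (norm v)\<^sup>2 / 2 + - (norm w)\<^sup>2 / 2"
    by (simp add: field_simps)
  from arg_cong[OF this, of exp] show ?thesis unfolding exp_add maxwellian_def by algebra
qed

section \<open>Integrability of the singular kinetic factor\<close>

lemma exists_dyadic_shell:
  fixes r :: real
  assumes "0 < r" "r < 1"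
  shows "\<exists>k. (1/2) ^ Suc k \<le> r \<and> r < (1/2) ^ k"
proof -
  have ex: "\<exists>n. (1/2) ^ n \<le> r" using real_arch_pow_inv[OF assms(1), of "1/2"] by (auto intro: less_imp_le)
  define n where "n = (LEAST n. (1/2) ^ n \<le> r)"
  have n: "(1/2) ^ n \<le> r" unfolding n_def by (rule LeastI_ex[OF ex])
  then obtain k where k: "n = Suc k" using assms(2) by (cases n) auto
  have "\<not> (1/2) ^ k \<le> r"
    using not_less_Least[of k "\<lambda>n. (1/2) ^ n \<le> r"] k unfolding n_def by simp
  then show ?thesis using n k by auto
qed

text \<open>Dyadic shells: for norm u in [2^-(k+1), 2^-k) the integrand is at most its value at the
  inner radius, as gamma < 0, while the ball of radius 2^-k has volume proportional to 2^(-k d). The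
  terms are geometric with ratio 2^-(gamma + d), which is below 1 exactly when gamma > - d.\<close>

lemma nn_integral_powr_unit_ball:
  fixes \<gamma> :: real
  assumes "- real DIM('a::euclidean_space) < \<gamma>" "\<gamma> < 0"
  shows "(\<integral>\<^sup>+u. ennreal (norm (u::'a) powr \<gamma>) * indicator (ball 0 1) u \<partial>lborel) < \<infinity>"
proof -
  define c where "c k = ((1/2) ^ Suc k) powr \<gamma>" for k
  have "(\<integral>\<^sup>+u. ennreal (norm (u::'a) powr \<gamma>) * indicator (ball 0 1) u \<partial>lborel)
      \<le> (\<integral>\<^sup>+u. (\<Sum>k. ennreal (c k) * indicator {u::'a. norm u < (1/2)^k} u) \<partial>lborel)"
  proof (rule nn_integral_mono)
    fix u :: 'a
    show "ennreal (norm u powr \<gamma>) * indicator (ball 0 1) u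
        \<le> (\<Sum>k. ennreal (c k) * indicator {u::'a. norm u < (1/2)^k} u)"
    proof (cases "u \<noteq> 0 \<and> norm u < 1")
      case True
      then obtain k where k: "(1/2) ^ Suc k \<le> norm u" "norm u < (1/2) ^ k"
        using exists_dyadic_shell[of "norm u"] by auto
      have "norm u powr \<gamma> \<le> c k"
        unfolding c_def using k(1) assms(2) by (intro powr_mono2') auto
      then have "ennreal (norm u powr \<gamma>) * indicator (ball 0 1) u
          \<le> ennreal (c k) * indicator {u::'a. norm u < (1/2)^k} u"
        using True k by (simp add: ennreal_leI)
      also have "\<dots> \<le> (\<Sum>k. ennreal (c k) * indicator {u::'a. norm u < (1/2)^k} u)"
        using sum_le_suminf[of "\<lambda>k. ennreal (c k) * indicator {u::'a. norm u < (1/2)^k} u" "{k}"]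
        by (auto simp: sum.insert simp del: sum_mult_indicator)
      finally show ?thesis .
    qed auto
  qed
  also have "\<dots> = (\<Sum>k. \<integral>\<^sup>+u. ennreal (c k) * indicator {u::'a. norm u < (1/2)^k} u \<partial>lborel)"
    by (rule nn_integral_suminf) measurable
  also have "\<dots> = (\<Sum>k. ennreal (c k * ((1/2)^k) ^ DIM('a)) * emeasure lborel (ball (0::'a) 1))"
  proof (rule suminf_cong)
    fix k
    have "emeasure lborel {u::'a. norm u < (1/2)^k \<and> sgn u \<in> UNIV}
        = ennreal (((1/2)^k) ^ DIM('a)) * emeasure lborel {u::'a. norm u < 1 \<and> sgn u \<in> UNIV}"
      by (rule emeasure_cone_scale) auto
    moreover have "{u::'a. norm u < 1 \<and> sgn u \<in> UNIV} = ball 0 1" by auto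
    ultimately have "emeasure lborel {u::'a. norm u < (1/2)^k}
        = ennreal (((1/2)^k) ^ DIM('a)) * emeasure lborel (ball (0::'a) 1)" by simp
    then show "(\<integral>\<^sup>+u. ennreal (c k) * indicator {u::'a. norm u < (1/2)^k} u \<partial>lborel)
        = ennreal (c k * ((1/2)^k) ^ DIM('a)) * emeasure lborel (ball (0::'a) 1)"
      by (simp add: nn_integral_cmult_indicator ennreal_mult'' mult.assoc c_def)
  qed
  also have "\<dots> = (\<Sum>k. ennreal (c k * ((1/2)^k) ^ DIM('a))) * emeasure lborel (ball (0::'a) 1)"
    by (rule ennreal_suminf_multc)
  also have "\<dots> < \<infinity>"
  proof -
    define q where "q = (1/2::real) powr (\<gamma> + real DIM('a))"
    have q: "0 < q" "q < 1" using assms(1) powr_less_mono2[of "\<gamma> + real DIM('a)" "1/2" 1] by (auto simp: q_def)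
    have "c k * ((1/2)^k) ^ DIM('a) = (1/2) powr \<gamma> * q ^ k" for k
    proof -
      have "c k = (1/2) powr (\<gamma> * real (Suc k))"
        unfolding c_def by (simp only: powr_realpow[symmetric] powr_powr zero_less_divide_1_iff zero_less_numeral mult.commute)
      moreover have "((1/2::real)^k) ^ DIM('a) = (1/2) powr (real k * real DIM('a))"
        by (simp add: powr_realpow flip: power_mult of_nat_mult)
      moreover have "q ^ k = (1/2) powr ((\<gamma> + real DIM('a)) * real k)"
        using q by (simp add: q_def powr_powr flip: powr_realpow)
      ultimately show ?thesis by (simp add: powr_add[symmetric] algebra_simps)
    qed
    moreover have "summable (\<lambda>k. (1/2) powr \<gamma> * q ^ k)"
      using q by (intro summable_mult summable_geometric) auto
    ultimately have "(\<Sum>k. ennreal (c k * ((1/2)^k) ^ DIM('a))) = ennreal (\<Sum>k. (1/2) powr \<gamma> * q ^ k)"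
      using q by (simp add: suminf_ennreal2)
    then show ?thesis
      using emeasure_lborel_unit_ball(2)[where 'a='a] by (simp add: ennreal_mult_less_top)
  qed
  finally show ?thesis .
qed

text \<open>Split at distance 1 from v. Inside, the Maxwellian is at most its maximum m and the
  singularity is integrable; outside, the power is at most 1 and the Maxwellian has mass 1. Neither
  bound depends on v.\<close>

lemma nn_integral_powr_maxwellian_bounded:
  fixes \<gamma> :: real
  assumes \<gamma>: "- real DIM('a::euclidean_space) < \<gamma>" "\<gamma> < 0"
  shows "\<exists>C. \<forall>v::'a. (\<integral>\<^sup>+w. ennreal (norm (v - w) powr \<gamma> * maxwellian w) \<partial>lborel) \<le> ennreal C"
proof -
  have [measurable]: "ball (0::'a) 1 \<in> sets borel" by simp
  define m where "m = (2 * pi) powr (- real DIM('a) / 2)"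
  define I where "I = (\<integral>\<^sup>+u. ennreal (norm (u::'a) powr \<gamma>) * indicator (ball 0 1) u \<partial>lborel)"
  have I: "I < \<infinity>" unfolding I_def by (rule nn_integral_powr_unit_ball[OF \<gamma>])
  have "(\<integral>\<^sup>+w. ennreal (norm (v - w) powr \<gamma> * maxwellian w) \<partial>lborel) \<le> ennreal m * I + 1" for v :: 'a
  proof -
    have "(\<integral>\<^sup>+w. ennreal (norm (v - w) powr \<gamma> * maxwellian w) \<partial>lborel)
        \<le> (\<integral>\<^sup>+w. ennreal m * (ennreal (norm (v - w) powr \<gamma>) * indicator (ball 0 1) (v - w))
          + ennreal (maxwellian w) \<partial>lborel)"
    proof (rule nn_integral_mono)
      fix w :: 'a
      show "ennreal (norm (v - w) powr \<gamma> * maxwellian w)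
          \<le> ennreal m * (ennreal (norm (v - w) powr \<gamma>) * indicator (ball 0 1) (v - w)) + ennreal (maxwellian w)"
      proof (cases "norm (v - w) < 1")
        case True
        have "norm (v - w) powr \<gamma> * maxwellian w \<le> m * norm (v - w) powr \<gamma>"
          using mult_left_mono[OF maxwellian_le[of w], of "norm (v - w) powr \<gamma>"]
          by (simp add: m_def mult.commute)
        then have "ennreal (norm (v - w) powr \<gamma> * maxwellian w) \<le> ennreal m * ennreal (norm (v - w) powr \<gamma>)"
          by (simp add: ennreal_mult'[symmetric] ennreal_leI m_def)
        then show ?thesis using True by (simp add: add_increasing2)
      next
        case False
        then have "norm (v - w) powr \<gamma> \<le> 1 powr \<gamma>" using \<gamma> by (intro powr_mono2') auto
        then have "norm (v - w) powr \<gamma> * maxwellian w \<le> maxwellian w"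
          using maxwellian_pos[of w] by (simp add: mult_left_le_one_le)
        then show ?thesis using False by (simp add: ennreal_leI)
      qed
    qed
    also have "\<dots> = ennreal m * (\<integral>\<^sup>+w. ennreal (norm (v - w) powr \<gamma>) * indicator (ball 0 1) (v - w) \<partial>lborel)
        + (\<integral>\<^sup>+w. ennreal (maxwellian (w::'a)) \<partial>lborel)"
    proof -
      have [measurable]: "(\<lambda>w::'a. indicator (ball 0 1) (v - w) :: ennreal) \<in> borel_measurable borel"
        by (rule measurable_compose[where N=borel and f="\<lambda>w. v - w"]) measurable
      show ?thesis by (subst nn_integral_add) (auto simp: nn_integral_cmult)
    qed
    also have "(\<integral>\<^sup>+w. ennreal (norm (v - w) powr \<gamma>) * indicator (ball 0 1) (v - w) \<partial>lborel) = I"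
      unfolding I_def by (rule nn_integral_lborel_reflect) measurable
    finally show ?thesis by (simp add: nn_integral_maxwellian)
  qed
  moreover have "ennreal m * I + 1 = ennreal (enn2real (ennreal m * I + 1))"
    using I by (simp add: ennreal_mult_less_top)
  ultimately show ?thesis by metis
qed

section \<open>The linear Boltzmann operator\<close>

interpretation w_sph: pair_sigma_finite lborel "sph :: 'a::euclidean_space measure" ..

interpretation v_w_sph: pair_sigma_finite lborel "lborel \<Otimes>\<^sub>M (sph :: 'a::euclidean_space measure)" ..

lemma AE_pair_sph_norm: "AE p in (lborel :: 'a::euclidean_space measure) \<Otimes>\<^sub>M (sph :: 'a measure). norm (snd p) = 1"
proof (rule w_sph.AE_pair_measure)
  show "{p \<in> space ((lborel :: 'a measure) \<Otimes>\<^sub>M (sph :: 'a measure)). norm (snd p) = 1} \<in> sets (lborel \<Otimes>\<^sub>M sph)"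
    by measurable
  show "AE w in (lborel :: 'a measure). AE s in (sph :: 'a measure). norm (snd (w, s)) = 1"
    by (rule AE_I2) (use AE_sph_norm[where 'a='a] in simp)
qed

lemma AE_triple_sph_norm:
  "AE x in (lborel :: 'a::euclidean_space measure) \<Otimes>\<^sub>M ((lborel :: 'a measure) \<Otimes>\<^sub>M (sph :: 'a measure)). norm (snd (snd x)) = 1"
proof (rule v_w_sph.AE_pair_measure)
  show "{x \<in> space ((lborel :: 'a measure) \<Otimes>\<^sub>M ((lborel :: 'a measure) \<Otimes>\<^sub>M (sph :: 'a measure))). norm (snd (snd x)) = 1}
      \<in> sets (lborel \<Otimes>\<^sub>M (lborel \<Otimes>\<^sub>M sph))"
    by measurable
  show "AE v in (lborel :: 'a measure). AE p in (lborel :: 'a measure) \<Otimes>\<^sub>M (sph :: 'a measure). norm (snd (snd (v, p))) = 1"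
    by (rule AE_I2) (use AE_pair_sph_norm[where 'a='a] in simp)
qed

lemma nn_integral_pair_sph:
  fixes f :: "'a::euclidean_space \<times> 'a \<Rightarrow> ennreal"
  assumes [measurable]: "f \<in> borel_measurable (borel \<Otimes>\<^sub>M borel)"
  shows "(\<integral>\<^sup>+p. f p \<partial>(lborel \<Otimes>\<^sub>M sph)) = (\<integral>\<^sup>+w. (\<integral>\<^sup>+s. f (w, s) \<partial>sph) \<partial>lborel)"
  by (rule sph.nn_integral_fst[symmetric]) simp

lemma nn_integral_triple_sph:
  fixes f :: "'a::euclidean_space \<times> 'a \<times> 'a \<Rightarrow> ennreal"
  assumes [measurable]: "f \<in> borel_measurable (borel \<Otimes>\<^sub>M borel \<Otimes>\<^sub>M borel)"
  shows "(\<integral>\<^sup>+x. f x \<partial>(lborel \<Otimes>\<^sub>M (lborel \<Otimes>\<^sub>M sph))) = (\<integral>\<^sup>+v. (\<integral>\<^sup>+p. f (v, p) \<partial>(lborel \<Otimes>\<^sub>M sph)) \<partial>lborel)"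
proof -
  have "sigma_finite_measure ((lborel :: 'a measure) \<Otimes>\<^sub>M (sph :: 'a measure))" ..
  then show ?thesis by (intro sigma_finite_measure.nn_integral_fst[symmetric]) simp_all
qed

section \<open>The collision map on triples\<close>

definition collide :: "'a::euclidean_space \<times> 'a \<times> 'a \<Rightarrow> 'a \<times> 'a \<times> 'a" where
  "collide x = (post (fst x) (fst (snd x)) (snd (snd x)), post_star (fst x) (fst (snd x)) (snd (snd x)),
    sgn (fst x - fst (snd x)))"

lemma nn_integral_collide:
  fixes f :: "'a::euclidean_space \<times> 'a \<times> 'a \<Rightarrow> ennreal"
  assumes [measurable]: "f \<in> borel_measurable (borel \<Otimes>\<^sub>M borel \<Otimes>\<^sub>M borel)"
  shows "(\<integral>\<^sup>+x. f (collide x) \<partial>(lborel \<Otimes>\<^sub>M (lborel \<Otimes>\<^sub>M sph))) = (\<integral>\<^sup>+x. f x \<partial>(lborel \<Otimes>\<^sub>M (lborel \<Otimes>\<^sub>M sph)))"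
proof -
  have "(\<lambda>(v, w, s). f (v, w, s)) \<in> borel_measurable (borel \<Otimes>\<^sub>M borel \<Otimes>\<^sub>M borel)" by simp
  from nn_integral_collision[of "\<lambda>v w s. f (v, w, s)", OF this] show ?thesis
    by (simp add: nn_integral_triple_sph nn_integral_pair_sph collide_def)
qed

lemma collide_relative:
  "post v w s - post_star v w s = norm (v - w) *\<^sub>R s" "post v w s + post_star v w s = v + w"
proof -
  have half: "(v + w) /\<^sub>R 2 + (v + w) /\<^sub>R 2 = v + w" "c *\<^sub>R s + c *\<^sub>R s = (2 * c) *\<^sub>R s" for c
    by (simp_all flip: scaleR_add_left)
  have "post v w s - post_star v w s = (norm (v - w) / 2) *\<^sub>R s + (norm (v - w) / 2) *\<^sub>R s"
    unfolding post_def post_star_def by simp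
  then show "post v w s - post_star v w s = norm (v - w) *\<^sub>R s" unfolding half by simp
  have "post v w s + post_star v w s = (v + w) /\<^sub>R 2 + (v + w) /\<^sub>R 2"
    unfolding post_def post_star_def by (simp del: scaleR_add_right)
  then show "post v w s + post_star v w s = v + w" unfolding half .
qed

text \<open>The outgoing relative velocity is norm (v - w) times s and has the old length, so a
  second collision towards the old direction restores v. For v = w the relative velocity is 0 and
  any direction will do.\<close>

lemma post_involution:
  assumes "norm s = 1"
  shows "post (post v w s) (post_star v w s) (sgn (v - w)) = (v :: 'a::euclidean_space)"
proof -
  have "post (post v w s) (post_star v w s) (sgn (v - w)) = (v + w) /\<^sub>R 2 + (norm (v - w) / 2) *\<^sub>R sgn (v - w)"
    unfolding post_def[of "post v w s"] collide_relative using assms by simp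
  also have "(norm (v - w) / 2) *\<^sub>R sgn (v - w) = (v - w) /\<^sub>R 2"
    using norm_sgn_scaleR[of "v - w"] by (metis divide_inverse_commute scaleR_scaleR)
  also have "(v + w) /\<^sub>R 2 + (v - w) /\<^sub>R 2 = v"
    by (simp flip: scaleR_add_right)
  finally show ?thesis .
qed

lemma integral_sphere_measure_pair:
  fixes f :: "'a::euclidean_space \<times> 'a \<Rightarrow> real"
  assumes [measurable]: "f \<in> borel_measurable (borel \<Otimes>\<^sub>M borel)"
  shows "(\<integral>p. f p \<partial>(lborel \<Otimes>\<^sub>M sphere_measure)) = (\<integral>p. f p \<partial>(lborel \<Otimes>\<^sub>M sph))"
proof -
  have "(\<lambda>p. (fst p, snd p)) \<in> measurable (lborel \<Otimes>\<^sub>M (sphere_measure :: 'a measure)) (borel \<Otimes>\<^sub>M borel)"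
    by (intro measurable_Pair measurable_compose[OF measurable_snd measurable_id_sphere_measure]) measurable
  then have m: "(\<lambda>(x, y). (x, y)) \<in> measurable (lborel \<Otimes>\<^sub>M (sphere_measure :: 'a measure)) (borel \<Otimes>\<^sub>M borel)"
    by (simp only: split_beta')
  have "distr lborel borel (\<lambda>x::'a. x) \<Otimes>\<^sub>M distr sphere_measure borel (\<lambda>x::'a. x)
      = distr ((lborel :: 'a measure) \<Otimes>\<^sub>M (sphere_measure :: 'a measure)) (borel \<Otimes>\<^sub>M borel) (\<lambda>(x, y). (x, y))"
    using sph.sigma_finite_measure_axioms
    by (intro pair_measure_distr measurable_id_sphere_measure) (auto simp: sph_def)
  moreover have "distr lborel borel (\<lambda>x::'a. x) = lborel"
    by (rule distr_id2) simp
  ultimately have eq: "(lborel :: 'a measure) \<Otimes>\<^sub>M (sph :: 'a measure)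
      = distr ((lborel :: 'a measure) \<Otimes>\<^sub>M (sphere_measure :: 'a measure)) (borel \<Otimes>\<^sub>M borel) (\<lambda>(x, y). (x, y))"
    by (simp add: sph_def)
  show ?thesis unfolding eq by (subst integral_distr[OF m]) (auto simp: split_beta')
qed

lemma space_sphere_measure: "space (sphere_measure :: 'a::euclidean_space measure) = sphere 0 1"
  by (simp add: sphere_measure_def space_scale_measure space_restrict_space)

text \<open>\<open>\<gamma>\<close> and \<open>b\<close> do not mention the velocity space; the type
  parameter \<open>ty\<close> pins it down.\<close>

locale linear_boltzmann =
  fixes \<gamma> :: real and b :: "real \<Rightarrow> real" and ty :: "'a::euclidean_space itself"
  assumes dim: "DIM('a) \<ge> 2" and \<gamma>: "- real DIM('a) < \<gamma>" "\<gamma> < 0"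
    and b_meas: "b \<in> borel_measurable (restrict_space borel {-1..1})"
    and b_nonneg: "\<And>x. x \<in> {-1..1} \<Longrightarrow> 0 \<le> b x"
    and mass_finite: "\<And>v w :: 'a. v \<noteq> w \<Longrightarrow> angular_mass b v w < \<infinity>"
    and mass_pos: "\<And>v w :: 'a. v \<noteq> w \<Longrightarrow> 0 < angular_mass b v w"
begin

text \<open>\<open>b\<close> is Borel only on [-1, 1]. Extended by 0 it is Borel on the line, so
  kernels are measurable also at vectors s off the sphere, where the inner product may leave the
  interval.\<close>

definition \<beta> :: "real \<Rightarrow> real" where
  "\<beta> x = (if x \<in> {-1..1} then b x else 0)"

definition kern :: "'a \<Rightarrow> 'a \<Rightarrow> 'a \<Rightarrow> real" where
  "kern v w s = norm (v - w) powr \<gamma> * \<beta> (sgn (v - w) \<bullet> s)"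

lemma \<beta>_nonneg: "0 \<le> \<beta> x"
  using b_nonneg by (simp add: \<beta>_def)

lemma measurable_\<beta> [measurable]: "\<beta> \<in> borel_measurable borel"
proof -
  have "(\<lambda>x. indicator {-1..1} x *\<^sub>R b x) \<in> borel_measurable borel"
    using b_meas by (subst (asm) borel_measurable_restrict_space_iff) auto
  also have "(\<lambda>x. indicator {-1..1} x *\<^sub>R b x) = \<beta>" by (auto simp: \<beta>_def indicator_def)
  finally show ?thesis .
qed

lemma kern_nonneg [simp]: "0 \<le> kern v w s"
  by (simp add: kern_def \<beta>_nonneg)

lemma measurable_kern [measurable (raw)]:
  assumes [measurable]: "f \<in> borel_measurable M" "g \<in> borel_measurable M" "h \<in> borel_measurable M"
  shows "(\<lambda>x. kern (f x) (g x) (h x)) \<in> borel_measurable M"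
  unfolding kern_def by measurable

lemma cos_angle_sgn: "cos_angle v w s = sgn (v - w) \<bullet> s"
  by (simp add: cos_angle_def sgn_div_norm)

lemma b_cos_angle: "norm s = 1 \<Longrightarrow> b (cos_angle v w s) = \<beta> (sgn (v - w) \<bullet> s)"
proof -
  assume s: "norm s = 1"
  have "\<bar>sgn (v - w) \<bullet> s\<bar> \<le> norm (sgn (v - w)) * norm s" by (rule Cauchy_Schwarz_ineq2)
  also have "\<dots> \<le> 1" using s by (simp add: norm_sgn)
  finally show ?thesis by (simp add: \<beta>_def cos_angle_sgn abs_le_iff)
qed

lemma coll_kernel_kern: "norm s = 1 \<Longrightarrow> coll_kernel \<gamma> b v w s = kern v w s"
  by (simp add: coll_kernel_def kern_def b_cos_angle)

text \<open>Microreversibility: the relative speed is preserved, and the old and the new direction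
  trade places in a symmetric inner product.\<close>

lemma kern_collide:
  assumes s: "norm s = 1"
  shows "kern (post v w s) (post_star v w s) (sgn (v - w)) = kern v w s"
proof (cases "v = w")
  case False
  then show ?thesis
    using s by (simp add: kern_def collide_relative sgn_scaleR inner_commute sgn_div_norm[of s])
qed (use s in \<open>simp add: kern_def collide_relative\<close>)

lemma gain_eq:
  assumes [measurable]: "f \<in> borel_measurable borel"
  shows "gain \<gamma> b f v = (\<integral>p. kern v (fst p) (snd p) * f (post v (fst p) (snd p)) *
      maxwellian (post_star v (fst p) (snd p)) \<partial>(lborel \<Otimes>\<^sub>M sph))"
proof -
  have "gain \<gamma> b f v = (\<integral>p. kern v (fst p) (snd p) * f (post v (fst p) (snd p)) *
      maxwellian (post_star v (fst p) (snd p)) \<partial>(lborel \<Otimes>\<^sub>M sphere_measure))"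
    unfolding gain_def
    by (intro Bochner_Integration.integral_cong refl)
      (auto simp: space_pair_measure space_sphere_measure coll_kernel_kern)
  also have "\<dots> = (\<integral>p. kern v (fst p) (snd p) * f (post v (fst p) (snd p)) *
      maxwellian (post_star v (fst p) (snd p)) \<partial>(lborel \<Otimes>\<^sub>M sph))"
    by (rule integral_sphere_measure_pair) measurable
  finally show ?thesis .
qed

lemma coll_freq_eq:
  "coll_freq \<gamma> b v = (\<integral>p. kern v (fst p) (snd p) * maxwellian (fst p) \<partial>(lborel \<Otimes>\<^sub>M sph))"
proof -
  have "coll_freq \<gamma> b v = (\<integral>p. kern v (fst p) (snd p) * maxwellian (fst p) \<partial>(lborel \<Otimes>\<^sub>M sphere_measure))"
    unfolding coll_freq_def
    by (intro Bochner_Integration.integral_cong refl)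
      (auto simp: space_pair_measure space_sphere_measure coll_kernel_kern)
  also have "\<dots> = (\<integral>p. kern v (fst p) (snd p) * maxwellian (fst p) \<partial>(lborel \<Otimes>\<^sub>M sph))"
    by (rule integral_sphere_measure_pair) measurable
  finally show ?thesis .
qed

lemma angular_mass_sph:
  assumes "norm e = 1"
  shows "(\<integral>\<^sup>+s. ennreal (\<beta> (e \<bullet> s)) \<partial>sph) = angular_mass b e (0::'a)"
proof -
  have "sgn e = e" using assms by (simp add: sgn_div_norm)
  then have "angular_mass b e 0 = (\<integral>\<^sup>+s. ennreal (\<beta> (e \<bullet> s)) \<partial>sphere_measure)"
    unfolding angular_mass_def
    by (intro nn_integral_cong) (simp add: space_sphere_measure b_cos_angle)
  also have "\<dots> = (\<integral>\<^sup>+s. ennreal (\<beta> (e \<bullet> s)) \<partial>sph)"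
    by (rule nn_integral_sphere_measure) measurable
  finally show ?thesis ..
qed

text \<open>Positive angular mass in the form of the hypothesis \<open>pos\<close> of
  \<open>AE_jump_null\<close>.\<close>

lemma not_AE_\<beta>_zero:
  assumes "norm (e::'a) = 1"
  shows "\<not> (AE s in sph. \<beta> (e \<bullet> s) = 0)"
proof
  assume "AE s in sph. \<beta> (e \<bullet> s) = 0"
  then have "(\<integral>\<^sup>+s. ennreal (\<beta> (e \<bullet> s)) \<partial>sph) = (\<integral>\<^sup>+s. 0 \<partial>(sph :: 'a measure))"
    by (intro nn_integral_cong_AE) auto
  moreover have "e \<noteq> 0" using assms by auto
  ultimately show False using angular_mass_sph[OF assms] mass_pos[of e 0] by simp
qed

lemma freq_bounded:
  "\<exists>S>0. \<forall>v. (\<integral>\<^sup>+p. ennreal (kern v (fst p) (snd p) * maxwellian (fst p)) \<partial>(lborel \<Otimes>\<^sub>M sph)) \<le> ennreal S"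
proof -
  obtain e :: 'a where e: "norm e = 1" using SOME_Basis norm_Basis by blast
  define l where "l = enn2real (angular_mass b e 0)"
  have l: "ennreal l = angular_mass b e 0" "0 \<le> l"
  proof -
    have "e \<noteq> 0" using e by auto
    then show "ennreal l = angular_mass b e 0" using mass_finite[of e 0] by (simp add: l_def)
  qed (simp add: l_def)
  have mass: "(\<integral>\<^sup>+s. ennreal (\<beta> (e' \<bullet> s)) \<partial>sph) = ennreal l" if "norm e' = 1" for e' :: 'a
    using nn_integral_sph_inner[OF that e, of "\<lambda>x. ennreal (\<beta> x)"] angular_mass_sph[OF e] l by simp
  obtain C where C: "\<And>v::'a. (\<integral>\<^sup>+w. ennreal (norm (v - w) powr \<gamma> * maxwellian w) \<partial>lborel) \<le> ennreal C"
    using nn_integral_powr_maxwellian_bounded[OF \<gamma>] by blast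
  \<comment> \<open>The maximum with 0 covers a negative C, which \<open>ennreal\<close> truncates.
    The added 1 makes the bound strictly positive, because later on \<open>S\<close> is divided
    by.\<close>
  have "(\<integral>\<^sup>+p. ennreal (kern v (fst p) (snd p) * maxwellian (fst p)) \<partial>(lborel \<Otimes>\<^sub>M sph)) \<le> ennreal (max C 0 * l + 1)" for v
  proof -
    have "(\<integral>\<^sup>+p. ennreal (kern v (fst p) (snd p) * maxwellian (fst p)) \<partial>(lborel \<Otimes>\<^sub>M sph))
        = (\<integral>\<^sup>+w. (\<integral>\<^sup>+s. ennreal (kern v w s * maxwellian w) \<partial>sph) \<partial>lborel)"
      by (subst nn_integral_pair_sph) auto
    also have "\<dots> = (\<integral>\<^sup>+w. ennreal (norm (v - w) powr \<gamma> * maxwellian w) * ennreal l \<partial>lborel)"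
    proof (rule nn_integral_cong)
      fix w :: 'a
      have "(\<integral>\<^sup>+s. ennreal (kern v w s * maxwellian w) \<partial>sph)
          = (\<integral>\<^sup>+s. ennreal (norm (v - w) powr \<gamma> * maxwellian w) * ennreal (\<beta> (sgn (v - w) \<bullet> s)) \<partial>sph)"
        by (intro nn_integral_cong, subst ennreal_mult[symmetric])
          (auto simp: kern_def \<beta>_nonneg less_imp_le[OF maxwellian_pos] mult_ac)
      also have "\<dots> = ennreal (norm (v - w) powr \<gamma> * maxwellian w) * (\<integral>\<^sup>+s. ennreal (\<beta> (sgn (v - w) \<bullet> s)) \<partial>sph)"
        by (rule nn_integral_cmult) simp
      also have "\<dots> = ennreal (norm (v - w) powr \<gamma> * maxwellian w) * ennreal l"
        using mass[of "sgn (v - w)"] by (cases "v = w") (auto simp: norm_sgn)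
      finally show "(\<integral>\<^sup>+s. ennreal (kern v w s * maxwellian w) \<partial>sph)
          = ennreal (norm (v - w) powr \<gamma> * maxwellian w) * ennreal l" .
    qed
    also have "\<dots> = (\<integral>\<^sup>+w. ennreal (norm (v - w) powr \<gamma> * maxwellian w) \<partial>lborel) * ennreal l"
      by (rule nn_integral_multc) simp
    also have "\<dots> \<le> ennreal (max C 0) * ennreal l"
      using C[of v] by (intro mult_right_mono) (auto intro: order_trans ennreal_leI)
    also have "\<dots> \<le> ennreal (max C 0 * l + 1)"
      using l(2) by (simp add: ennreal_mult'[symmetric] ennreal_leI)
    finally show ?thesis .
  qed
  moreover have "max C 0 * l + 1 > 0" using l by (simp add: add_nonneg_pos)
  ultimately show ?thesis by blast
qed

definition S :: real where
  "S = (SOME S. S > 0 \<and>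
    (\<forall>v. (\<integral>\<^sup>+p. ennreal (kern v (fst p) (snd p) * maxwellian (fst p)) \<partial>(lborel \<Otimes>\<^sub>M sph)) \<le> ennreal S))"

lemma S_pos: "S > 0"
  and freq_nn_le: "(\<integral>\<^sup>+p. ennreal (kern v (fst p) (snd p) * maxwellian (fst p)) \<partial>(lborel \<Otimes>\<^sub>M sph)) \<le> ennreal S"
  using someI_ex[OF freq_bounded] unfolding S_def by auto

lemma kern_maxwellian_nonneg: "0 \<le> kern v w s * maxwellian u"
  by (simp add: less_imp_le[OF maxwellian_pos])

lemma integrable_kern: "integrable (lborel \<Otimes>\<^sub>M sph) (\<lambda>p. kern v (fst p) (snd p) * maxwellian (fst p))"
proof (rule integrableI_nonneg)
  show "AE p in lborel \<Otimes>\<^sub>M sph. 0 \<le> kern v (fst p) (snd p) * maxwellian (fst p)"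
    by (simp add: kern_maxwellian_nonneg)
  show "(\<integral>\<^sup>+p. ennreal (kern v (fst p) (snd p) * maxwellian (fst p)) \<partial>(lborel \<Otimes>\<^sub>M sph)) < \<infinity>"
    using freq_nn_le[of v] by (simp add: le_less_trans)
qed measurable

lemma freq_nn:
  "(\<integral>\<^sup>+p. ennreal (kern v (fst p) (snd p) * maxwellian (fst p)) \<partial>(lborel \<Otimes>\<^sub>M sph)) = ennreal (coll_freq \<gamma> b v)"
  unfolding coll_freq_eq by (rule nn_integral_eq_integral[OF integrable_kern]) (simp add: kern_maxwellian_nonneg)

lemma coll_freq_nonneg: "0 \<le> coll_freq \<gamma> b (v::'a)"
  unfolding coll_freq_eq by (intro integral_nonneg_AE) (simp add: kern_maxwellian_nonneg)

lemma coll_freq_le: "coll_freq \<gamma> b (v::'a) \<le> S"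
  using freq_nn_le[of v] S_pos unfolding freq_nn by (simp add: ennreal_le_iff)

lemma measurable_coll_freq [measurable]: "coll_freq \<gamma> b \<in> borel_measurable (borel :: 'a measure)"
  unfolding coll_freq_eq[abs_def] by measurable

text \<open>Mass balance of gain and loss: undoing the collision turns v' into v and its partner
  into w while \<open>kern\<close> is unchanged, and integrating out w and s leaves the collision
  frequency.\<close>

lemma nn_integral_gain:
  fixes f :: "'a \<Rightarrow> ennreal"
  assumes [measurable]: "f \<in> borel_measurable borel"
  shows "(\<integral>\<^sup>+v. (\<integral>\<^sup>+p. ennreal (kern v (fst p) (snd p) * maxwellian (post_star v (fst p) (snd p)))
      * f (post v (fst p) (snd p)) \<partial>(lborel \<Otimes>\<^sub>M sph)) \<partial>lborel)
    = (\<integral>\<^sup>+v. ennreal (coll_freq \<gamma> b v) * f v \<partial>lborel)"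
proof -
  define G where "G x = ennreal (kern (fst x) (fst (snd x)) (snd (snd x)) * maxwellian (fst (snd x))) * f (fst x)"
    for x :: "'a \<times> 'a \<times> 'a"
  have [measurable]: "G \<in> borel_measurable (borel \<Otimes>\<^sub>M borel \<Otimes>\<^sub>M borel)"
    unfolding G_def by measurable
  have "(\<integral>\<^sup>+v. (\<integral>\<^sup>+p. ennreal (kern v (fst p) (snd p) * maxwellian (post_star v (fst p) (snd p)))
      * f (post v (fst p) (snd p)) \<partial>(lborel \<Otimes>\<^sub>M sph)) \<partial>lborel)
    = (\<integral>\<^sup>+x. ennreal (kern (fst x) (fst (snd x)) (snd (snd x)) * maxwellian (post_star (fst x) (fst (snd x)) (snd (snd x))))
      * f (post (fst x) (fst (snd x)) (snd (snd x))) \<partial>(lborel \<Otimes>\<^sub>M (lborel \<Otimes>\<^sub>M sph)))"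
    by (subst nn_integral_triple_sph) auto
  also have "\<dots> = (\<integral>\<^sup>+x. G (collide x) \<partial>(lborel \<Otimes>\<^sub>M (lborel \<Otimes>\<^sub>M sph)))"
  proof (rule nn_integral_cong_AE)
    show "AE x in lborel \<Otimes>\<^sub>M (lborel \<Otimes>\<^sub>M sph).
        ennreal (kern (fst x) (fst (snd x)) (snd (snd x)) * maxwellian (post_star (fst x) (fst (snd x)) (snd (snd x))))
        * f (post (fst x) (fst (snd x)) (snd (snd x))) = G (collide x)"
      using AE_triple_sph_norm by eventually_elim (simp add: G_def collide_def kern_collide)
  qed
  also have "\<dots> = (\<integral>\<^sup>+x. G x \<partial>(lborel \<Otimes>\<^sub>M (lborel \<Otimes>\<^sub>M sph)))"
    by (rule nn_integral_collide) simp
  also have "\<dots> = (\<integral>\<^sup>+v. (\<integral>\<^sup>+p. ennreal (kern v (fst p) (snd p) * maxwellian (fst p)) * f v \<partial>(lborel \<Otimes>\<^sub>M sph)) \<partial>lborel)"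
    by (subst nn_integral_triple_sph) (auto simp: G_def)
  also have "\<dots> = (\<integral>\<^sup>+v. ennreal (coll_freq \<gamma> b v) * f v \<partial>lborel)"
    by (intro nn_integral_cong, subst nn_integral_multc) (auto simp: freq_nn)
  finally show ?thesis .
qed

section \<open>The reversible chain of collisions at equilibrium\<close>

definition \<mu> :: "'a measure" where
  "\<mu> = density lborel (\<lambda>v. ennreal (maxwellian v))"

text \<open>The rate of collisions when both partners are Maxwellian. On unit vectors s this weight
  is invariant under the collision map, the source of reversibility.\<close>

definition jumps :: "('a \<times> 'a \<times> 'a) measure" where
  "jumps = density (lborel \<Otimes>\<^sub>M (lborel \<Otimes>\<^sub>M sph))
    (\<lambda>x. ennreal (kern (fst x) (fst (snd x)) (snd (snd x)) * (maxwellian (fst x) * maxwellian (fst (snd x)))))"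

definition after :: "'a \<times> 'a \<times> 'a \<Rightarrow> 'a" where
  "after x = post (fst x) (fst (snd x)) (snd (snd x))"

text \<open>The gain operator in the unknown h = f / M, simplified by
  \<open>maxwellian_collision\<close>.\<close>

definition scatter :: "('a \<Rightarrow> real) \<Rightarrow> 'a \<Rightarrow> real" where
  "scatter h v = (\<integral>p. kern v (fst p) (snd p) * maxwellian (fst p) * h (post v (fst p) (snd p)) \<partial>(lborel \<Otimes>\<^sub>M sph))"

text \<open>The operator 1 + L / (2 S) seen through f = M h; \<open>P_maxwellian_mult\<close> makes
  the link.\<close>

definition Q :: "('a \<Rightarrow> real) \<Rightarrow> 'a \<Rightarrow> real" where
  "Q h v = h v + (scatter h v - coll_freq \<gamma> b v * h v) / (2 * S)"

lemma sets_\<mu> [simp, measurable_cong]: "sets \<mu> = sets borel"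
  by (simp add: \<mu>_def)

lemma space_\<mu> [simp]: "space \<mu> = UNIV"
  by (simp add: \<mu>_def)

lemma sets_jumps [simp, measurable_cong]: "sets jumps = sets (borel \<Otimes>\<^sub>M borel \<Otimes>\<^sub>M borel)"
  unfolding jumps_def sets_density by (intro sets_pair_measure_cong) auto

lemma measurable_after [measurable]: "after \<in> borel_measurable (borel \<Otimes>\<^sub>M borel \<Otimes>\<^sub>M borel)"
  unfolding after_def[abs_def] by measurable

lemma nn_integral_\<mu>:
  "f \<in> borel_measurable borel \<Longrightarrow> (\<integral>\<^sup>+v. f v \<partial>\<mu>) = (\<integral>\<^sup>+v. ennreal (maxwellian v) * f v \<partial>lborel)"
  unfolding \<mu>_def by (rule nn_integral_density) auto

lemma emeasure_\<mu>: "emeasure \<mu> UNIV = 1"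
  unfolding \<mu>_def by (simp add: emeasure_density nn_integral_maxwellian)

lemma nn_integral_jumps:
  fixes f :: "'a \<times> 'a \<times> 'a \<Rightarrow> ennreal"
  assumes [measurable]: "f \<in> borel_measurable (borel \<Otimes>\<^sub>M borel \<Otimes>\<^sub>M borel)"
  shows "(\<integral>\<^sup>+x. f x \<partial>jumps) = (\<integral>\<^sup>+x. ennreal (kern (fst x) (fst (snd x)) (snd (snd x)) *
    (maxwellian (fst x) * maxwellian (fst (snd x)))) * f x \<partial>(lborel \<Otimes>\<^sub>M (lborel \<Otimes>\<^sub>M sph)))"
  unfolding jumps_def by (rule nn_integral_density) measurable

lemma nn_integral_jumps_fst:
  assumes [measurable]: "f \<in> borel_measurable borel"
  shows "(\<integral>\<^sup>+x. f (fst x) \<partial>jumps) = (\<integral>\<^sup>+v. ennreal (coll_freq \<gamma> b v) * f v \<partial>\<mu>)"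
proof -
  have "(\<integral>\<^sup>+x. f (fst x) \<partial>jumps) = (\<integral>\<^sup>+v. (\<integral>\<^sup>+p. ennreal (kern v (fst p) (snd p) *
      (maxwellian v * maxwellian (fst p))) * f v \<partial>(lborel \<Otimes>\<^sub>M sph)) \<partial>lborel)"
    by (subst nn_integral_jumps, simp, subst nn_integral_triple_sph) auto
  also have "\<dots> = (\<integral>\<^sup>+v. (\<integral>\<^sup>+p. ennreal (kern v (fst p) (snd p) * maxwellian (fst p)) *
      (ennreal (maxwellian v) * f v) \<partial>(lborel \<Otimes>\<^sub>M sph)) \<partial>lborel)"
    by (intro nn_integral_cong)
      (simp add: ennreal_mult' ennreal_mult'' kern_maxwellian_nonneg less_imp_le[OF maxwellian_pos] mult_ac)
  also have "\<dots> = (\<integral>\<^sup>+v. ennreal (coll_freq \<gamma> b v) * (ennreal (maxwellian v) * f v) \<partial>lborel)"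
    by (intro nn_integral_cong, subst nn_integral_multc) (auto simp: freq_nn)
  also have "\<dots> = (\<integral>\<^sup>+v. ennreal (coll_freq \<gamma> b v) * f v \<partial>\<mu>)"
    by (subst nn_integral_\<mu>) (auto simp: mult_ac)
  finally show ?thesis .
qed

text \<open>Detailed balance: the collision map preserves both the reference measure and the weight
  of \<open>jumps\<close>, and exchanges the velocities before and after.\<close>

lemma nn_integral_jumps_swap:
  fixes f :: "'a \<times> 'a \<Rightarrow> ennreal"
  assumes [measurable]: "f \<in> borel_measurable (borel \<Otimes>\<^sub>M borel)"
  shows "(\<integral>\<^sup>+x. f (fst x, after x) \<partial>jumps) = (\<integral>\<^sup>+x. f (after x, fst x) \<partial>jumps)"
proof -
  define G where "G x = ennreal (kern (fst x) (fst (snd x)) (snd (snd x)) *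
    (maxwellian (fst x) * maxwellian (fst (snd x)))) * f (fst x, after x)" for x
  have [measurable]: "G \<in> borel_measurable (borel \<Otimes>\<^sub>M borel \<Otimes>\<^sub>M borel)"
    unfolding G_def by measurable
  have "(\<integral>\<^sup>+x. f (fst x, after x) \<partial>jumps) = (\<integral>\<^sup>+x. G x \<partial>(lborel \<Otimes>\<^sub>M (lborel \<Otimes>\<^sub>M sph)))"
    unfolding G_def by (subst nn_integral_jumps) auto
  also have "\<dots> = (\<integral>\<^sup>+x. G (collide x) \<partial>(lborel \<Otimes>\<^sub>M (lborel \<Otimes>\<^sub>M sph)))"
    by (rule nn_integral_collide[symmetric]) simp
  also have "\<dots> = (\<integral>\<^sup>+x. ennreal (kern (fst x) (fst (snd x)) (snd (snd x)) *
      (maxwellian (fst x) * maxwellian (fst (snd x)))) * f (after x, fst x) \<partial>(lborel \<Otimes>\<^sub>M (lborel \<Otimes>\<^sub>M sph)))"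
  proof (rule nn_integral_cong_AE)
    show "AE x in lborel \<Otimes>\<^sub>M (lborel \<Otimes>\<^sub>M sph). G (collide x) = ennreal (kern (fst x) (fst (snd x)) (snd (snd x)) *
        (maxwellian (fst x) * maxwellian (fst (snd x)))) * f (after x, fst x)"
      using AE_triple_sph_norm
      by eventually_elim (simp add: G_def collide_def after_def kern_collide maxwellian_collision post_involution)
  qed
  also have "\<dots> = (\<integral>\<^sup>+x. f (after x, fst x) \<partial>jumps)"
    by (subst nn_integral_jumps) auto
  finally show ?thesis .
qed

lemma nn_integral_jumps_after:
  assumes [measurable]: "f \<in> borel_measurable borel"
  shows "(\<integral>\<^sup>+x. f (after x) \<partial>jumps) = (\<integral>\<^sup>+x. f (fst x) \<partial>jumps)"
  using nn_integral_jumps_swap[of "\<lambda>p. f (snd p)"] by simp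

lemma nn_integral_jumps_fst_le:
  assumes [measurable]: "f \<in> borel_measurable borel"
  shows "(\<integral>\<^sup>+x. f (fst x) \<partial>jumps) \<le> ennreal S * (\<integral>\<^sup>+v. f v \<partial>\<mu>)"
proof -
  have "(\<integral>\<^sup>+x. f (fst x) \<partial>jumps) \<le> (\<integral>\<^sup>+v. ennreal S * f v \<partial>\<mu>)"
    unfolding nn_integral_jumps_fst[OF assms]
    by (intro nn_integral_mono mult_right_mono ennreal_leI coll_freq_le) auto
  then show ?thesis by (simp add: nn_integral_cmult)
qed

lemma finite_measure_jumps: "finite_measure jumps"
proof
  have "emeasure jumps (space jumps) = (\<integral>\<^sup>+x. 1 \<partial>jumps)" by simp
  also have "\<dots> \<le> ennreal S * 1"
    using nn_integral_jumps_fst_le[of "\<lambda>_. 1"] emeasure_\<mu> by simp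
  also have "\<dots> < \<infinity>" by simp
  finally show "emeasure jumps (space jumps) \<noteq> \<infinity>" by simp
qed

lemma finite_measure_\<mu>: "finite_measure \<mu>"
  by standard (simp add: emeasure_\<mu>)

lemma bdd_meas_\<mu>: "h \<in> bdd_meas \<mu> \<longleftrightarrow> h \<in> borel_measurable borel \<and> (\<exists>C. \<forall>x. \<bar>h x\<bar> \<le> C)"
  by (simp add: bdd_meas_def measurable_cong_sets[OF sets_\<mu> refl])

lemma integrable_scatter:
  assumes "h \<in> bdd_meas \<mu>"
  shows "integrable (lborel \<Otimes>\<^sub>M sph) (\<lambda>p. kern v (fst p) (snd p) * maxwellian (fst p) * h (post v (fst p) (snd p)))"
proof -
  obtain C where [measurable]: "h \<in> borel_measurable borel" and C: "\<And>x. \<bar>h x\<bar> \<le> C"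
    using assms by (auto simp: bdd_meas_\<mu>)
  show ?thesis
  proof (rule Bochner_Integration.integrable_bound)
    show "integrable (lborel \<Otimes>\<^sub>M sph) (\<lambda>p. kern v (fst p) (snd p) * maxwellian (fst p) * C)"
      using integrable_kern by simp
    show "AE p in lborel \<Otimes>\<^sub>M sph. norm (kern v (fst p) (snd p) * maxwellian (fst p) * h (post v (fst p) (snd p)))
        \<le> norm (kern v (fst p) (snd p) * maxwellian (fst p) * C)"
      using order_trans[OF C abs_ge_self] by (auto simp: abs_mult intro!: mult_left_mono)
  qed measurable
qed

lemma scatter_bound:
  assumes h: "h \<in> bdd_meas \<mu>" and C: "\<And>x. \<bar>h x\<bar> \<le> C"
  shows "\<bar>scatter h v\<bar> \<le> C * S"
proof -
  have C0: "0 \<le> C" using C[of 0] by linarith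
  have "\<bar>scatter h v\<bar> \<le> (\<integral>p. \<bar>kern v (fst p) (snd p) * maxwellian (fst p) * h (post v (fst p) (snd p))\<bar> \<partial>(lborel \<Otimes>\<^sub>M sph))"
    unfolding scatter_def by (rule integral_abs_bound)
  also have "\<dots> \<le> (\<integral>p. kern v (fst p) (snd p) * maxwellian (fst p) * C \<partial>(lborel \<Otimes>\<^sub>M sph))"
  proof (rule integral_mono)
    show "\<bar>kern v (fst p) (snd p) * maxwellian (fst p) * h (post v (fst p) (snd p))\<bar>
        \<le> kern v (fst p) (snd p) * maxwellian (fst p) * C" for p
      using C[of "post v (fst p) (snd p)"] kern_maxwellian_nonneg[of v "fst p" "snd p" "fst p"]
      unfolding abs_mult[of "kern v (fst p) (snd p) * maxwellian (fst p)"] by (simp add: mult_left_mono)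
    show "integrable (lborel \<Otimes>\<^sub>M sph) (\<lambda>p. kern v (fst p) (snd p) * maxwellian (fst p) * C)"
      using integrable_kern by simp
  qed (rule integrable_abs[OF integrable_scatter[OF h]])
  also have "\<dots> = coll_freq \<gamma> b v * C" by (simp add: coll_freq_eq)
  also have "\<dots> \<le> S * C" using coll_freq_le C0 by (rule mult_right_mono)
  finally show ?thesis by (simp add: mult.commute)
qed

lemma scatter_bdd:
  assumes h: "h \<in> bdd_meas \<mu>"
  shows "scatter h \<in> bdd_meas \<mu>"
proof -
  obtain C where [measurable]: "h \<in> borel_measurable borel" and C: "\<And>x. \<bar>h x\<bar> \<le> C"
    using h by (auto simp: bdd_meas_\<mu>)
  have "scatter h \<in> borel_measurable borel" unfolding scatter_def[abs_def] by measurable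
  then show ?thesis using scatter_bound[OF h C] by (auto simp: bdd_meas_\<mu>)
qed

lemma coll_freq_bdd: "coll_freq \<gamma> b \<in> bdd_meas \<mu>"
  using coll_freq_nonneg coll_freq_le by (auto simp: bdd_meas_\<mu> intro!: exI[of _ S])

lemma Q_bdd:
  assumes h: "h \<in> bdd_meas \<mu>"
  shows "Q h \<in> bdd_meas \<mu>"
proof -
  have "(\<lambda>v. h v + (1 / (2 * S)) * (scatter h v - coll_freq \<gamma> b v * h v)) \<in> bdd_meas \<mu>"
    by (intro bdd_meas_add bdd_meas_mult bdd_meas_diff bdd_meas_const h scatter_bdd coll_freq_bdd)
  then show ?thesis by (simp add: Q_def[abs_def])
qed

lemma Q_weak:
  assumes g: "g \<in> bdd_meas \<mu>" and h: "h \<in> bdd_meas \<mu>"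
  shows "(\<integral>x. g x * Q h x \<partial>\<mu>) = (\<integral>x. g x * h x \<partial>\<mu>) - (\<integral>x. g (fst x) * (h (fst x) - h (after x)) \<partial>jumps) / (2 * S)"
proof -
  interpret \<mu>: finite_measure \<mu> by (rule finite_measure_\<mu>)
  interpret jumps: finite_measure jumps by (rule finite_measure_jumps)
  have [measurable]: "g \<in> borel_measurable borel" "h \<in> borel_measurable borel"
    using g h by (auto simp: bdd_meas_\<mu>)
  define D where "D x = kern (fst x) (fst (snd x)) (snd (snd x)) * (maxwellian (fst x) * maxwellian (fst (snd x)))"
    for x :: "'a \<times> 'a \<times> 'a"
  have D0: "0 \<le> D x" for x by (simp add: D_def less_imp_le[OF maxwellian_pos])
  have [measurable]: "D \<in> borel_measurable (borel \<Otimes>\<^sub>M borel \<Otimes>\<^sub>M borel)" unfolding D_def by measurable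
  define F where "F x = g (fst x) * (h (fst x) - h (after x))" for x
  have [measurable]: "F \<in> borel_measurable (borel \<Otimes>\<^sub>M borel \<Otimes>\<^sub>M borel)" unfolding F_def by measurable
  have jumps: "jumps = density (lborel \<Otimes>\<^sub>M (lborel \<Otimes>\<^sub>M sph)) (\<lambda>x. ennreal (D x))"
    by (simp add: jumps_def D_def)
  have m: "fst \<in> measurable jumps \<mu>" "after \<in> measurable jumps \<mu>" by measurable
  have "F \<in> bdd_meas jumps" unfolding F_def
    by (intro bdd_meas_mult bdd_meas_diff bdd_meas_compose[OF g] bdd_meas_compose[OF h] m)
  then have "integrable jumps F" by (rule jumps.integrable_bdd_meas)
  then have iF: "integrable (lborel \<Otimes>\<^sub>M (lborel \<Otimes>\<^sub>M sph)) (\<lambda>x. D x * F x)"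
    unfolding jumps by (subst (asm) integrable_density) (auto simp: D0)
  have "(\<integral>x. F x \<partial>jumps) = (\<integral>x. D x * F x \<partial>(lborel \<Otimes>\<^sub>M (lborel \<Otimes>\<^sub>M sph)))"
    unfolding jumps by (subst integral_density) (auto simp: D0)
  also have "\<dots> = (\<integral>v. (\<integral>p. D (v, p) * F (v, p) \<partial>(lborel \<Otimes>\<^sub>M sph)) \<partial>lborel)"
    using v_w_sph.integral_fst'[OF iF] by simp
  also have "\<dots> = (\<integral>v. maxwellian v * (g v * (coll_freq \<gamma> b v * h v - scatter h v)) \<partial>lborel)"
  proof (intro Bochner_Integration.integral_cong refl)
    fix v :: 'a
    have "(\<integral>p. D (v, p) * F (v, p) \<partial>(lborel \<Otimes>\<^sub>M sph))
        = (\<integral>p. maxwellian v * g v * (kern v (fst p) (snd p) * maxwellian (fst p) * h v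
            - kern v (fst p) (snd p) * maxwellian (fst p) * h (post v (fst p) (snd p))) \<partial>(lborel \<Otimes>\<^sub>M sph))"
      by (intro Bochner_Integration.integral_cong refl) (simp add: D_def F_def after_def algebra_simps)
    also have "\<dots> = maxwellian v * g v * (coll_freq \<gamma> b v * h v - scatter h v)"
      using integrable_kern[of v] integrable_scatter[OF h, of v]
      by (simp add: scatter_def coll_freq_eq)
    finally show "(\<integral>p. D (v, p) * F (v, p) \<partial>(lborel \<Otimes>\<^sub>M sph))
        = maxwellian v * (g v * (coll_freq \<gamma> b v * h v - scatter h v))" by simp
  qed
  also have "\<dots> = (\<integral>v. g v * (coll_freq \<gamma> b v * h v - scatter h v) \<partial>\<mu>)"
  proof -
    have [measurable]: "scatter h \<in> borel_measurable borel"
      using scatter_bdd[OF h] by (simp add: bdd_meas_\<mu>)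
    show ?thesis unfolding \<mu>_def by (subst integral_density) (auto simp: less_imp_le[OF maxwellian_pos])
  qed
  finally have *: "(\<integral>x. F x \<partial>jumps) = (\<integral>v. g v * (coll_freq \<gamma> b v * h v - scatter h v) \<partial>\<mu>)" .
  have i: "integrable \<mu> (\<lambda>v. g v * h v)" "integrable \<mu> (\<lambda>v. g v * (coll_freq \<gamma> b v * h v - scatter h v))"
    by (intro \<mu>.integrable_bdd_meas bdd_meas_mult bdd_meas_diff g h scatter_bdd coll_freq_bdd)+
  have "(\<integral>x. g x * Q h x \<partial>\<mu>) = (\<integral>x. g x * h x - g x * (coll_freq \<gamma> b x * h x - scatter h x) / (2 * S) \<partial>\<mu>)"
    by (intro Bochner_Integration.integral_cong refl) (use S_pos in \<open>simp add: Q_def field_simps\<close>)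
  also have "\<dots> = (\<integral>x. g x * h x \<partial>\<mu>) - (\<integral>x. F x \<partial>jumps) / (2 * S)"
    using i by (simp add: *)
  finally show ?thesis by (simp add: F_def)
qed

text \<open>One jump from a fixed velocity already reaches almost every other. Fix a v from which
  almost every charged collision leaves g unchanged; by \<open>AE_jump_null\<close> the set N of
  displacements that would change g is null, so g equals g v almost everywhere.\<close>

lemma jumps_irreducible:
  fixes g :: "'a \<Rightarrow> real"
  assumes [measurable]: "g \<in> borel_measurable borel" and ae: "AE x in jumps. g (fst x) = g (after x)"
  shows "\<exists>c. AE x in \<mu>. g x = c"
proof -
  define R where "R v w s \<longleftrightarrow> 0 < kern v w s \<longrightarrow> g v = g (post v w s)" for v w s
  have [measurable]: "Measurable.pred (lborel \<Otimes>\<^sub>M sph) (\<lambda>p. R v (fst p) (snd p))" for v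
    unfolding R_def by measurable
  have "AE x in lborel \<Otimes>\<^sub>M (lborel \<Otimes>\<^sub>M sph). 0 < ennreal (kern (fst x) (fst (snd x)) (snd (snd x)) *
      (maxwellian (fst x) * maxwellian (fst (snd x)))) \<longrightarrow> g (fst x) = g (after x)"
    using ae unfolding jumps_def by (subst (asm) AE_density) auto
  then have "AE x in lborel \<Otimes>\<^sub>M (lborel \<Otimes>\<^sub>M sph). R (fst x) (fst (snd x)) (snd (snd x))"
    by eventually_elim (simp add: R_def after_def zero_less_mult_iff maxwellian_pos)
  then have "AE v in lborel. AE p in lborel \<Otimes>\<^sub>M sph. R v (fst p) (snd p)"
    using v_w_sph.AE_pair by fastforce
  \<comment> \<open>A single good v is enough, and it exists because Lebesgue measure is not the
    zero measure.\<close>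
  then have "\<exists>v. AE p in lborel \<Otimes>\<^sub>M sph. R v (fst p) (snd p)"
  proof (rule contrapos_pp)
    assume "\<nexists>v. AE p in lborel \<Otimes>\<^sub>M sph. R v (fst p) (snd p)"
    moreover have "ae_filter (lborel :: 'a measure) \<noteq> bot"
      by (simp add: ae_filter_eq_bot_iff emeasure_lborel_UNIV)
    ultimately show "\<not> (AE v in lborel. AE p in lborel \<Otimes>\<^sub>M sph. R v (fst p) (snd p))"
      by (simp add: eventually_False)
  qed
  then obtain v where v: "AE p in lborel \<Otimes>\<^sub>M sph. R v (fst p) (snd p)" by blast
  define N where "N = {z. g (v + z) \<noteq> g v}"
  have [measurable]: "N \<in> sets borel" unfolding N_def by measurable
  have "AE w in lborel. AE s in sph. R v w s"
    using w_sph.AE_pair[OF v] by simp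
  moreover have "{x \<in> space (lborel \<Otimes>\<^sub>M sph). R v (fst x) (snd x)} \<in> sets (lborel \<Otimes>\<^sub>M sph)"
    unfolding R_def by measurable
  ultimately have "AE s in sph. AE w in lborel. R v w s"
    by (simp add: w_sph.AE_commute)
  then have "AE s in sph. AE u in lborel. \<beta> (sgn u \<bullet> s) = 0 \<or> (norm u *\<^sub>R s - u) /\<^sub>R 2 \<notin> N"
  proof eventually_elim
    case (elim s)
    \<comment> \<open>The substitution w = v - u, which replaces the partner's velocity by the
      relative velocity.\<close>
    have D: "distr lborel borel (\<lambda>u. v - u) = lborel"
    proof (rule measure_eqI)
      fix A :: "'a set" assume "A \<in> sets (distr lborel borel (\<lambda>u. v - u))"
      then have [measurable]: "A \<in> sets borel" by simp
      have "emeasure (distr lborel borel (\<lambda>u. v - u)) A = (\<integral>\<^sup>+u. indicator A u \<partial>distr lborel borel (\<lambda>u. v - u))"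
        by simp
      also have "\<dots> = (\<integral>\<^sup>+u. indicator A (v - u) \<partial>lborel)"
        by (rule nn_integral_distr) auto
      also have "\<dots> = emeasure lborel A" by (subst nn_integral_lborel_reflect) auto
      finally show "emeasure (distr lborel borel (\<lambda>u. v - u)) A = emeasure lborel A" .
    qed simp
    have "AE w in distr lborel borel (\<lambda>u. v - u). R v w s" unfolding D by (rule elim)
    then have "AE u in lborel. R v (v - u) s"
      by (subst (asm) AE_distr_iff) (auto simp: R_def[abs_def])
    moreover have "AE u in lborel. u \<noteq> (0::'a)" by (rule AE_lborel_singleton)
    ultimately show ?case
    proof eventually_elim
      case (elim u)
      have "post v (v - u) s = v + (norm u *\<^sub>R s - u) /\<^sub>R 2"
      proof -
        have "(v + (v - u)) /\<^sub>R 2 = v - u /\<^sub>R 2"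
          by (simp add: scaleR_diff_right flip: scaleR_2) (simp add: algebra_simps flip: scaleR_2)
        then show ?thesis by (simp add: post_def scaleR_diff_right)
      qed
      moreover have "kern v (v - u) s = norm u powr \<gamma> * \<beta> (sgn u \<bullet> s)" by (simp add: kern_def)
      moreover have "\<beta> (sgn u \<bullet> s) = 0 \<or> \<beta> (sgn u \<bullet> s) > 0" using \<beta>_nonneg[of "sgn u \<bullet> s"] by linarith
      ultimately show ?case using elim by (auto simp: R_def N_def)
    qed
  qed
  from AE_jump_null[OF dim measurable_\<beta> _ not_AE_\<beta>_zero this]
  have "AE z in lborel. g (v + z) = g v" by (simp add: N_def)
  then have "AE x in distr lborel borel ((+) v). g x = g v"
    by (subst AE_distr_iff) auto
  then have "AE x in lborel. g x = g v" unfolding lborel_distr_plus .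
  then have "AE x in \<mu>. g x = g v"
    unfolding \<mu>_def by (subst AE_density) auto
  then show ?thesis by blast
qed

sublocale reversible_chain \<mu> jumps fst after S Q
proof (intro reversible_chain.intro reversible_chain_axioms.intro finite_measure_\<mu> finite_measure_jumps S_pos)
  show "measure \<mu> (space \<mu>) = 1" by (simp add: measure_def emeasure_\<mu>)
  show "fst \<in> measurable jumps \<mu>" "after \<in> measurable jumps \<mu>" by measurable
  show "(\<integral>\<^sup>+x. f (fst x) \<partial>jumps) \<le> ennreal S * (\<integral>\<^sup>+x. f x \<partial>\<mu>)" if "f \<in> borel_measurable \<mu>" for f
    using that by (intro nn_integral_jumps_fst_le) simp
  show "(\<integral>\<^sup>+x. f (after x) \<partial>jumps) \<le> ennreal S * (\<integral>\<^sup>+x. f x \<partial>\<mu>)" if "f \<in> borel_measurable \<mu>" for f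
    using that nn_integral_jumps_fst_le[of f] nn_integral_jumps_after[of f] by simp
  show "(\<integral>x. f (fst x) * g (after x) \<partial>jumps) = (\<integral>x. g (fst x) * f (after x) \<partial>jumps)"
    if "f \<in> bdd_meas \<mu>" "g \<in> bdd_meas \<mu>" for f g
  proof -
    have [measurable]: "f \<in> borel_measurable borel" "g \<in> borel_measurable borel"
      using that by (auto simp: bdd_meas_\<mu>)
    \<comment> \<open>The exchange is known for nonnegative integrands; equality of the two joint
      laws carries it over to signed f and g.\<close>
    have eq: "distr jumps (borel \<Otimes>\<^sub>M borel) (\<lambda>x. (fst x, after x)) = distr jumps (borel \<Otimes>\<^sub>M borel) (\<lambda>x. (after x, fst x))"
    proof (rule measure_eqI)
      fix A assume "A \<in> sets (distr jumps (borel \<Otimes>\<^sub>M borel) (\<lambda>x. (fst x, after x)))"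
      then have [measurable]: "A \<in> sets (borel \<Otimes>\<^sub>M borel)" by simp
      have "emeasure (distr jumps (borel \<Otimes>\<^sub>M borel) (\<lambda>x. (fst x, after x))) A = (\<integral>\<^sup>+x. indicator A (fst x, after x) \<partial>jumps)"
        by (subst nn_integral_distr[symmetric, of _ _ "borel \<Otimes>\<^sub>M borel"]) auto
      also have "\<dots> = (\<integral>\<^sup>+x. indicator A (after x, fst x) \<partial>jumps)"
        by (rule nn_integral_jumps_swap) simp
      also have "\<dots> = emeasure (distr jumps (borel \<Otimes>\<^sub>M borel) (\<lambda>x. (after x, fst x))) A"
        by (subst nn_integral_distr[symmetric, of _ _ "borel \<Otimes>\<^sub>M borel"]) auto
      finally show "emeasure (distr jumps (borel \<Otimes>\<^sub>M borel) (\<lambda>x. (fst x, after x))) A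
          = emeasure (distr jumps (borel \<Otimes>\<^sub>M borel) (\<lambda>x. (after x, fst x))) A" .
    qed simp
    have "(\<integral>x. f (fst x) * g (after x) \<partial>jumps)
        = (\<integral>y. f (fst y) * g (snd y) \<partial>distr jumps (borel \<Otimes>\<^sub>M borel) (\<lambda>x. (fst x, after x)))"
      by (subst integral_distr) auto
    also have "\<dots> = (\<integral>x. f (after x) * g (fst x) \<partial>jumps)"
      unfolding eq by (subst integral_distr) auto
    finally show ?thesis by (simp add: mult.commute)
  qed
  show "Q h \<in> bdd_meas \<mu>" if "h \<in> bdd_meas \<mu>" for h using that by (rule Q_bdd)
  show "(\<integral>x. g x * Q h x \<partial>\<mu>) = (\<integral>x. g x * h x \<partial>\<mu>) - (\<integral>x. g (fst x) * (h (fst x) - h (after x)) \<partial>jumps) / (2 * S)"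
    if "g \<in> bdd_meas \<mu>" "h \<in> bdd_meas \<mu>" for g h using that by (rule Q_weak)
  show "\<exists>c. AE x in \<mu>. g x = c" if "g \<in> borel_measurable \<mu>" "AE x in jumps. g (fst x) = g (after x)"
    for g :: "'a \<Rightarrow> real"
    using that by (intro jumps_irreducible) auto
qed

end

section \<open>The operator on L^1 and its contraction property\<close>

context linear_boltzmann
begin

lemma nn_integral_abs_gain_integrand:
  assumes [measurable]: "f \<in> borel_measurable (borel :: 'a measure)"
  shows "(\<integral>\<^sup>+v. (\<integral>\<^sup>+p. ennreal \<bar>kern v (fst p) (snd p) * f (post v (fst p) (snd p)) *
      maxwellian (post_star v (fst p) (snd p))\<bar> \<partial>(lborel \<Otimes>\<^sub>M sph)) \<partial>lborel)
    = (\<integral>\<^sup>+v. ennreal (coll_freq \<gamma> b v * \<bar>f v\<bar>) \<partial>lborel)"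
proof -
  have "ennreal \<bar>kern v w s * f x * maxwellian y\<bar> = ennreal (kern v w s * maxwellian y) * ennreal \<bar>f x\<bar>"
    for v w s x and y :: 'a
    by (simp add: abs_mult ennreal_mult'[symmetric] kern_maxwellian_nonneg less_imp_le[OF maxwellian_pos] mult_ac)
  moreover have "ennreal (coll_freq \<gamma> b v * \<bar>f v\<bar>) = ennreal (coll_freq \<gamma> b v) * ennreal \<bar>f v\<bar>" for v
    by (simp add: ennreal_mult' coll_freq_nonneg)
  ultimately show ?thesis
    using nn_integral_gain[of "\<lambda>x. ennreal \<bar>f x\<bar>"] by simp
qed

lemma nn_integral_freq_finite:
  assumes "integrable lborel (f :: 'a \<Rightarrow> real)"
  shows "(\<integral>\<^sup>+v. ennreal (coll_freq \<gamma> b v * \<bar>f v\<bar>) \<partial>lborel) < \<infinity>"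
proof -
  have [measurable]: "f \<in> borel_measurable borel" using assms by auto
  have "(\<integral>\<^sup>+v. ennreal (coll_freq \<gamma> b v * \<bar>f v\<bar>) \<partial>lborel) \<le> (\<integral>\<^sup>+v. ennreal (S * \<bar>f v\<bar>) \<partial>lborel)"
    by (intro nn_integral_mono ennreal_leI mult_right_mono coll_freq_le) auto
  also have "\<dots> < \<infinity>"
  proof -
    have "integrable lborel (\<lambda>v. S * \<bar>f v\<bar>)" using assms by simp
    then show ?thesis using S_pos by (subst nn_integral_eq_integral) auto
  qed
  finally show ?thesis .
qed

lemma integrable_gain_integrand:
  assumes f: "integrable lborel (f :: 'a \<Rightarrow> real)"
  shows "integrable (lborel \<Otimes>\<^sub>M (lborel \<Otimes>\<^sub>M sph)) (\<lambda>x. kern (fst x) (fst (snd x)) (snd (snd x)) *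
    f (post (fst x) (fst (snd x)) (snd (snd x))) * maxwellian (post_star (fst x) (fst (snd x)) (snd (snd x))))"
proof (rule integrableI_bounded)
  have [measurable]: "f \<in> borel_measurable borel" using f by auto
  show "(\<lambda>x. kern (fst x) (fst (snd x)) (snd (snd x)) *
    f (post (fst x) (fst (snd x)) (snd (snd x))) * maxwellian (post_star (fst x) (fst (snd x)) (snd (snd x))))
    \<in> borel_measurable (lborel \<Otimes>\<^sub>M (lborel \<Otimes>\<^sub>M sph))"
    by measurable
  show "(\<integral>\<^sup>+x. ennreal (norm (kern (fst x) (fst (snd x)) (snd (snd x)) *
    f (post (fst x) (fst (snd x)) (snd (snd x))) * maxwellian (post_star (fst x) (fst (snd x)) (snd (snd x)))))
    \<partial>(lborel \<Otimes>\<^sub>M (lborel \<Otimes>\<^sub>M sph))) < \<infinity>"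
    using nn_integral_freq_finite[OF f] nn_integral_abs_gain_integrand[of f]
    by (subst nn_integral_triple_sph) auto
qed

lemma AE_integrable_gain_integrand:
  assumes f: "integrable lborel (f :: 'a \<Rightarrow> real)"
  shows "AE v in lborel. integrable (lborel \<Otimes>\<^sub>M sph) (\<lambda>p. kern v (fst p) (snd p) *
    f (post v (fst p) (snd p)) * maxwellian (post_star v (fst p) (snd p)))"
  using v_w_sph.AE_integrable_fst'[OF integrable_gain_integrand[OF f]] by simp

lemma integrable_gain:
  assumes f: "integrable lborel (f :: 'a \<Rightarrow> real)"
  shows "integrable lborel (gain \<gamma> b f)"
proof -
  have m: "f \<in> borel_measurable borel" using f by auto
  have "gain \<gamma> b f = (\<lambda>v. \<integral>p. kern v (fst p) (snd p) *
      f (post v (fst p) (snd p)) * maxwellian (post_star v (fst p) (snd p)) \<partial>(lborel \<Otimes>\<^sub>M sph))"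
    using gain_eq[OF m] by blast
  then show ?thesis using v_w_sph.integrable_fst'[OF integrable_gain_integrand[OF f]] by simp
qed

lemma integrable_freq:
  assumes f: "integrable lborel (f :: 'a \<Rightarrow> real)"
  shows "integrable lborel (\<lambda>v. coll_freq \<gamma> b v * f v)"
proof (rule Bochner_Integration.integrable_bound)
  have [measurable]: "f \<in> borel_measurable borel" using f by auto
  show "integrable lborel (\<lambda>v. S * f v)" using f by simp
  show "(\<lambda>v. coll_freq \<gamma> b v * f v) \<in> borel_measurable lborel" by measurable
  show "AE v in lborel. norm (coll_freq \<gamma> b v * f v) \<le> norm (S * f v)"
    using coll_freq_nonneg coll_freq_le S_pos by (auto simp: abs_mult intro!: mult_right_mono)
qed

text \<open>Move the absolute value inside the gain integral and use mass balance: the gain of f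
  weighs no more than its loss.\<close>

lemma integral_abs_gain_le:
  assumes f: "integrable lborel (f :: 'a \<Rightarrow> real)"
  shows "(\<integral>v. \<bar>gain \<gamma> b f v\<bar> \<partial>lborel) \<le> (\<integral>v. coll_freq \<gamma> b v * \<bar>f v\<bar> \<partial>lborel)"
proof -
  have m: "f \<in> borel_measurable borel" using f by auto
  have "(\<integral>\<^sup>+v. ennreal \<bar>gain \<gamma> b f v\<bar> \<partial>lborel)
      \<le> (\<integral>\<^sup>+v. (\<integral>\<^sup>+p. ennreal \<bar>kern v (fst p) (snd p) * f (post v (fst p) (snd p)) *
        maxwellian (post_star v (fst p) (snd p))\<bar> \<partial>(lborel \<Otimes>\<^sub>M sph)) \<partial>lborel)"
  proof (rule nn_integral_mono_AE)
    show "AE v in lborel. ennreal \<bar>gain \<gamma> b f v\<bar>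
        \<le> (\<integral>\<^sup>+p. ennreal \<bar>kern v (fst p) (snd p) * f (post v (fst p) (snd p)) *
          maxwellian (post_star v (fst p) (snd p))\<bar> \<partial>(lborel \<Otimes>\<^sub>M sph))"
      using AE_integrable_gain_integrand[OF f]
    proof eventually_elim
      case (elim v)
      show ?case using integral_norm_bound_ennreal[OF elim] by (simp add: gain_eq[OF m])
    qed
  qed
  also have "\<dots> = (\<integral>\<^sup>+v. ennreal (coll_freq \<gamma> b v * \<bar>f v\<bar>) \<partial>lborel)"
    by (rule nn_integral_abs_gain_integrand[OF m])
  finally show ?thesis
    using integrable_gain[OF f] integrable_freq[OF integrable_abs[OF f]] coll_freq_nonneg
    by (subst (asm) (1 2) nn_integral_eq_integral) (auto simp: ennreal_le_iff)
qed

text \<open>Only almost everywhere: where one of the gain integrals diverges, its default value 0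
  need not respect sums.\<close>

lemma gain_linear:
  assumes f: "integrable lborel (f :: 'a \<Rightarrow> real)" and g: "integrable lborel g"
  shows "AE v in lborel. gain \<gamma> b (\<lambda>x. c * f x + g x) v = c * gain \<gamma> b f v + gain \<gamma> b g v"
  using AE_integrable_gain_integrand[OF f] AE_integrable_gain_integrand[OF g]
proof eventually_elim
  case (elim v)
  have [measurable]: "f \<in> borel_measurable borel" "g \<in> borel_measurable borel" using f g by auto
  have "gain \<gamma> b (\<lambda>x. c * f x + g x) v
      = (\<integral>p. c * (kern v (fst p) (snd p) * f (post v (fst p) (snd p)) * maxwellian (post_star v (fst p) (snd p)))
        + kern v (fst p) (snd p) * g (post v (fst p) (snd p)) * maxwellian (post_star v (fst p) (snd p)) \<partial>(lborel \<Otimes>\<^sub>M sph))"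
    by (subst gain_eq) (auto simp: algebra_simps)
  also have "\<dots> = c * gain \<gamma> b f v + gain \<gamma> b g v"
    using elim by (simp add: gain_eq)
  finally show ?case .
qed

definition collision :: "('a \<Rightarrow> real) \<Rightarrow> 'a \<Rightarrow> real" where
  "collision f v = gain \<gamma> b f v - coll_freq \<gamma> b v * f v"

lemma integrable_collision:
  assumes f: "integrable lborel (f :: 'a \<Rightarrow> real)"
  shows "integrable lborel (collision f)"
  unfolding collision_def[abs_def] using integrable_gain[OF f] integrable_freq[OF f] by simp

lemma collision_linear:
  assumes f: "integrable lborel (f :: 'a \<Rightarrow> real)" and g: "integrable lborel g"
  shows "AE v in lborel. collision (\<lambda>x. c * f x + g x) v = c * collision f v + collision g v"
  using gain_linear[OF f g, of c] by eventually_elim (simp add: collision_def algebra_simps)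

text \<open>The gain at a given v samples f at the velocities v', so equality almost everywhere is
  not inherited point by point. Instead the gain of the difference vanishes almost everywhere by the
  L^1 bound.\<close>

lemma collision_cong_AE:
  assumes f: "integrable lborel (f :: 'a \<Rightarrow> real)" and g: "integrable lborel g" and eq: "AE x in lborel. f x = g x"
  shows "AE v in lborel. collision f v = collision g v"
proof -
  define d where "d x = - 1 * g x + f x" for x
  have d: "integrable lborel d" unfolding d_def using f g by (intro Bochner_Integration.integrable_add integrable_mult_right) auto
  have d0: "AE x in lborel. d x = 0" using eq by eventually_elim (simp add: d_def)
  have "(\<integral>v. \<bar>gain \<gamma> b d v\<bar> \<partial>lborel) \<le> (\<integral>v. coll_freq \<gamma> b v * \<bar>d v\<bar> \<partial>lborel)"
    by (rule integral_abs_gain_le[OF d])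
  also have "\<dots> = (\<integral>v. 0 \<partial>(lborel :: 'a measure))"
  proof (rule integral_cong_AE)
    show "AE v in lborel. coll_freq \<gamma> b v * \<bar>d v\<bar> = 0" using d0 by eventually_elim simp
    show "(\<lambda>v. coll_freq \<gamma> b v * \<bar>d v\<bar>) \<in> borel_measurable lborel"
      using integrable_freq[OF integrable_abs[OF d]] by auto
  qed simp
  finally have "(\<integral>v. \<bar>gain \<gamma> b d v\<bar> \<partial>lborel) \<le> 0" by simp
  moreover have "0 \<le> (\<integral>v. \<bar>gain \<gamma> b d v\<bar> \<partial>lborel)" by simp
  ultimately have "(\<integral>v. \<bar>gain \<gamma> b d v\<bar> \<partial>lborel) = 0" by linarith
  then have "AE v in lborel. gain \<gamma> b d v = 0"
    using integrable_gain[OF d] by (subst (asm) integral_nonneg_eq_0_iff_AE) auto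
  moreover have "AE v in lborel. gain \<gamma> b d v = - 1 * gain \<gamma> b g v + gain \<gamma> b f v"
    unfolding d_def by (rule gain_linear[OF g f])
  ultimately show ?thesis using eq by eventually_elim (simp add: collision_def)
qed

lemma boltzmann_abs:
  assumes f: "integrable lborel (f :: 'a \<Rightarrow> real)"
  shows "boltzmann \<gamma> b (abs_l1 f) = abs_l1 (collision f)"
  unfolding boltzmann_def collision_def[symmetric, abs_def]
  using collision_cong_AE[OF integrable_rep_l1 f rep_abs_l1[OF f]]
  by (intro abs_l1_eqI integrable_collision integrable_rep_l1 f)

definition P :: "'a l1 \<Rightarrow> 'a l1" where
  "P F = F + (1 / (2 * S)) *\<^sub>R boltzmann \<gamma> b F"

lemma boltzmann_P: "boltzmann \<gamma> b F = (2 * S) *\<^sub>R (P F - F)"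
  using S_pos by (simp add: P_def)

lemma P_abs:
  assumes f: "integrable lborel (f :: 'a \<Rightarrow> real)"
  shows "P (abs_l1 f) = abs_l1 (\<lambda>v. f v + 1 / (2 * S) * collision f v)"
  unfolding P_def boltzmann_abs[OF f] scaleR_abs_l1[OF integrable_collision[OF f]]
  using integrable_collision[OF f] by (intro abs_l1_ops f) simp

text \<open>As the collision frequency is at most S, the coefficient 1 - r of f v, with r the
  frequency divided by 2 S, is nonnegative. The mass it withholds pays for the gain, by
  \<open>integral_abs_gain_le\<close>.\<close>

lemma norm_P_le: "norm (P F) \<le> norm F"
proof -
  define f where "f = rep_l1 F"
  have f: "integrable lborel f" and F: "F = abs_l1 f" by (simp_all add: f_def)
  have iK: "integrable lborel (\<lambda>v. \<bar>gain \<gamma> b f v\<bar>)" by (rule integrable_abs[OF integrable_gain[OF f]])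
  have iS: "integrable lborel (\<lambda>v. coll_freq \<gamma> b v * \<bar>f v\<bar>)" by (rule integrable_freq[OF integrable_abs[OF f]])
  have "norm (P F) = (\<integral>v. \<bar>f v + 1 / (2 * S) * collision f v\<bar> \<partial>lborel)"
    unfolding F P_abs[OF f] using f integrable_collision[OF f] by (intro norm_abs_l1) simp
  also have "\<dots> \<le> (\<integral>v. \<bar>f v\<bar> - 1 / (2 * S) * (coll_freq \<gamma> b v * \<bar>f v\<bar>) + 1 / (2 * S) * \<bar>gain \<gamma> b f v\<bar> \<partial>lborel)"
  proof (rule integral_mono)
    show "integrable lborel (\<lambda>v. \<bar>f v + 1 / (2 * S) * collision f v\<bar>)"
      using f integrable_collision[OF f] by simp
    show "integrable lborel (\<lambda>v. \<bar>f v\<bar> - 1 / (2 * S) * (coll_freq \<gamma> b v * \<bar>f v\<bar>) + 1 / (2 * S) * \<bar>gain \<gamma> b f v\<bar>)"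
      using f iK iS integrable_gain[OF f] by simp
    fix v :: 'a
    define r where "r = coll_freq \<gamma> b v / (2 * S)"
    have r: "0 \<le> r" "r \<le> 1"
      using coll_freq_nonneg[of v] coll_freq_le[of v] S_pos by (auto simp: r_def field_simps)
    have "f v + 1 / (2 * S) * collision f v = (1 - r) * f v + 1 / (2 * S) * gain \<gamma> b f v"
      by (simp add: collision_def r_def algebra_simps)
    then have "\<bar>f v + 1 / (2 * S) * collision f v\<bar> \<le> \<bar>(1 - r) * f v\<bar> + \<bar>1 / (2 * S) * gain \<gamma> b f v\<bar>"
      by (simp only: abs_triangle_ineq)
    also have "\<dots> = (1 - r) * \<bar>f v\<bar> + 1 / (2 * S) * \<bar>gain \<gamma> b f v\<bar>"
      using r S_pos by (simp add: abs_mult)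
    also have "\<dots> = \<bar>f v\<bar> - 1 / (2 * S) * (coll_freq \<gamma> b v * \<bar>f v\<bar>) + 1 / (2 * S) * \<bar>gain \<gamma> b f v\<bar>"
      by (simp add: r_def algebra_simps)
    finally show "\<bar>f v + 1 / (2 * S) * collision f v\<bar>
        \<le> \<bar>f v\<bar> - 1 / (2 * S) * (coll_freq \<gamma> b v * \<bar>f v\<bar>) + 1 / (2 * S) * \<bar>gain \<gamma> b f v\<bar>" .
  qed
  also have "\<dots> = (\<integral>v. \<bar>f v\<bar> \<partial>lborel) - 1 / (2 * S) * (\<integral>v. coll_freq \<gamma> b v * \<bar>f v\<bar> \<partial>lborel)
      + 1 / (2 * S) * (\<integral>v. \<bar>gain \<gamma> b f v\<bar> \<partial>lborel)"
    using f iK iS integrable_gain[OF f] by simp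
  also have "\<dots> \<le> (\<integral>v. \<bar>f v\<bar> \<partial>lborel)"
    using mult_left_mono[OF integral_abs_gain_le[OF f], of "1 / (2 * S)"] S_pos by simp
  also have "\<dots> = norm F" unfolding F by (rule norm_abs_l1[OF f, symmetric])
  finally show ?thesis .
qed

lemma boltzmann_linear: "boltzmann \<gamma> b (c *\<^sub>R F + G) = c *\<^sub>R boltzmann \<gamma> b F + boltzmann \<gamma> b (G :: 'a l1)"
proof -
  define f g where "f = rep_l1 F" and "g = rep_l1 G"
  have f: "integrable lborel f" "F = abs_l1 f" and g: "integrable lborel g" "G = abs_l1 g"
    by (simp_all add: f_def g_def)
  have cf: "integrable lborel (\<lambda>x. c * f x)" using f(1) by simp
  have s: "integrable lborel (\<lambda>x. c * f x + g x)" using f(1) g(1) by simp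
  have "c *\<^sub>R F + G = abs_l1 (\<lambda>x. c * f x + g x)"
    unfolding f(2) g(2) scaleR_abs_l1[OF f(1)] by (rule abs_l1_ops(1)[OF cf g(1)])
  then have "boltzmann \<gamma> b (c *\<^sub>R F + G) = abs_l1 (collision (\<lambda>x. c * f x + g x))"
    using boltzmann_abs[OF s] by simp
  also have "\<dots> = abs_l1 (\<lambda>v. c * collision f v + collision g v)"
    using collision_linear[OF f(1) g(1)] integrable_collision[OF s] integrable_collision[OF f(1)] integrable_collision[OF g(1)]
    by (intro abs_l1_eqI) auto
  also have "\<dots> = c *\<^sub>R boltzmann \<gamma> b F + boltzmann \<gamma> b G"
    unfolding f(2) g(2) boltzmann_abs[OF f(1)] boltzmann_abs[OF g(1)] scaleR_abs_l1[OF integrable_collision[OF f(1)]]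
    using integrable_collision[OF f(1)] integrable_collision[OF g(1)] by (intro abs_l1_ops(1)[symmetric]) auto
  finally show ?thesis .
qed

lemma bounded_linear_P: "bounded_linear P"
proof (rule bounded_linear_intro[where K=1])
  fix F G :: "'a l1" and c :: real
  have b0: "boltzmann \<gamma> b (0 :: 'a l1) = 0"
    using boltzmann_linear[of 1 "0 :: 'a l1" 0] by simp
  show "P (F + G) = P F + P G"
    using boltzmann_linear[of 1 F G] by (simp add: P_def scaleR_add_right)
  show "P (c *\<^sub>R F) = c *\<^sub>R P F"
    using boltzmann_linear[of c F 0] by (simp add: P_def b0 scaleR_add_right)
  show "norm (P F) \<le> norm F * 1" using norm_P_le by simp
qed

section \<open>Convergence of the powers, by density of bounded multiples of the Maxwellian\<close>

lemma integrable_maxwellian_mult: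
  assumes "h \<in> bdd_meas \<mu>"
  shows "integrable lborel (\<lambda>v. maxwellian v * h v)"
proof -
  obtain C where [measurable]: "h \<in> borel_measurable borel" and C: "\<And>x. \<bar>h x\<bar> \<le> C"
    using assms by (auto simp: bdd_meas_\<mu>)
  show ?thesis
  proof (rule Bochner_Integration.integrable_bound)
    show "integrable lborel (\<lambda>v::'a. maxwellian v * C)" using integrable_maxwellian[where 'a='a] by simp
    show "AE v in lborel. norm (maxwellian v * h v) \<le> norm (maxwellian v * C)"
      using order_trans[OF C abs_ge_self] by (auto simp: abs_mult intro!: mult_left_mono)
  qed measurable
qed

text \<open>Conservation of energy replaces the product of outgoing Maxwellians by the incoming one,
  and the factor M(v) leaves the integral.\<close>

lemma gain_maxwellian_mult:
  assumes h: "h \<in> bdd_meas \<mu>"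
  shows "gain \<gamma> b (\<lambda>v. maxwellian v * h v) v = maxwellian v * scatter h v"
proof -
  have [measurable]: "h \<in> borel_measurable borel" using h by (auto simp: bdd_meas_\<mu>)
  have "gain \<gamma> b (\<lambda>v. maxwellian v * h v) v
      = (\<integral>p. kern v (fst p) (snd p) * (maxwellian (post v (fst p) (snd p)) * h (post v (fst p) (snd p))) *
        maxwellian (post_star v (fst p) (snd p)) \<partial>(lborel \<Otimes>\<^sub>M sph))"
    by (rule gain_eq) measurable
  also have "\<dots> = (\<integral>p. maxwellian v * (kern v (fst p) (snd p) * maxwellian (fst p) * h (post v (fst p) (snd p))) \<partial>(lborel \<Otimes>\<^sub>M sph))"
  proof (rule integral_cong_AE)
    show "AE p in lborel \<Otimes>\<^sub>M sph. kern v (fst p) (snd p) * (maxwellian (post v (fst p) (snd p)) * h (post v (fst p) (snd p))) *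
        maxwellian (post_star v (fst p) (snd p))
        = maxwellian v * (kern v (fst p) (snd p) * maxwellian (fst p) * h (post v (fst p) (snd p)))"
      using AE_pair_sph_norm
    proof eventually_elim
      case (elim p)
      show ?case using maxwellian_collision[OF elim, of v "fst p"] by algebra
    qed
  qed measurable
  also have "\<dots> = maxwellian v * scatter h v"
    unfolding scatter_def by (rule integral_mult_right_zero)
  finally show ?thesis .
qed

lemma P_maxwellian_mult:
  assumes h: "h \<in> bdd_meas \<mu>"
  shows "P (abs_l1 (\<lambda>v. maxwellian v * h v)) = abs_l1 (\<lambda>v. maxwellian v * Q h v)"
proof -
  have "maxwellian v * h v + 1 / (2 * S) * collision (\<lambda>v. maxwellian v * h v) v = maxwellian v * Q h v" for v
    using S_pos by (simp add: collision_def gain_maxwellian_mult[OF h] Q_def field_simps)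
  then show ?thesis by (simp only: P_abs[OF integrable_maxwellian_mult[OF h]])
qed

lemma P_pow_maxwellian_mult:
  assumes h: "h \<in> bdd_meas \<mu>"
  shows "(P ^^ n) (abs_l1 (\<lambda>v. maxwellian v * h v)) = abs_l1 (\<lambda>v. maxwellian v * (Q ^^ n) h v)"
  by (induction n) (simp_all add: P_maxwellian_mult Q_pow_bdd[OF h])

lemma integral_\<mu>:
  assumes "h \<in> bdd_meas \<mu>"
  shows "(\<integral>v. h v \<partial>\<mu>) = (\<integral>v. maxwellian v * h v \<partial>lborel)"
  using assms unfolding \<mu>_def[of] bdd_meas_def
  by (subst integral_density) (auto simp: less_imp_le[OF maxwellian_pos])

text \<open>The norm of the class of M h is the L^1 norm of h for \<open>\<mu>\<close>, and its
  total mass is the mean of h, so \<open>Q_pow_tendsto_mean\<close> carries over.\<close>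

lemma P_pow_tendsto_dense:
  assumes h: "h \<in> bdd_meas \<mu>" and F: "F = abs_l1 (\<lambda>v. maxwellian v * h v)"
  shows "(\<lambda>n. (P ^^ n) F) \<longlonglongrightarrow> l1_integral F *\<^sub>R abs_l1 maxwellian"
proof -
  define c where "c = (\<integral>v. h v \<partial>\<mu>)"
  have c: "l1_integral F = c"
    unfolding F l1_integral_abs_l1[OF integrable_maxwellian_mult[OF h]] c_def by (rule integral_\<mu>[OF h, symmetric])
  have "norm ((P ^^ n) F - l1_integral F *\<^sub>R abs_l1 maxwellian) = (\<integral>v. \<bar>(Q ^^ n) h v - c\<bar> \<partial>\<mu>)" for n
  proof -
    have d: "(\<lambda>v. (Q ^^ n) h v - c) \<in> bdd_meas \<mu>" by (intro bdd_meas_diff bdd_meas_const Q_pow_bdd h)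
    then have ad: "(\<lambda>v. \<bar>(Q ^^ n) h v - c\<bar>) \<in> bdd_meas \<mu>" by (auto simp: bdd_meas_\<mu>)
    have "(P ^^ n) F - l1_integral F *\<^sub>R abs_l1 maxwellian
        = abs_l1 (\<lambda>v. maxwellian v * (Q ^^ n) h v) - abs_l1 (\<lambda>v. c * maxwellian v)"
      unfolding c by (simp add: F P_pow_maxwellian_mult[OF h] scaleR_abs_l1[OF integrable_maxwellian])
    also have "\<dots> = abs_l1 (\<lambda>v. maxwellian v * (Q ^^ n) h v - c * maxwellian v)"
      using integrable_maxwellian[where 'a='a] by (intro abs_l1_ops(2) integrable_maxwellian_mult Q_pow_bdd h) simp
    also have "(\<lambda>v. maxwellian v * (Q ^^ n) h v - c * maxwellian v) = (\<lambda>v. maxwellian v * ((Q ^^ n) h v - c))"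
      by (simp add: algebra_simps)
    finally have "norm ((P ^^ n) F - l1_integral F *\<^sub>R abs_l1 maxwellian) = (\<integral>v. \<bar>maxwellian v * ((Q ^^ n) h v - c)\<bar> \<partial>lborel)"
      by (simp only: norm_abs_l1[OF integrable_maxwellian_mult[OF d]])
    then show ?thesis
      unfolding integral_\<mu>[OF ad] by (simp add: abs_mult less_imp_le[OF maxwellian_pos])
  qed
  then have "(\<lambda>n. norm ((P ^^ n) F - l1_integral F *\<^sub>R abs_l1 maxwellian)) \<longlonglongrightarrow> 0"
    using Q_pow_tendsto_mean[OF h] by (simp add: c_def)
  then show ?thesis by (simp add: tendsto_norm_zero_iff LIM_zero_iff)
qed

text \<open>Truncate f / M at height n. Truncation only lowers absolute values, so dominated
  convergence applies with majorant 2 |f|.\<close>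

lemma dense_maxwellian_mult:
  assumes "e > 0"
  shows "\<exists>h\<in>bdd_meas \<mu>. norm (F - abs_l1 (\<lambda>v. maxwellian v * h v)) < e"
proof -
  define f where "f = rep_l1 F"
  have f: "integrable lborel f" and F: "F = abs_l1 f" by (simp_all add: f_def)
  have [measurable]: "f \<in> borel_measurable borel" using f by auto
  define h where "h n v = max (- real n) (min (real n) (f v / maxwellian v))" for n v
  have h: "h n \<in> bdd_meas \<mu>" for n
    unfolding bdd_meas_\<mu> by (auto simp: h_def[abs_def] intro!: exI[of _ "real n"])
  have "(\<lambda>n. \<integral>v. \<bar>f v - maxwellian v * h n v\<bar> \<partial>lborel) \<longlonglongrightarrow> (\<integral>v. 0 \<partial>(lborel :: 'a measure))"
  proof (rule integral_dominated_convergence[where w="\<lambda>v. 2 * \<bar>f v\<bar>"])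
    show "(\<lambda>v. \<bar>f v - maxwellian v * h n v\<bar>) \<in> borel_measurable lborel" for n
      using bdd_meas_measurable[OF h[of n]] by (simp add: measurable_cong_sets[OF sets_\<mu> refl])
    show "integrable lborel (\<lambda>v. 2 * \<bar>f v\<bar>)" using f by simp
    show "AE v in lborel. norm \<bar>f v - maxwellian v * h n v\<bar> \<le> 2 * \<bar>f v\<bar>" for n
    proof (rule AE_I2)
      fix v
      have "\<bar>h n v\<bar> \<le> \<bar>f v / maxwellian v\<bar>" unfolding h_def by linarith
      then have "maxwellian v * \<bar>h n v\<bar> \<le> maxwellian v * \<bar>f v / maxwellian v\<bar>"
        using maxwellian_pos[of v] by (intro mult_left_mono) auto
      also have "\<dots> = \<bar>f v\<bar>" using maxwellian_pos[of v] by simp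
      finally have "\<bar>maxwellian v * h n v\<bar> \<le> \<bar>f v\<bar>"
        using maxwellian_pos[of v] by (simp add: abs_mult)
      then show "norm \<bar>f v - maxwellian v * h n v\<bar> \<le> 2 * \<bar>f v\<bar>" by simp
    qed
    show "AE v in lborel. (\<lambda>n. \<bar>f v - maxwellian v * h n v\<bar>) \<longlonglongrightarrow> 0"
    proof (rule AE_I2)
      fix v
      obtain k :: nat where k: "\<bar>f v / maxwellian v\<bar> \<le> real k" using real_arch_simple by blast
      have "\<forall>\<^sub>F n in sequentially. \<bar>f v - maxwellian v * h n v\<bar> = 0"
        using eventually_ge_at_top[of k]
      proof eventually_elim
        case (elim n)
        then have "\<bar>f v / maxwellian v\<bar> \<le> real n" using k by linarith
        then have "h n v = f v / maxwellian v" unfolding h_def by linarith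
        then show ?case using maxwellian_pos[of v] by simp
      qed
      then show "(\<lambda>n. \<bar>f v - maxwellian v * h n v\<bar>) \<longlonglongrightarrow> 0" by (rule tendsto_eventually)
    qed
  qed simp
  then have "(\<lambda>n. \<integral>v. \<bar>f v - maxwellian v * h n v\<bar> \<partial>lborel) \<longlonglongrightarrow> 0" by simp
  from order_tendstoD(2)[OF this assms] obtain n where n: "(\<integral>v. \<bar>f v - maxwellian v * h n v\<bar> \<partial>lborel) < e"
    by (auto simp: eventually_sequentially)
  have "F - abs_l1 (\<lambda>v. maxwellian v * h n v) = abs_l1 (\<lambda>v. f v - maxwellian v * h n v)"
    unfolding F by (intro abs_l1_ops(2) f integrable_maxwellian_mult h)
  moreover have "norm (abs_l1 (\<lambda>v. f v - maxwellian v * h n v)) = (\<integral>v. \<bar>f v - maxwellian v * h n v\<bar> \<partial>lborel)"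
    using f integrable_maxwellian_mult[OF h] by (intro norm_abs_l1) simp
  ultimately show ?thesis using h n by (intro bexI[of _ "h n"]) auto
qed

lemma norm_maxwellian: "norm (abs_l1 (maxwellian :: 'a \<Rightarrow> real)) = 1"
  using norm_abs_l1[OF integrable_maxwellian, where 'a='a]
  by (simp add: less_imp_le[OF maxwellian_pos] integral_maxwellian)

lemma l1_integral_diff_le: "\<bar>l1_integral F - l1_integral G\<bar> \<le> norm (F - G :: 'a l1)"
proof -
  define f g where "f = rep_l1 F" and "g = rep_l1 G"
  have f: "integrable lborel f" "F = abs_l1 f" and g: "integrable lborel g" "G = abs_l1 g"
    by (simp_all add: f_def g_def)
  have "l1_integral F - l1_integral G = (\<integral>x. f x - g x \<partial>lborel)"
    using f g by (simp add: l1_integral_abs_l1)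
  also have "\<bar>\<dots>\<bar> \<le> (\<integral>x. \<bar>f x - g x\<bar> \<partial>lborel)" by (rule integral_abs_bound)
  also have "\<dots> = norm (F - G)"
    using f g by (simp add: abs_l1_ops(2) norm_abs_l1)
  finally show ?thesis .
qed

text \<open>Three errors of size e / 3: the approximation carried along by the contraction P^n, the
  convergence for the approximant G, and the change of total mass, at most the norm of F - G because
  the Maxwellian has norm 1.\<close>

lemma P_pow_tendsto: "(\<lambda>n. (P ^^ n) F) \<longlonglongrightarrow> l1_integral F *\<^sub>R abs_l1 maxwellian"
proof (rule LIMSEQ_I)
  interpret P: bounded_linear P by (rule bounded_linear_P)
  have Pdiff: "(P ^^ n) (A - B) = (P ^^ n) A - (P ^^ n) B" for n A B
    by (induction n) (simp_all add: P.diff)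
  have Pnorm: "norm ((P ^^ n) A) \<le> norm A" for n A
    by (induction n) (auto intro: order_trans[OF norm_P_le])
  let ?m = "abs_l1 maxwellian :: 'a l1"
  fix e :: real assume e: "e > 0"
  then obtain h where h: "h \<in> bdd_meas \<mu>" "norm (F - abs_l1 (\<lambda>v. maxwellian v * h v)) < e / 3"
    using dense_maxwellian_mult[of "e / 3" F] by auto
  define G where "G = abs_l1 (\<lambda>v. maxwellian v * h v)"
  have FG: "norm (F - G) < e / 3" using h(2) by (simp add: G_def)
  obtain N where N: "\<And>n. n \<ge> N \<Longrightarrow> norm ((P ^^ n) G - l1_integral G *\<^sub>R ?m) < e / 3"
    using LIMSEQ_D[OF P_pow_tendsto_dense[OF h(1) G_def], of "e / 3"] e by auto
  have "norm ((P ^^ n) F - l1_integral F *\<^sub>R ?m) < e" if "n \<ge> N" for n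
  proof -
    have "(P ^^ n) F - l1_integral F *\<^sub>R ?m
        = (P ^^ n) (F - G) + (((P ^^ n) G - l1_integral G *\<^sub>R ?m) + (l1_integral G - l1_integral F) *\<^sub>R ?m)"
      by (simp add: Pdiff scaleR_diff_left)
    also have "norm \<dots> \<le> norm ((P ^^ n) (F - G)) + (norm ((P ^^ n) G - l1_integral G *\<^sub>R ?m)
        + norm ((l1_integral G - l1_integral F) *\<^sub>R ?m))"
      by (intro order_trans[OF norm_triangle_ineq] add_mono order_refl norm_triangle_ineq)
    also have "norm ((l1_integral G - l1_integral F) *\<^sub>R ?m) \<le> norm (F - G)"
      using l1_integral_diff_le[of G F] by (simp add: norm_maxwellian norm_minus_commute)
    finally show ?thesis using Pnorm[of n "F - G"] FG N[OF that] by linarith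
  qed
  then show "\<exists>N. \<forall>n\<ge>N. norm ((P ^^ n) F - l1_integral F *\<^sub>R ?m) < e" by blast
qed

lemma bounded_linear_boltzmann: "bounded_linear (boltzmann \<gamma> b :: 'a l1 \<Rightarrow> 'a l1)"
  unfolding boltzmann_P[abs_def]
  by (intro bounded_linear_const_scaleR bounded_linear_sub bounded_linear_P bounded_linear_ident)

lemma generated_semigroup_tendsto:
  assumes "generates (boltzmann \<gamma> b) V"
  shows "((\<lambda>t. V t F) \<longlongrightarrow> l1_integral F *\<^sub>R abs_l1 (maxwellian :: 'a \<Rightarrow> real)) at_top"
proof (rule Lim_transform_eventually)
  show "((\<lambda>t. bop_apply (exp (t *\<^sub>R bop_of (\<lambda>F. (2 * S) *\<^sub>R (P F - F)))) F) \<longlongrightarrow>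
      l1_integral F *\<^sub>R abs_l1 maxwellian) at_top"
    using S_pos by (intro poisson_average_tendsto bounded_linear_P P_pow_tendsto) simp
  show "\<forall>\<^sub>F t in at_top. bop_apply (exp (t *\<^sub>R bop_of (\<lambda>F. (2 * S) *\<^sub>R (P F - F)))) F = V t F"
    using eventually_ge_at_top[of 0]
    by eventually_elim
      (simp add: generates_unique[OF bounded_linear_boltzmann assms] boltzmann_P[abs_def])
qed

end

theorem theorem1p2:
  fixes \<gamma> :: real and b :: "real \<Rightarrow> real"
  assumes "DIM('a::euclidean_space) \<ge> 2"
    and "- real DIM('a) < \<gamma>" and "\<gamma> < 0"
    and "b \<in> borel_measurable (restrict_space borel {-1..1})"
    and "\<And>x. x \<in> {-1..1} \<Longrightarrow> 0 \<le> b x"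
    and "\<And>v w :: 'a. v \<noteq> w \<Longrightarrow> angular_mass b v w < \<infinity>"
    and "\<And>v w :: 'a. v \<noteq> w \<Longrightarrow> 0 < angular_mass b v w"
  shows "is_direct_sum {f :: 'a l1. boltzmann \<gamma> b f = 0}
           (closure (range (boltzmann \<gamma> b :: 'a l1 \<Rightarrow> 'a l1)))
    \<and> (\<exists>V. generates (boltzmann \<gamma> b :: 'a l1 \<Rightarrow> 'a l1) V)
    \<and> (\<forall>V. generates (boltzmann \<gamma> b :: 'a l1 \<Rightarrow> 'a l1) V \<longrightarrow>
         (\<forall>f. l1_nonneg f \<longrightarrow>
           ((\<lambda>t. norm (V t f - l1_integral f *\<^sub>R abs_l1 maxwellian)) \<longlongrightarrow> 0) at_top))"
proof -
  interpret linear_boltzmann \<gamma> b "TYPE('a)"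
    using assms by unfold_locales
  have "is_direct_sum {f :: 'a l1. boltzmann \<gamma> b f = 0} (closure (range (boltzmann \<gamma> b :: 'a l1 \<Rightarrow> 'a l1)))"
    unfolding boltzmann_P[abs_def]
    using S_pos
    by (intro direct_sum_of_convergent_powers[where L="\<lambda>f. l1_integral f *\<^sub>R abs_l1 maxwellian"]
        bounded_linear_P norm_P_le P_pow_tendsto) simp
  moreover have "\<exists>V. generates (boltzmann \<gamma> b :: 'a l1 \<Rightarrow> 'a l1) V"
    using exp_semigroup_generates[OF bounded_linear_boltzmann] by blast
  moreover have "((\<lambda>t. norm (V t f - l1_integral f *\<^sub>R abs_l1 maxwellian)) \<longlongrightarrow> 0) at_top"
    if "generates (boltzmann \<gamma> b :: 'a l1 \<Rightarrow> 'a l1) V" for V f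
    using generated_semigroup_tendsto[OF that, of f] by (simp add: tendsto_norm_zero_iff LIM_zero_iff)
  ultimately show ?thesis by blast
qed

end
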